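(* Let $\Phi:\mathcal{L}(\mathcal{H})\to\mathcal{L}(\mathcal{K})$ be a quantum channel. If $\Phi$ admits a dominating transmittable algebra $\mathscr{A}_{\mathrm{dom}}(\Phi)$, then $N_d(\Phi)\geq0$ for every $d\in\{1,\ldots,d_{\max}(\Phi)\}$, and $$\mathscr{A}_{\mathrm{dom}}(\Phi)\cong\mathscr{A}_{\mathrm{cap}}(\Phi).$$ More generally, whenever $\mathscr{A}_{\mathrm{cap}}(\Phi)$ is defined (i.e. all $N_d(\Phi)\ge 0$) and transmittable via $\Phi$, it is a maximal transmittable algebra for $\Phi$.
   Context: All Hilbert spaces are finite-dimensional and complex; all $C^*$-algebras are finite-dimensional and nonzero. $\mathcal{L}(\mathcal{H})$ is the algebra of linear operators on $\mathcal{H}$. A quantum channel is a linear, completely positive, trace-preserving map $\Phi:\mathcal{L}(\mathcal{H})\to\mathcal{L}(\mathcal{K})$; its adjoint $\Phi^*$ is defined by $\mathrm{Tr}(Y\Phi(X))=\mathrm{Tr}(\Phi^*(Y)X)$. $\cong$ denotes $*$-isomorphism. Embedding: $\mathscr{A}\leq\mathscr{B}$ means there is an injective (not necessarily unital) $*$-homomorphism $\mathscr{A}\to\mathscr{B}$. Correctability: a $*$-subalgebra $\mathscr{A}\subseteq\mathcal{L}(\mathcal{H})$ with unit projection $P$ (possibly $P\neq 1_{\mathcal{H}}$) is correctable for $\Phi$ if, with $C=P\mathcal{H}$, $V:C\to\mathcal{H}$ the inclusion and $\Phi|_C(Y)=\Phi(VYV^* )$, there is a channel $\mathcal{D}:\mathcal{L}(\mathcal{K})\to\mathcal{L}(C)$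 with $(\mathcal{D}\circ\Phi|_C)^*(X)=X$ for all $X\in V^*\mathscr{A}V$. $\mathscr{A}$ is transmittable via $\Phi$ if there is an injective $*$-homomorphism $\pi:\mathscr{A}\to\mathcal{L}(\mathcal{H})$ whose image is correctable for $\Phi$; $\mathscr{T}(\Phi)$ is the set of transmittable algebras up to $*$-isomorphism. $\mathscr{A}\in\mathscr{T}(\Phi)$ is maximal if $\mathscr{B}\in\mathscr{T}(\Phi)$ and $\mathscr{A}\leq\mathscr{B}$ imply $\mathscr{A}\cong\mathscr{B}$; it is dominating (denoted $\mathscr{A}_{\mathrm{dom}}(\Phi)$) if $\mathscr{B}\leq\mathscr{A}$ for every $\mathscr{B}\in\mathscr{T}(\Phi)$. Hybrid capacities: $d_{\max}(\Phi)=\max\{d\in\mathbb{N}:\mathbb{M}_d(\mathbb{C})\in\mathscr{T}(\Phi)\}$, and for $1\le d\le d_{\max}(\Phi)$, $c_d(\Phi)=\max\{c\in\mathbb{N}:\mathbb{M}_d(\mathbb{C})^{\oplus c}\in\mathscr{T}(\Phi)\}$. Define integers recursively (descending in $d$) by $N_{d_{\max}(\Phi)}(\Phi)=c_{d_{\max}(\Phi)}(\Phi)$ and $$N_d(\Phi)=c_d(\Phi)-\sum_{m=d+1}^{d_{\max}(\Phi)}N_m(\Phi)\left\lfloor\frac{m}{d}\right\rfloor,\qquad 1\leq d<d_{\max}(\Phi).$$ When all $N_d(\Phi)\ge0$, the capacity algebra is defined as $\mathscr{A}_{\mathrm{cap}}(\Phi)=\bigoplus_{d=1}^{d_{\max}(\Phi)}\mathbb{M}_d(\mathbb{C})^{\oplus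 N_d(\Phi)}$, with summands of zero multiplicity omitted. *)

theory Defs
  imports "Jordan_Normal_Form.Schur_Decomposition" "HOL-Algebra.Ring"
begin

hide_const (open) Multiset.mult Polynomial.smult Modules.module

section \<open>Finite-dimensional C*-algebras\<close>

record 'a star_algebra = "(complex, 'a) module" +
  adj :: "'a \<Rightarrow> 'a"

text \<open>A finite-dimensional C*-algebra always has a unit, so requiring one (as \<^locale>\<open>ring\<close> does)
  excludes nothing; homomorphisms below are not required to preserve it. The C*-norm is determined
  by the *-algebra structure and is therefore not a field of the record; its completeness is
  automatic in finite dimension. The zero algebra is excluded.\<close>

definition fd_cstar_algebra :: "'a star_algebra \<Rightarrow> bool" where
  "fd_cstar_algebra A \<longleftrightarrow>
     ring A \<and> vectorspace class_ring A \<and> vectorspace.fin_dim class_ring A \<and>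
     \<one>\<^bsub>A\<^esub> \<noteq> \<zero>\<^bsub>A\<^esub> \<and>
     (\<forall>c. \<forall>x\<in>carrier A. \<forall>y\<in>carrier A.
        (c \<odot>\<^bsub>A\<^esub> x) \<otimes>\<^bsub>A\<^esub> y = c \<odot>\<^bsub>A\<^esub> (x \<otimes>\<^bsub>A\<^esub> y) \<and>
        x \<otimes>\<^bsub>A\<^esub> (c \<odot>\<^bsub>A\<^esub> y) = c \<odot>\<^bsub>A\<^esub> (x \<otimes>\<^bsub>A\<^esub> y)) \<and>
     (\<forall>x\<in>carrier A. adj A x \<in> carrier A \<and> adj A (adj A x) = x) \<and>
     (\<forall>x\<in>carrier A. \<forall>y\<in>carrier A.
        adj A (x \<oplus>\<^bsub>A\<^esub> y) = adj A x \<oplus>\<^bsub>A\<^esub> adj A y \<and>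
        adj A (x \<otimes>\<^bsub>A\<^esub> y) = adj A y \<otimes>\<^bsub>A\<^esub> adj A x) \<and>
     (\<forall>c. \<forall>x\<in>carrier A. adj A (c \<odot>\<^bsub>A\<^esub> x) = cnj c \<odot>\<^bsub>A\<^esub> adj A x) \<and>
     (\<exists>\<nu> :: 'a \<Rightarrow> real.
        (\<forall>x\<in>carrier A. 0 \<le> \<nu> x \<and> (\<nu> x = 0 \<longleftrightarrow> x = \<zero>\<^bsub>A\<^esub>)) \<and>
        (\<forall>c. \<forall>x\<in>carrier A. \<nu> (c \<odot>\<^bsub>A\<^esub> x) = cmod c * \<nu> x) \<and>
        (\<forall>x\<in>carrier A. \<forall>y\<in>carrier A.
           \<nu> (x \<oplus>\<^bsub>A\<^esub> y) \<le> \<nu> x + \<nu> y \<and> \<nu> (x \<otimes>\<^bsub>A\<^esub> y) \<le> \<nu> x * \<nu> y) \<and>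
        (\<forall>x\<in>carrier A. \<nu> (adj A x \<otimes>\<^bsub>A\<^esub> x) = (\<nu> x)\<^sup>2))"

definition star_hom :: "'a star_algebra \<Rightarrow> 'b star_algebra \<Rightarrow> ('a \<Rightarrow> 'b) set" where
  "star_hom A B = {f \<in> carrier A \<rightarrow> carrier B.
     (\<forall>x\<in>carrier A. \<forall>y\<in>carrier A.
        f (x \<oplus>\<^bsub>A\<^esub> y) = f x \<oplus>\<^bsub>B\<^esub> f y \<and> f (x \<otimes>\<^bsub>A\<^esub> y) = f x \<otimes>\<^bsub>B\<^esub> f y) \<and>
     (\<forall>c. \<forall>x\<in>carrier A. f (c \<odot>\<^bsub>A\<^esub> x) = c \<odot>\<^bsub>B\<^esub> f x) \<and>
     (\<forall>x\<in>carrier A. f (adj A x) = adj B (f x))}"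

definition star_embeds :: "'a star_algebra \<Rightarrow> 'b star_algebra \<Rightarrow> bool" where
  "star_embeds A B \<longleftrightarrow> (\<exists>f\<in>star_hom A B. inj_on f (carrier A))"

definition star_iso :: "'a star_algebra \<Rightarrow> 'b star_algebra \<Rightarrow> bool" where
  "star_iso A B \<longleftrightarrow> (\<exists>f\<in>star_hom A B. bij_betw f (carrier A) (carrier B))"

definition mat_algebra :: "nat \<Rightarrow> complex mat star_algebra" where
  "mat_algebra d =
     \<lparr>carrier = carrier_mat d d, mult = (*), one = 1\<^sub>m d, zero = 0\<^sub>m d d, add = (+),
      smult = (\<cdot>\<^sub>m), adj = mat_adjoint\<rparr>"

text \<open>The direct sum of the full matrix algebras whose sizes are listed in \<open>ds\<close>.\<close>

definition mat_direct_sum :: "nat list \<Rightarrow> complex mat list star_algebra" where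
  "mat_direct_sum ds =
     \<lparr>carrier = {xs. list_all2 (\<lambda>x d. x \<in> carrier_mat d d) xs ds},
      mult = map2 (*), one = map 1\<^sub>m ds, zero = map (\<lambda>d. 0\<^sub>m d d) ds, add = map2 (+),
      smult = (\<lambda>c. map (\<lambda>x. c \<cdot>\<^sub>m x)), adj = map mat_adjoint\<rparr>"


section \<open>Quantum channels\<close>

text \<open>The Hilbert space is \<open>\<complex>\<^sup>n\<close>, and \<open>\<L>(\<complex>\<^sup>n)\<close> is \<^term>\<open>carrier_mat n n\<close>.
  Only the values of a channel on this carrier matter.\<close>

definition mtrace :: "complex mat \<Rightarrow> complex" where
  "mtrace A = (\<Sum>i<dim_row A. A $$ (i, i))"

text \<open>In the order on \<^typ>\<open>complex\<close>, \<open>0 \<le> z\<close> says that \<open>z\<close> is real and nonnegative.\<close>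

definition psd :: "nat \<Rightarrow> complex mat \<Rightarrow> bool" where
  "psd n A \<longleftrightarrow> A \<in> carrier_mat n n \<and> (\<forall>v\<in>carrier_vec n. 0 \<le> (A *\<^sub>v v) \<bullet>c v)"

text \<open>\<open>id\<^sub>k \<otimes> \<Phi>\<close>, where \<open>\<complex>\<^sup>k \<otimes> \<complex>\<^sup>n\<close> is identified with \<open>\<complex>\<^sup>k\<^sup>n\<close> through
  \<open>e\<^sub>i \<otimes> e\<^sub>a \<mapsto> e\<^sub>i\<^sub>n\<^sub>+\<^sub>a\<close>: the map \<open>\<Phi>\<close> is applied to each \<open>n \<times> n\<close> block.\<close>

definition mat_block :: "nat \<Rightarrow> complex mat \<Rightarrow> nat \<Rightarrow> nat \<Rightarrow> complex mat" where
  "mat_block n X i j = mat n n (\<lambda>(a, b). X $$ (i * n + a, j * n + b))"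

definition ampliation ::
  "nat \<Rightarrow> nat \<Rightarrow> nat \<Rightarrow> (complex mat \<Rightarrow> complex mat) \<Rightarrow> complex mat \<Rightarrow> complex mat" where
  "ampliation k n m \<Phi> X =
     mat (k * m) (k * m) (\<lambda>(r, s). \<Phi> (mat_block n X (r div m) (s div m)) $$ (r mod m, s mod m))"

definition completely_positive ::
  "nat \<Rightarrow> nat \<Rightarrow> (complex mat \<Rightarrow> complex mat) \<Rightarrow> bool" where
  "completely_positive n m \<Phi> \<longleftrightarrow> (\<forall>k X. psd (k * n) X \<longrightarrow> psd (k * m) (ampliation k n m \<Phi> X))"

definition quantum_channel ::
  "nat \<Rightarrow> nat \<Rightarrow> (complex mat \<Rightarrow> complex mat) \<Rightarrow> bool" where
  "quantum_channel n m \<Phi> \<longleftrightarrow>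
     \<Phi> \<in> carrier_mat n n \<rightarrow> carrier_mat m m \<and>
     (\<forall>X\<in>carrier_mat n n. \<forall>Y\<in>carrier_mat n n. \<Phi> (X + Y) = \<Phi> X + \<Phi> Y) \<and>
     (\<forall>c. \<forall>X\<in>carrier_mat n n. \<Phi> (c \<cdot>\<^sub>m X) = c \<cdot>\<^sub>m \<Phi> X) \<and>
     completely_positive n m \<Phi> \<and>
     (\<forall>X\<in>carrier_mat n n. mtrace (\<Phi> X) = mtrace X)"

definition map_adjoint ::
  "nat \<Rightarrow> (complex mat \<Rightarrow> complex mat) \<Rightarrow> complex mat \<Rightarrow> complex mat" where
  "map_adjoint n \<Phi> Y =
     (THE Z. Z \<in> carrier_mat n n \<and> (\<forall>X\<in>carrier_mat n n. mtrace (Y * \<Phi> X) = mtrace (Z * X)))"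


section \<open>Correctable and transmittable algebras\<close>

definition star_subalgebra :: "nat \<Rightarrow> complex mat set \<Rightarrow> bool" where
  "star_subalgebra n S \<longleftrightarrow>
     S \<subseteq> carrier_mat n n \<and> 0\<^sub>m n n \<in> S \<and>
     (\<forall>X\<in>S. \<forall>Y\<in>S. X + Y \<in> S \<and> X * Y \<in> S) \<and>
     (\<forall>c. \<forall>X\<in>S. c \<cdot>\<^sub>m X \<in> S) \<and>
     (\<forall>X\<in>S. mat_adjoint X \<in> S)"

text \<open>\<open>P\<close> is the unit of \<open>S\<close>; it need not be the identity matrix. An orthonormal basis identifies
  the range \<open>C\<close> of \<open>P\<close> with \<open>\<complex>\<^sup>r\<close>, and the inclusion of \<open>C\<close> then becomes an isometry \<open>V\<close>
  (\<open>V\<^sup>*V = 1\<close>) whose range projection \<open>VV\<^sup>*\<close> is \<open>P\<close>. The condition does not depend on which such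
  \<open>V\<close> is taken, since two of them differ by a unitary of \<open>\<complex>\<^sup>r\<close>.\<close>

definition correctable ::
  "nat \<Rightarrow> nat \<Rightarrow> (complex mat \<Rightarrow> complex mat) \<Rightarrow> complex mat set \<Rightarrow> bool" where
  "correctable n m \<Phi> S \<longleftrightarrow> star_subalgebra n S \<and>
     (\<exists>P\<in>S. (\<forall>X\<in>S. P * X = X \<and> X * P = X) \<and>
        (\<exists>r. \<exists>V\<in>carrier_mat n r. mat_adjoint V * V = 1\<^sub>m r \<and> V * mat_adjoint V = P \<and>
           (\<exists>D. quantum_channel m r D \<and>
              (\<forall>X \<in> (\<lambda>Y. mat_adjoint V * Y * V) ` S.
                 map_adjoint r (D \<circ> (\<lambda>Y. \<Phi> (V * Y * mat_adjoint V))) X = X))))"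

definition transmittable ::
  "nat \<Rightarrow> nat \<Rightarrow> (complex mat \<Rightarrow> complex mat) \<Rightarrow> 'a star_algebra \<Rightarrow> bool" where
  "transmittable n m \<Phi> A \<longleftrightarrow> fd_cstar_algebra A \<and>
     (\<exists>\<pi>\<in>star_hom A (mat_algebra n). inj_on \<pi> (carrier A) \<and> correctable n m \<Phi> (\<pi> ` carrier A))"

text \<open>In the next two definitions \<open>B\<close> ranges over algebras with elements of type
  \<^typ>\<open>complex mat\<close>. Every transmittable algebra is isomorphic to such an algebra, namely its
  image in \<open>\<L>(\<complex>\<^sup>n)\<close>, so that all isomorphism classes are covered; see the lemmas
  \<open>dominating_any_type\<close> and \<open>maximal_any_type\<close>.\<close>

definition maximal_transmittable ::
  "nat \<Rightarrow> nat \<Rightarrow> (complex mat \<Rightarrow> complex mat) \<Rightarrow> 'a star_algebra \<Rightarrow> bool" where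
  "maximal_transmittable n m \<Phi> A \<longleftrightarrow> transmittable n m \<Phi> A \<and>
     (\<forall>B :: complex mat star_algebra. transmittable n m \<Phi> B \<and> star_embeds A B \<longrightarrow> star_iso A B)"

definition dominating_transmittable ::
  "nat \<Rightarrow> nat \<Rightarrow> (complex mat \<Rightarrow> complex mat) \<Rightarrow> 'a star_algebra \<Rightarrow> bool" where
  "dominating_transmittable n m \<Phi> A \<longleftrightarrow> transmittable n m \<Phi> A \<and>
     (\<forall>B :: complex mat star_algebra. transmittable n m \<Phi> B \<longrightarrow> star_embeds B A)"


definition image_algebra :: "nat \<Rightarrow> ('a \<Rightarrow> complex mat) \<Rightarrow> 'a star_algebra \<Rightarrow> complex mat star_algebra" where
  "image_algebra n f A = (mat_algebra n)\<lparr>carrier := f ` carrier A, one := f \<one>\<^bsub>A\<^esub>\<rparr>"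

lemma image_algebra_sel [simp]:
  "carrier (image_algebra n f A) = f ` carrier A" "one (image_algebra n f A) = f \<one>\<^bsub>A\<^esub>"
  "zero (image_algebra n f A) = 0\<^sub>m n n" "mult (image_algebra n f A) = (*)"
  "add (image_algebra n f A) = (+)" "smult (image_algebra n f A) = (\<cdot>\<^sub>m)"
  "adj (image_algebra n f A) = mat_adjoint"
  by (simp_all add: image_algebra_def mat_algebra_def)

lemma mat_algebra_sel [simp]:
  "carrier (mat_algebra n) = carrier_mat n n" "one (mat_algebra n) = 1\<^sub>m n"
  "zero (mat_algebra n) = 0\<^sub>m n n" "mult (mat_algebra n) = (*)"
  "add (mat_algebra n) = (+)" "smult (mat_algebra n) = (\<cdot>\<^sub>m)"
  "adj (mat_algebra n) = mat_adjoint"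
  by (simp_all add: mat_algebra_def)

lemma fd_cstar_image_algebra:
  assumes A: "fd_cstar_algebra A" and f: "f \<in> star_hom A (mat_algebra n)"
    and inj: "inj_on f (carrier A)"
  shows "fd_cstar_algebra (image_algebra n f A)"
proof -
  let ?I = "image_algebra n f A"
  interpret A: ring A using A by (simp add: fd_cstar_algebra_def)
  interpret V: vectorspace class_ring A using A by (simp add: fd_cstar_algebra_def)
  have fd: "V.fin_dim" using A by (simp add: fd_cstar_algebra_def)
  have nz: "\<one>\<^bsub>A\<^esub> \<noteq> \<zero>\<^bsub>A\<^esub>" using A by (simp add: fd_cstar_algebra_def)
  have sm: "c \<odot>\<^bsub>A\<^esub> x \<in> carrier A" if "x \<in> carrier A" for c x
    using V.smult_closed[of c x] that by simp
  have ad: "adj A x \<in> carrier A" "adj A (adj A x) = x" if "x \<in> carrier A" for x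
    using A that by (auto simp: fd_cstar_algebra_def)
  have sml: "(c \<odot>\<^bsub>A\<^esub> x) \<otimes>\<^bsub>A\<^esub> y = c \<odot>\<^bsub>A\<^esub> (x \<otimes>\<^bsub>A\<^esub> y)"
    and smr: "x \<otimes>\<^bsub>A\<^esub> (c \<odot>\<^bsub>A\<^esub> y) = c \<odot>\<^bsub>A\<^esub> (x \<otimes>\<^bsub>A\<^esub> y)"
    and ada: "adj A (x \<oplus>\<^bsub>A\<^esub> y) = adj A x \<oplus>\<^bsub>A\<^esub> adj A y"
    and adm: "adj A (x \<otimes>\<^bsub>A\<^esub> y) = adj A y \<otimes>\<^bsub>A\<^esub> adj A x"
    if "x \<in> carrier A" "y \<in> carrier A" for c x y
    using A that unfolding fd_cstar_algebra_def by blast+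
  have ads: "adj A (c \<odot>\<^bsub>A\<^esub> x) = cnj c \<odot>\<^bsub>A\<^esub> adj A x" if "x \<in> carrier A" for c x
    using A that unfolding fd_cstar_algebra_def by blast
  have fc: "f x \<in> carrier_mat n n" if "x \<in> carrier A" for x
    using f that by (auto simp: star_hom_def)
  have fa: "f x + f y = f (x \<oplus>\<^bsub>A\<^esub> y)" and fm: "f x * f y = f (x \<otimes>\<^bsub>A\<^esub> y)"
    if "x \<in> carrier A" "y \<in> carrier A" for x y
    using f that by (auto simp: star_hom_def)
  have fs: "c \<cdot>\<^sub>m f x = f (c \<odot>\<^bsub>A\<^esub> x)" and fj: "mat_adjoint (f x) = f (adj A x)"
    if "x \<in> carrier A" for c x
    using f that by (auto simp: star_hom_def)
  have f0: "0\<^sub>m n n = f \<zero>\<^bsub>A\<^esub>"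
  proof -
    have c: "f \<zero>\<^bsub>A\<^esub> \<in> carrier_mat n n" by (simp add: fc)
    have e: "f \<zero>\<^bsub>A\<^esub> + f \<zero>\<^bsub>A\<^esub> = f \<zero>\<^bsub>A\<^esub>" using fa[of "\<zero>\<^bsub>A\<^esub>" "\<zero>\<^bsub>A\<^esub>"] by simp
    show ?thesis
    proof (rule eq_matI)
      fix i j assume "i < dim_row (f \<zero>\<^bsub>A\<^esub>)" "j < dim_col (f \<zero>\<^bsub>A\<^esub>)"
      with c show "0\<^sub>m n n $$ (i, j) = f \<zero>\<^bsub>A\<^esub> $$ (i, j)"
        using arg_cong[OF e, of "\<lambda>M. M $$ (i, j)"] by auto
    qed (use c in auto)
  qed
  note fr = fa fm fs fj f0 sm ad
  have ag: "abelian_group ?I"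
  proof (rule abelian_groupI)
    fix x assume "x \<in> carrier ?I"
    then obtain a where "a \<in> carrier A" "x = f a" by auto
    then show "\<exists>y\<in>carrier ?I. y \<oplus>\<^bsub>?I\<^esub> x = \<zero>\<^bsub>?I\<^esub>"
      by (intro bexI[of _ "f (\<ominus>\<^bsub>A\<^esub> a)"]) (auto simp: fr A.l_neg)
  qed (auto simp: fr A.a_ac)
  have mon: "monoid ?I"
    by (rule monoidI) (auto simp: fr A.m_assoc)
  have ring: "ring ?I"
    by (rule ringI[OF ag mon]) (auto simp: fr A.l_distr A.r_distr)
  have mod: "module class_ring ?I"
  proof (rule moduleI[OF _ ag])
    show "cring (class_ring :: complex ring)" by (rule domain.axioms(1)[OF field.axioms(1)[OF class_field]])
  qed (use V.smult_l_distr V.smult_r_distr V.smult_assoc1 V.smult_one in \<open>auto simp: fr\<close>)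
  have vs: "vectorspace class_ring ?I"
    by (rule vectorspace.intro[OF mod class_field])
  interpret I: vectorspace class_ring ?I by (rule vs)
  have "linear_map class_ring A ?I f"
    by (intro linear_map.intro mod_hom.intro mod_hom_axioms.intro V.vectorspace_axioms vs
          vectorspace.axioms(1)[OF V.vectorspace_axioms] mod) (auto simp: LinearCombinations.module_hom_def fr)
  then have fdI: "I.fin_dim"
    by (rule linear_map.surj_fin_dim[OF _ fd]) simp
  let ?norm = "\<lambda>\<nu> :: 'a \<Rightarrow> real.
        (\<forall>x\<in>carrier A. 0 \<le> \<nu> x \<and> (\<nu> x = 0 \<longleftrightarrow> x = \<zero>\<^bsub>A\<^esub>)) \<and>
        (\<forall>c. \<forall>x\<in>carrier A. \<nu> (c \<odot>\<^bsub>A\<^esub> x) = cmod c * \<nu> x) \<and>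
        (\<forall>x\<in>carrier A. \<forall>y\<in>carrier A.
           \<nu> (x \<oplus>\<^bsub>A\<^esub> y) \<le> \<nu> x + \<nu> y \<and> \<nu> (x \<otimes>\<^bsub>A\<^esub> y) \<le> \<nu> x * \<nu> y) \<and>
        (\<forall>x\<in>carrier A. \<nu> (adj A x \<otimes>\<^bsub>A\<^esub> x) = (\<nu> x)\<^sup>2)"
  have "\<exists>\<nu>. ?norm \<nu>" using A unfolding fd_cstar_algebra_def by (elim conjE)
  then obtain \<nu> where "?norm \<nu>" ..
  then have nu: "x \<in> carrier A \<Longrightarrow> 0 \<le> \<nu> x" "x \<in> carrier A \<Longrightarrow> \<nu> x = 0 \<longleftrightarrow> x = \<zero>\<^bsub>A\<^esub>"
    "x \<in> carrier A \<Longrightarrow> \<nu> (c \<odot>\<^bsub>A\<^esub> x) = cmod c * \<nu> x"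
    "\<lbrakk>x \<in> carrier A; y \<in> carrier A\<rbrakk> \<Longrightarrow> \<nu> (x \<oplus>\<^bsub>A\<^esub> y) \<le> \<nu> x + \<nu> y"
    "\<lbrakk>x \<in> carrier A; y \<in> carrier A\<rbrakk> \<Longrightarrow> \<nu> (x \<otimes>\<^bsub>A\<^esub> y) \<le> \<nu> x * \<nu> y"
    "x \<in> carrier A \<Longrightarrow> \<nu> (adj A x \<otimes>\<^bsub>A\<^esub> x) = (\<nu> x)\<^sup>2" for c x y
    by simp_all
  let ?g = "the_inv_into (carrier A) f"
  have g: "?g (f x) = x" if "x \<in> carrier A" for x
    using inj that by (rule the_inv_into_f_f)
  have fz: "f x = f \<zero>\<^bsub>A\<^esub> \<longleftrightarrow> x = \<zero>\<^bsub>A\<^esub>" if "x \<in> carrier A" for x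
    using inj that by (auto simp: inj_on_eq_iff)
  have one: "f \<one>\<^bsub>A\<^esub> \<noteq> f \<zero>\<^bsub>A\<^esub>" using fz nz by auto
  show ?thesis
    unfolding fd_cstar_algebra_def
  proof (intro conjI ring vs fdI exI[of _ "\<lambda>x. \<nu> (?g x)"])
  qed (auto simp: fr one g fz nu sml smr ada adm ads)
qed

lemma transmittable_image_algebra:
  fixes B :: "'b star_algebra"
  assumes "transmittable n m \<Phi> B"
  obtains B' :: "complex mat star_algebra"
    where "transmittable n m \<Phi> B'" "star_iso B B'" "star_iso B' B"
proof -
  from assms obtain f where B: "fd_cstar_algebra B" and f: "f \<in> star_hom B (mat_algebra n)"
    and inj: "inj_on f (carrier B)" and cor: "correctable n m \<Phi> (f ` carrier B)"
    by (auto simp: transmittable_def)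
  interpret B: ring B using B by (simp add: fd_cstar_algebra_def)
  interpret V: vectorspace class_ring B using B by (simp add: fd_cstar_algebra_def)
  have sm: "c \<odot>\<^bsub>B\<^esub> x \<in> carrier B" if "x \<in> carrier B" for c x
    using V.smult_closed[of c x] that by simp
  have ad: "adj B x \<in> carrier B" if "x \<in> carrier B" for x
    using B that by (auto simp: fd_cstar_algebra_def)
  let ?I = "image_algebra n f B"
  let ?g = "the_inv_into (carrier B) f"
  have g: "?g (f x) = x" if "x \<in> carrier B" for x
    using inj that by (rule the_inv_into_f_f)
  have fr: "x \<in> carrier B \<Longrightarrow> y \<in> carrier B \<Longrightarrow> f x + f y = f (x \<oplus>\<^bsub>B\<^esub> y)"
    "x \<in> carrier B \<Longrightarrow> y \<in> carrier B \<Longrightarrow> f x * f y = f (x \<otimes>\<^bsub>B\<^esub> y)"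
    "x \<in> carrier B \<Longrightarrow> c \<cdot>\<^sub>m f x = f (c \<odot>\<^bsub>B\<^esub> x)"
    "x \<in> carrier B \<Longrightarrow> mat_adjoint (f x) = f (adj B x)" for c x y
    using f by (auto simp: star_hom_def)
  have "transmittable n m \<Phi> ?I"
    unfolding transmittable_def
  proof (intro conjI fd_cstar_image_algebra[OF B f inj] bexI[of _ id])
    show "id \<in> star_hom ?I (mat_algebra n)"
      using f by (auto simp: star_hom_def)
  qed (use cor in auto)
  moreover have "star_iso B ?I"
    unfolding star_iso_def using f inj by (intro bexI[of _ f]) (auto simp: star_hom_def bij_betw_def)
  moreover have "star_iso ?I B"
    unfolding star_iso_def
  proof (intro bexI[of _ ?g])
    show "?g \<in> star_hom ?I B" by (auto simp: star_hom_def fr g sm ad)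
    show "bij_betw ?g (carrier ?I) (carrier B)"
      using inj by (simp add: bij_betw_the_inv_into inj_on_imp_bij_betw)
  qed
  ultimately show thesis by (rule that)
qed

lemma star_hom_comp: "f \<in> star_hom A B \<Longrightarrow> g \<in> star_hom B C \<Longrightarrow> g \<circ> f \<in> star_hom A C"
  by (auto simp: star_hom_def Pi_iff)

lemma star_hom_image: "f \<in> star_hom A B \<Longrightarrow> f ` carrier A \<subseteq> carrier B"
  by (auto simp: star_hom_def)

lemma star_embeds_trans: "star_embeds A B \<Longrightarrow> star_embeds B C \<Longrightarrow> star_embeds A C"
  unfolding star_embeds_def
  by (meson comp_inj_on inj_on_subset star_hom_comp star_hom_image)

lemma star_iso_trans: "star_iso A B \<Longrightarrow> star_iso B C \<Longrightarrow> star_iso A C"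
  unfolding star_iso_def by (meson bij_betw_trans star_hom_comp)

lemma star_iso_embeds: "star_iso A B \<Longrightarrow> star_embeds A B"
  by (auto simp: star_iso_def star_embeds_def bij_betw_def)

lemma dominating_any_type:
  fixes B :: "'b star_algebra"
  assumes "dominating_transmittable n m \<Phi> A" "transmittable n m \<Phi> B"
  shows "star_embeds B A"
  using assms transmittable_image_algebra[OF assms(2)]
  by (metis dominating_transmittable_def star_embeds_trans star_iso_embeds)

lemma maximal_any_type:
  fixes B :: "'b star_algebra"
  assumes "maximal_transmittable n m \<Phi> A" "transmittable n m \<Phi> B" "star_embeds A B"
  shows "star_iso A B"
  using assms transmittable_image_algebra[OF assms(2)]
  by (metis maximal_transmittable_def star_embeds_trans star_iso_embeds star_iso_trans)


section \<open>Hybrid capacities and the capacity algebra\<close>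

definition d_max :: "nat \<Rightarrow> nat \<Rightarrow> (complex mat \<Rightarrow> complex mat) \<Rightarrow> nat" where
  "d_max n m \<Phi> = Max {d. transmittable n m \<Phi> (mat_algebra d)}"

definition hybrid_cap ::
  "nat \<Rightarrow> nat \<Rightarrow> (complex mat \<Rightarrow> complex mat) \<Rightarrow> nat \<Rightarrow> nat" where
  "hybrid_cap n m \<Phi> d = Max {c. transmittable n m \<Phi> (mat_direct_sum (replicate c d))}"

text \<open>For \<open>d = d_max n m \<Phi>\<close> the sum is empty, which gives the initial value of the recursion.\<close>

function hybrid_mult ::
  "nat \<Rightarrow> nat \<Rightarrow> (complex mat \<Rightarrow> complex mat) \<Rightarrow> nat \<Rightarrow> int" where
  "hybrid_mult n m \<Phi> d =
     int (hybrid_cap n m \<Phi> d) -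
       (\<Sum>k\<in>{d<..d_max n m \<Phi>}. hybrid_mult n m \<Phi> k * \<lfloor>real k / real d\<rfloor>)"
  by auto
termination
  by (relation "measure (\<lambda>(n, m, \<Phi>, d). d_max n m \<Phi> - d)") auto

declare hybrid_mult.simps [simp del]

text \<open>Meaningful only when these multiplicities are nonnegative, since \<^const>\<open>nat\<close> truncates.\<close>

definition capacity_algebra ::
  "nat \<Rightarrow> nat \<Rightarrow> (complex mat \<Rightarrow> complex mat) \<Rightarrow> complex mat list star_algebra" where
  "capacity_algebra n m \<Phi> =
     mat_direct_sum
       (concat (map (\<lambda>d. replicate (nat (hybrid_mult n m \<Phi> d)) d) [1..<Suc (d_max n m \<Phi>)]))"

end

theory Submission
  imports Defs
begin

text \<open>A *-subalgebra of \<open>\<L>(\<complex>\<^sup>n)\<close> is a direct sum of full matrix algebras, so every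
  transmittable algebra is \<open>\<Oplus>\<^sub>i M\<^bsub>b\<^sub>i\<^esub>\<close> for some list of sizes. Any algebra embedded in a
  transmittable one is again transmittable: compose the decoder with the compression to the smaller
  unit projection. Comparing traces of projections, \<open>M\<^sub>d\<^sup>\<oplus>\<^sup>c\<close> embeds in \<open>\<Oplus>\<^sub>i M\<^bsub>b\<^sub>i\<^esub>\<close>
  iff \<open>c \<le> \<Sum>\<^sub>i \<lfloor>b\<^sub>i/d\<rfloor>\<close>. For a dominating algebra this gives
  \<open>c\<^sub>d = \<Sum>\<^sub>i \<lfloor>b\<^sub>i/d\<rfloor>\<close> for all \<open>d\<close>. The same holds for a transmittable algebra that
  contains \<open>\<A>\<^sub>c\<^sub>a\<^sub>p\<close>, because \<open>c\<^sub>d\<close> is the number of copies of \<open>M\<^sub>d\<close> that fit into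
  \<open>\<A>\<^sub>c\<^sub>a\<^sub>p\<close>. This system is triangular in the multiplicities of the sizes, and its
  solution is the sequence \<open>N\<^sub>d\<close>.\<close>

section \<open>Complex matrices and projections\<close>

abbreviation adjoint_mat :: "complex mat \<Rightarrow> complex mat" ("_\<^sup>\<dagger>" [1000] 1000)
  where "A\<^sup>\<dagger> \<equiv> mat_adjoint A"

lemma dim_mat_adjoint [simp]:
  "dim_row (A\<^sup>\<dagger>) = dim_col A" "dim_col (A\<^sup>\<dagger>) = dim_row A"
  by (auto simp: mat_adjoint_def)

lemma mat_adjoint_index [simp]:
  fixes A :: "complex mat"
  assumes "i < dim_col A" "j < dim_row A"
  shows "A\<^sup>\<dagger> $$ (i, j) = cnj (A $$ (j, i))"
  using assms by (simp add: mat_adjoint_def mat_of_rows_def)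

lemma mat_adjoint_carrier [simp]: "A \<in> carrier_mat n m \<Longrightarrow> A\<^sup>\<dagger> \<in> carrier_mat m n"
  by (auto intro!: carrier_matI)

lemma mat_adjoint_adjoint [simp]: "(A :: complex mat)\<^sup>\<dagger>\<^sup>\<dagger> = A"
  by (rule eq_matI) auto

lemma mat_adjoint_mult:
  fixes A B :: "complex mat"
  assumes "dim_col A = dim_row B"
  shows "(A * B)\<^sup>\<dagger> = B\<^sup>\<dagger> * A\<^sup>\<dagger>"
  using assms by (intro eq_matI) (auto simp: scalar_prod_def intro!: sum.cong)

lemma mat_adjoint_add:
  fixes A B :: "complex mat"
  assumes "dim_row A = dim_row B" "dim_col A = dim_col B"
  shows "(A + B)\<^sup>\<dagger> = A\<^sup>\<dagger> + B\<^sup>\<dagger>"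
  using assms by (intro eq_matI) auto

lemma mat_adjoint_minus:
  fixes A B :: "complex mat"
  assumes "dim_row A = dim_row B" "dim_col A = dim_col B"
  shows "(A - B)\<^sup>\<dagger> = A\<^sup>\<dagger> - B\<^sup>\<dagger>"
  using assms by (intro eq_matI) auto

lemma mat_adjoint_zero [simp]: "(0\<^sub>m n m :: complex mat)\<^sup>\<dagger> = 0\<^sub>m m n"
  by (rule eq_matI) auto

lemma mat_adjoint_one [simp]: "(1\<^sub>m n :: complex mat)\<^sup>\<dagger> = 1\<^sub>m n"
  by (rule eq_matI) auto

lemma mat_mult_assoc_dim:
  fixes A B C :: "'a :: semiring_0 mat"
  shows "dim_col A = dim_row B \<Longrightarrow> dim_col B = dim_row C \<Longrightarrow> A * B * C = A * (B * C)"
  by (rule assoc_mult_mat[of _ "dim_row A" "dim_row B" _ "dim_row C" _ "dim_col C"]) auto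

lemma mat_mult_vec_assoc_dim:
  fixes A B :: "'a :: comm_ring mat"
  shows "dim_col A = dim_row B \<Longrightarrow> dim_col B = dim_vec v \<Longrightarrow> A * B *\<^sub>v v = A *\<^sub>v (B *\<^sub>v v)"
  by (rule assoc_mult_mat_vec[of _ "dim_row A" "dim_row B" _ "dim_vec v"]) auto

lemma mat_distrib_dim:
  fixes A B C :: "'a :: comm_ring mat"
  shows "dim_col A = dim_row B \<Longrightarrow> dim_row B = dim_row C \<Longrightarrow> dim_col B = dim_col C \<Longrightarrow> A * (B + C) = A * B + A * C"
    "dim_col A = dim_row C \<Longrightarrow> dim_row A = dim_row B \<Longrightarrow> dim_col A = dim_col B \<Longrightarrow> (A + B) * C = A * C + B * C"
    "dim_col A = dim_row B \<Longrightarrow> dim_row B = dim_row C \<Longrightarrow> dim_col B = dim_col C \<Longrightarrow> A * (B - C) = A * B - A * C"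
    "dim_col A = dim_row C \<Longrightarrow> dim_row A = dim_row B \<Longrightarrow> dim_col A = dim_col B \<Longrightarrow> (A - B) * C = A * C - B * C"
  by (intro eq_matI, auto simp: scalar_prod_def algebra_simps sum.distrib sum_subtractf)+

lemma mat_smult_dim:
  fixes A B :: "'a :: comm_ring mat"
  shows "dim_col A = dim_row B \<Longrightarrow> (c \<cdot>\<^sub>m A) * B = c \<cdot>\<^sub>m (A * B)"
    "dim_col A = dim_row B \<Longrightarrow> A * (c \<cdot>\<^sub>m B) = c \<cdot>\<^sub>m (A * B)"
  by (intro eq_matI, auto simp: scalar_prod_def algebra_simps sum_distrib_left)+

lemma mat_one_zero_dim:
  fixes A :: "'a :: comm_ring_1 mat"
  shows "dim_row A = n \<Longrightarrow> 1\<^sub>m n * A = A" "dim_col A = n \<Longrightarrow> A * 1\<^sub>m n = A"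
    "dim_row A = n \<Longrightarrow> 0\<^sub>m m n * A = 0\<^sub>m m (dim_col A)" "dim_col A = n \<Longrightarrow> A * 0\<^sub>m n m = 0\<^sub>m (dim_row A) m"
  by (intro eq_matI, auto simp: scalar_prod_def)+

lemma mat_vec_distrib_dim:
  fixes A B :: "'a :: comm_ring mat"
  shows "dim_row A = dim_row B \<Longrightarrow> dim_col A = dim_col B \<Longrightarrow> dim_col B = dim_vec v \<Longrightarrow> (A + B) *\<^sub>v v = A *\<^sub>v v + B *\<^sub>v v"
    "dim_row A = dim_row B \<Longrightarrow> dim_col A = dim_col B \<Longrightarrow> dim_col B = dim_vec v \<Longrightarrow> (A - B) *\<^sub>v v = A *\<^sub>v v - B *\<^sub>v v"
    "dim_col A = dim_vec v \<Longrightarrow> (c \<cdot>\<^sub>m A) *\<^sub>v v = c \<cdot>\<^sub>v (A *\<^sub>v v)"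
    "dim_col A = dim_vec v \<Longrightarrow> dim_vec v = dim_vec w \<Longrightarrow> A *\<^sub>v (v + w) = A *\<^sub>v v + A *\<^sub>v w"
    "dim_col A = dim_vec v \<Longrightarrow> dim_vec v = dim_vec w \<Longrightarrow> A *\<^sub>v (v - w) = A *\<^sub>v v - A *\<^sub>v w"
    "dim_col A = dim_vec v \<Longrightarrow> A *\<^sub>v (c \<cdot>\<^sub>v v) = c \<cdot>\<^sub>v (A *\<^sub>v v)"
  by (intro eq_vecI, auto simp: scalar_prod_def algebra_simps sum.distrib sum_subtractf sum_distrib_left)+

lemma mult_mat_zero_vec_dim: "dim_col A = n \<Longrightarrow> A *\<^sub>v 0\<^sub>v n = 0\<^sub>v (dim_row A)" for A :: "'a :: comm_ring mat"
  by (intro eq_vecI) (auto simp: scalar_prod_def)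

lemma zero_mat_mult_vec_dim: "dim_vec v = n \<Longrightarrow> 0\<^sub>m m n *\<^sub>v v = 0\<^sub>v m" for v :: "'a :: comm_ring vec"
  by (intro eq_vecI) (auto simp: scalar_prod_def)

lemma col_mult2_dim: "dim_col A = dim_row B \<Longrightarrow> j < dim_col B \<Longrightarrow> col (A * B) j = A *\<^sub>v col B j"
  for A B :: "'a :: semiring_0 mat"
  by (rule col_mult2[of _ "dim_row A" "dim_row B" _ "dim_col B"]) auto

lemma mat_diff_zeroD:
  fixes A B :: "'a :: group_add mat"
  assumes "A - B = 0\<^sub>m n m" "dim_row A = n" "dim_row B = n" "dim_col A = m" "dim_col B = m"
  shows "A = B"
proof (rule eq_matI)
  fix i j assume "i < dim_row B" "j < dim_col B"
  then show "A $$ (i, j) = B $$ (i, j)"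
    using arg_cong[OF assms(1), of "\<lambda>M. M $$ (i, j)"] assms(2-) by simp
qed (use assms in auto)

lemma mat_add_self_zeroD:
  fixes M :: "'a :: ab_group_add mat"
  assumes "M + M = M" "M \<in> carrier_mat n m"
  shows "M = 0\<^sub>m n m"
proof (rule eq_matI)
  fix i j assume "i < dim_row (0\<^sub>m n m)" "j < dim_col (0\<^sub>m n m)"
  then show "M $$ (i, j) = 0\<^sub>m n m $$ (i, j)"
    using arg_cong[OF assms(1), of "\<lambda>M. M $$ (i, j)"] assms(2) by simp
qed (use assms(2) in auto)

lemma mat_eq_mult_vecI:
  fixes A B :: "'a :: comm_ring_1 mat"
  assumes "A \<in> carrier_mat n m" "B \<in> carrier_mat n m"
    and "\<And>v. v \<in> carrier_vec m \<Longrightarrow> A *\<^sub>v v = B *\<^sub>v v"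
  shows "A = B"
proof (rule eq_matI)
  fix i j assume ij: "i < dim_row B" "j < dim_col B"
  have "(A *\<^sub>v unit_vec m j) $ i = (B *\<^sub>v unit_vec m j) $ i" by (simp add: assms)
  then show "A $$ (i, j) = B $$ (i, j)" using ij assms(1,2) by simp
qed (use assms in auto)

lemma cscalar_prod_adjoint:
  fixes A :: "complex mat"
  assumes "A \<in> carrier_mat n m" "x \<in> carrier_vec m" "y \<in> carrier_vec n"
  shows "(A *\<^sub>v x) \<bullet>c y = x \<bullet>c (A\<^sup>\<dagger> *\<^sub>v y)"
proof -
  have "(A *\<^sub>v x) \<bullet>c y = (\<Sum>i<n. \<Sum>j<m. A $$ (i, j) * x $ j * cnj (y $ i))"
    using assms by (simp add: scalar_prod_def sum_distrib_right lessThan_atLeast0 mult.assoc)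
  also have "\<dots> = (\<Sum>j<m. \<Sum>i<n. A $$ (i, j) * x $ j * cnj (y $ i))"
    by (rule sum.swap)
  also have "\<dots> = x \<bullet>c (A\<^sup>\<dagger> *\<^sub>v y)"
    using assms by (simp add: scalar_prod_def sum_distrib_left lessThan_atLeast0 algebra_simps)
  finally show ?thesis .
qed

lemma mtrace_comm:
  assumes "A \<in> carrier_mat n m" "B \<in> carrier_mat m n"
  shows "mtrace (A * B) = mtrace (B * A)"
proof -
  have "mtrace (A * B) = (\<Sum>i<n. \<Sum>j<m. A $$ (i, j) * B $$ (j, i))"
    using assms by (simp add: mtrace_def scalar_prod_def lessThan_atLeast0)
  also have "\<dots> = (\<Sum>j<m. \<Sum>i<n. A $$ (i, j) * B $$ (j, i))" by (rule sum.swap)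
  also have "\<dots> = mtrace (B * A)"
    using assms by (simp add: mtrace_def scalar_prod_def lessThan_atLeast0 mult.commute)
  finally show ?thesis .
qed

lemma mtrace_add: "A \<in> carrier_mat n n \<Longrightarrow> B \<in> carrier_mat n n \<Longrightarrow> mtrace (A + B) = mtrace A + mtrace B"
  by (auto simp: mtrace_def sum.distrib)

lemma mtrace_minus: "A \<in> carrier_mat n n \<Longrightarrow> B \<in> carrier_mat n n \<Longrightarrow> mtrace (A - B) = mtrace A - mtrace B"
  by (auto simp: mtrace_def sum_subtractf)

lemma mtrace_smult: "A \<in> carrier_mat n n \<Longrightarrow> mtrace (c \<cdot>\<^sub>m A) = c * mtrace A"
  by (auto simp: mtrace_def sum_distrib_left)

lemma mtrace_one [simp]: "mtrace (1\<^sub>m n) = of_nat n"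
  by (simp add: mtrace_def)

lemma mtrace_zero [simp]: "mtrace (0\<^sub>m n n) = 0"
  by (simp add: mtrace_def)

lemma mtrace_adjoint_mult:
  assumes "A \<in> carrier_mat n m"
  shows "mtrace (A\<^sup>\<dagger> * A) = of_real (\<Sum>j<m. \<Sum>i<n. (cmod (A $$ (i, j)))\<^sup>2)"
  using assms by (simp add: mtrace_def scalar_prod_def lessThan_atLeast0 complex_norm_square mult.commute
      del: of_real_power)

lemma mtrace_adjoint_mult_eq_0:
  assumes A: "A \<in> carrier_mat n m" and z: "mtrace (A\<^sup>\<dagger> * A) = 0"
  shows "A = 0\<^sub>m n m"
proof -
  have "(\<Sum>j<m. \<Sum>i<n. (cmod (A $$ (i, j)))\<^sup>2) = 0"
    using mtrace_adjoint_mult[OF A] z by (metis of_real_eq_0_iff)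
  then have "\<forall>j<m. \<forall>i<n. A $$ (i, j) = 0"
    by (subst (asm) sum_nonneg_eq_0_iff) (auto simp: sum_nonneg sum_nonneg_eq_0_iff)
  then show ?thesis using A by (intro eq_matI) auto
qed

lemma adjoint_mult_zero:
  assumes "A \<in> carrier_mat n m" "A\<^sup>\<dagger> * A = 0\<^sub>m m m"
  shows "A = 0\<^sub>m n m"
  using assms by (intro mtrace_adjoint_mult_eq_0) simp_all

definition is_proj :: "nat \<Rightarrow> complex mat \<Rightarrow> bool" where
  "is_proj n P \<longleftrightarrow> P \<in> carrier_mat n n \<and> P * P = P \<and> P\<^sup>\<dagger> = P"

lemma is_proj_diff:
  assumes P: "is_proj n P" and Q: "is_proj n Q" and PQ: "P * Q = Q"
  shows "is_proj n (P - Q)"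
proof -
  have c: "dim_row P = n" "dim_col P = n" "dim_row Q = n" "dim_col Q = n"
    using P Q by (auto simp: is_proj_def)
  have "Q * P = Q"
    using arg_cong[OF PQ, of mat_adjoint] P Q c by (simp add: mat_adjoint_mult is_proj_def)
  with P Q PQ c have "(P - Q) * (P - Q) = (P - Q) - (Q - Q)"
    by (simp add: mat_distrib_dim is_proj_def)
  also have "\<dots> = P - Q" using c by (intro eq_matI) auto
  finally show ?thesis using P Q c by (simp add: is_proj_def mat_adjoint_minus minus_carrier_mat)
qed

lemma is_proj_one: "is_proj n (1\<^sub>m n)"
  by (simp add: is_proj_def)

lemma isometry_range_proj:
  assumes W: "W \<in> carrier_mat n r" and iso: "W\<^sup>\<dagger> * W = 1\<^sub>m r"
  shows "is_proj n (W * W\<^sup>\<dagger>)" "mtrace (W * W\<^sup>\<dagger>) = of_nat r"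
proof -
  have c: "dim_row W = n" "dim_col W = r" using W by auto
  have "W * W\<^sup>\<dagger> * (W * W\<^sup>\<dagger>) = W * (W\<^sup>\<dagger> * W * W\<^sup>\<dagger>)" using c by (simp add: mat_mult_assoc_dim)
  then show "is_proj n (W * W\<^sup>\<dagger>)" using W c iso by (simp add: is_proj_def mat_adjoint_mult mat_one_zero_dim)
  show "mtrace (W * W\<^sup>\<dagger>) = of_nat r"
    using mtrace_comm[of W n r "W\<^sup>\<dagger>"] W iso by simp
qed

lemma is_proj_mtrace:
  assumes "is_proj n P"
  shows "mtrace P = of_real (Re (mtrace P))" "0 \<le> Re (mtrace P)" "Re (mtrace P) \<le> n"
proof -
  have nonneg: "mtrace Q = of_real (Re (mtrace Q)) \<and> 0 \<le> Re (mtrace Q)" if "is_proj n Q" for Q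
    using mtrace_adjoint_mult[of Q n n] that by (simp add: is_proj_def sum_nonneg)
  then show "mtrace P = of_real (Re (mtrace P))" "0 \<le> Re (mtrace P)" using assms by blast+
  have "is_proj n (1\<^sub>m n - P)"
    using assms by (intro is_proj_diff is_proj_one) (auto simp: is_proj_def)
  from nonneg[OF this] show "Re (mtrace P) \<le> n"
    using assms by (simp add: mtrace_minus[of _ n] is_proj_def)
qed

lemma is_proj_mtrace_pos:
  assumes "is_proj n P" "P \<noteq> 0\<^sub>m n n"
  shows "0 < Re (mtrace P)"
proof (rule ccontr)
  assume "\<not> 0 < Re (mtrace P)"
  then have z: "mtrace P = 0" using is_proj_mtrace[OF assms(1)] by simp
  then have "P = 0\<^sub>m n n"
    using assms(1) by (intro mtrace_adjoint_mult_eq_0) (simp_all add: is_proj_def)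
  with assms(2) show False by simp
qed

lemma isometry_dim_pos:
  assumes "W \<in> carrier_mat n r" "W * W\<^sup>\<dagger> \<noteq> 0\<^sub>m n n"
  shows "0 < r"
proof (rule ccontr)
  assume "\<not> 0 < r"
  then have "W * W\<^sup>\<dagger> = 0\<^sub>m n n" using assms(1) by (intro eq_matI) (auto simp: scalar_prod_def)
  with assms(2) show False by simp
qed

lemma isometry_dim_le:
  assumes "W \<in> carrier_mat n r" "W\<^sup>\<dagger> * W = 1\<^sub>m r"
  shows "r \<le> n"
  using isometry_range_proj[OF assms] is_proj_mtrace(3)[of n "W * W\<^sup>\<dagger>"] by simp

definition vec_subspace :: "nat \<Rightarrow> complex vec set \<Rightarrow> bool" where
  "vec_subspace n T \<longleftrightarrow> T \<subseteq> carrier_vec n \<and> 0\<^sub>v n \<in> T \<and>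
     (\<forall>x\<in>T. \<forall>y\<in>T. x + y \<in> T) \<and> (\<forall>c. \<forall>x\<in>T. c \<cdot>\<^sub>v x \<in> T)"

lemma vec_subspace_mult_mat_vec:
  assumes T: "vec_subspace n T" and W: "W \<in> carrier_mat n r" and col: "\<And>j. j < r \<Longrightarrow> col W j \<in> T"
    and c: "c \<in> carrier_vec r"
  shows "W *\<^sub>v c \<in> T"
proof -
  have "vec n (\<lambda>a. \<Sum>j<k. W $$ (a, j) * c $ j) \<in> T" if "k \<le> r" for k
    using that
  proof (induction k)
    case 0
    have "vec n (\<lambda>a. \<Sum>j<0. W $$ (a, j) * c $ j) = 0\<^sub>v n" by auto
    with T show ?case by (simp add: vec_subspace_def)
  next
    case (Suc k)
    have "vec n (\<lambda>a. \<Sum>j<Suc k. W $$ (a, j) * c $ j)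
        = vec n (\<lambda>a. \<Sum>j<k. W $$ (a, j) * c $ j) + c $ k \<cdot>\<^sub>v col W k"
      using W Suc.prems by auto
    with Suc T col[of k] show ?case by (simp add: vec_subspace_def)
  qed
  moreover have "W *\<^sub>v c = vec n (\<lambda>a. \<Sum>j<r. W $$ (a, j) * c $ j)"
    using W c by (auto simp: scalar_prod_def lessThan_atLeast0)
  ultimately show ?thesis by simp
qed

lemma orthonormal_basis:
  assumes T: "vec_subspace n T"
  obtains r W where "W \<in> carrier_mat n r" "W\<^sup>\<dagger> * W = 1\<^sub>m r" "\<And>j. j < r \<Longrightarrow> col W j \<in> T"
    "\<And>x. x \<in> T \<Longrightarrow> W *\<^sub>v (W\<^sup>\<dagger> *\<^sub>v x) = x"
proof -
  define on where "on r W \<longleftrightarrow> W \<in> carrier_mat n r \<and> W\<^sup>\<dagger> * W = 1\<^sub>m r \<and> (\<forall>j<r. col W j \<in> T)" for r W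
  have "on 0 (0\<^sub>m n 0)" by (auto simp: on_def)
  moreover have "r \<le> n" if "\<exists>W. on r W" for r using that isometry_dim_le by (auto simp: on_def)
  ultimately obtain r where r: "\<exists>W. on r W" and max: "\<And>r'. \<exists>W. on r' W \<Longrightarrow> r' \<le> r"
    using GreatestI_nat[of "\<lambda>r. \<exists>W. on r W" 0 n] Greatest_le_nat[of "\<lambda>r. \<exists>W. on r W" _ n] by metis
  from r obtain W where W: "W \<in> carrier_mat n r" "W\<^sup>\<dagger> * W = 1\<^sub>m r" "\<And>j. j < r \<Longrightarrow> col W j \<in> T"
    by (auto simp: on_def)
  have c: "dim_row W = n" "dim_col W = r" using W by auto
  have "W *\<^sub>v (W\<^sup>\<dagger> *\<^sub>v x) = x" if x: "x \<in> T" for x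
  proof (rule ccontr)
    assume ne: "W *\<^sub>v (W\<^sup>\<dagger> *\<^sub>v x) \<noteq> x"
    have xc: "x \<in> carrier_vec n" using x T by (auto simp: vec_subspace_def)
    define y where "y = x - W *\<^sub>v (W\<^sup>\<dagger> *\<^sub>v x)"
    have "W *\<^sub>v (W\<^sup>\<dagger> *\<^sub>v x) \<in> T"
      by (rule vec_subspace_mult_mat_vec[OF T W(1) W(3) mult_mat_vec_carrier[OF _ xc]]) (use W(1) in simp_all)
    then have "x + (-1) \<cdot>\<^sub>v (W *\<^sub>v (W\<^sup>\<dagger> *\<^sub>v x)) \<in> T"
      using T x by (simp add: vec_subspace_def)
    also have "x + (-1) \<cdot>\<^sub>v (W *\<^sub>v (W\<^sup>\<dagger> *\<^sub>v x)) = y" using W xc by (auto simp: y_def)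
    finally have yT: "y \<in> T" .
    then have yc: "y \<in> carrier_vec n" using T by (auto simp: vec_subspace_def)
    have yne: "y \<noteq> 0\<^sub>v n"
    proof
      assume y0: "y = 0\<^sub>v n"
      have "W *\<^sub>v (W\<^sup>\<dagger> *\<^sub>v x) = x"
      proof (rule eq_vecI)
        fix i assume "i < dim_vec x"
        then show "(W *\<^sub>v (W\<^sup>\<dagger> *\<^sub>v x)) $ i = x $ i"
          using arg_cong[OF y0, of "\<lambda>v. v $ i"] xc c by (simp add: y_def)
      qed (use xc c in auto)
      with ne show False by simp
    qed
    have "W\<^sup>\<dagger> *\<^sub>v y = W\<^sup>\<dagger> *\<^sub>v x - W\<^sup>\<dagger> * W *\<^sub>v (W\<^sup>\<dagger> *\<^sub>v x)"
      using xc c by (simp add: y_def mat_mult_vec_assoc_dim mat_vec_distrib_dim)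
    also have "\<dots> = 0\<^sub>v r" using W(2) mult_mat_vec_carrier[OF mat_adjoint_carrier[OF W(1)] xc] by simp
    finally have Wy: "W\<^sup>\<dagger> *\<^sub>v y = 0\<^sub>v r" .
    define s where "s = sqrt (\<Sum>a<n. (cmod (y $ a))\<^sup>2)"
    have "\<exists>a<n. y $ a \<noteq> 0" using yne yc by (metis carrier_vecD eq_vecI index_zero_vec)
    then have "(\<Sum>a<n. (cmod (y $ a))\<^sup>2) > 0" by (auto intro!: sum_pos2)
    then have s: "s > 0" "s\<^sup>2 = (\<Sum>a<n. (cmod (y $ a))\<^sup>2)" by (auto simp: s_def)
    have ss: "(\<Sum>a<n. cnj (y $ a) * y $ a) = of_real (s\<^sup>2)"
      by (simp add: s(2) complex_norm_square mult.commute del: of_real_power)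
    define W' where "W' = mat n (Suc r) (\<lambda>(a, j). if j < r then W $$ (a, j) else y $ a / of_real s)"
    have W'c: "W' \<in> carrier_mat n (Suc r)" by (simp add: W'_def)
    have e1: "(\<Sum>a<n. cnj (W $$ (a, i)) * y $ a) = 0" if "i < r" for i
      using arg_cong[OF Wy, of "\<lambda>v. v $ i"] that yc c by (simp add: scalar_prod_def lessThan_atLeast0)
    have e2: "(\<Sum>a<n. cnj (y $ a) * W $$ (a, i)) = 0" if "i < r" for i
      using arg_cong[OF e1[OF that], of cnj] by (simp add: mult.commute)
    have e3: "(\<Sum>a<n. cnj (W $$ (a, i)) * W $$ (a, j)) = (if i = j then 1 else 0)" if "i < r" "j < r" for i j
      using arg_cong[OF W(2), of "\<lambda>M. M $$ (i, j)"] that c by (simp add: scalar_prod_def lessThan_atLeast0)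
    have "W'\<^sup>\<dagger> * W' = 1\<^sub>m (Suc r)"
    proof (rule eq_matI)
      fix i j assume ij: "i < dim_row (1\<^sub>m (Suc r) :: complex mat)" "j < dim_col (1\<^sub>m (Suc r) :: complex mat)"
      have l: "(W'\<^sup>\<dagger> * W') $$ (i, j) = (\<Sum>a<n. cnj (W' $$ (a, i)) * W' $$ (a, j))"
        using ij W'c by (simp add: scalar_prod_def lessThan_atLeast0)
      have "(\<Sum>a<n. cnj (W' $$ (a, i)) * W' $$ (a, j)) = (if i = j then 1 else 0)"
      proof (cases "i < r"; cases "j < r")
        assume "\<not> i < r" "\<not> j < r"
        then have "(\<Sum>a<n. cnj (W' $$ (a, i)) * W' $$ (a, j)) = (\<Sum>a<n. cnj (y $ a) * y $ a / of_real (s\<^sup>2))"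
          using ij by (intro sum.cong) (auto simp: W'_def power2_eq_square)
        also have "\<dots> = 1" using s(1) ss by (simp flip: sum_divide_distrib)
        finally show ?thesis using ij \<open>\<not> i < r\<close> \<open>\<not> j < r\<close> by simp
      next
        assume "i < r" "\<not> j < r"
        then show ?thesis using ij e1[of i] by (simp add: W'_def flip: sum_divide_distrib)
      next
        assume "\<not> i < r" "j < r"
        then show ?thesis using ij e2[of j] by (simp add: W'_def flip: sum_divide_distrib)
      qed (use e3 in \<open>simp add: W'_def\<close>)
      then show "(W'\<^sup>\<dagger> * W') $$ (i, j) = 1\<^sub>m (Suc r) $$ (i, j)" using l ij by simp
    qed (use W'c in auto)
    moreover have "col W' j \<in> T" if "j < Suc r" for j
    proof (cases "j < r")
      case True
      then have "col W' j = col W j" using c by (auto simp: W'_def)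
      with W(3)[OF True] show ?thesis by simp
    next
      case False
      then have "col W' j = (1 / of_real s) \<cdot>\<^sub>v y" using that yc by (auto simp: W'_def)
      with yT T show ?thesis by (simp add: vec_subspace_def)
    qed
    ultimately have "on (Suc r) W'" using W'c by (simp add: on_def)
    then show False using max[of "Suc r"] by auto
  qed
  with W that show thesis by blast
qed

lemma is_proj_isometry:
  assumes Q: "is_proj n Q"
  obtains r V where "V \<in> carrier_mat n r" "V\<^sup>\<dagger> * V = 1\<^sub>m r" "V * V\<^sup>\<dagger> = Q"
proof -
  have Qc: "Q \<in> carrier_mat n n" "dim_row Q = n" "dim_col Q = n" using Q by (auto simp: is_proj_def)
  let ?T = "{v \<in> carrier_vec n. Q *\<^sub>v v = v}"
  have "vec_subspace n ?T"
    using Qc by (auto simp: vec_subspace_def mult_add_distrib_mat_vec[of _ n n] mult_mat_vec[of _ n n])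
  then obtain r W where W: "W \<in> carrier_mat n r" "W\<^sup>\<dagger> * W = 1\<^sub>m r" "\<And>j. j < r \<Longrightarrow> col W j \<in> ?T"
    "\<And>x. x \<in> ?T \<Longrightarrow> W *\<^sub>v (W\<^sup>\<dagger> *\<^sub>v x) = x" by (rule orthonormal_basis) blast
  have c: "dim_row W = n" "dim_col W = r" using W by auto
  have QW: "Q * W = W"
    using W(3) Qc c by (intro mat_col_eqI) (auto simp: col_mult2[of _ n n _ r] W(1))
  have "W * W\<^sup>\<dagger> * Q = Q"
  proof (rule mat_eq_mult_vecI)
    fix v :: "complex vec" assume v: "v \<in> carrier_vec n"
    then have "Q *\<^sub>v v \<in> ?T" using Q Qc by (auto simp: is_proj_def simp flip: mat_mult_vec_assoc_dim)
    from W(4)[OF this] show "W * W\<^sup>\<dagger> * Q *\<^sub>v v = Q *\<^sub>v v"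
      using c Qc v by (simp add: mat_mult_vec_assoc_dim)
  qed (use Qc W(1) in auto)
  from arg_cong[OF this, of mat_adjoint] have "Q * (W * W\<^sup>\<dagger>) = Q"
    using Q c Qc by (simp add: mat_adjoint_mult is_proj_def)
  then have "W * W\<^sup>\<dagger> = Q" using QW c Qc by (simp flip: mat_mult_assoc_dim)
  with W that show thesis by blast
qed

lemma is_proj_mtrace_nat:
  assumes "is_proj n P" obtains t :: nat where "mtrace P = of_nat t"
  using is_proj_isometry[OF assms] isometry_range_proj(2) by metis

primrec msum :: "nat \<Rightarrow> (nat \<Rightarrow> complex mat) \<Rightarrow> nat \<Rightarrow> complex mat" where
  "msum n f 0 = 0\<^sub>m n n"
| "msum n f (Suc k) = msum n f k + f k"

lemma msum_carrier [simp]: "(\<And>i. i < k \<Longrightarrow> f i \<in> carrier_mat n n) \<Longrightarrow> msum n f k \<in> carrier_mat n n"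
  by (induction k) auto

lemma msum_mult_right:
  assumes "\<And>i. i < k \<Longrightarrow> f i \<in> carrier_mat n n" "B \<in> carrier_mat n n"
  shows "msum n f k * B = msum n (\<lambda>i. f i * B) k"
  using assms
proof (induction k)
  case (Suc k)
  then have "msum n f k \<in> carrier_mat n n" "f k \<in> carrier_mat n n" by auto
  note this[THEN carrier_matD(1)] this[THEN carrier_matD(2)]
  with Suc show ?case by (simp add: mat_distrib_dim(2) carrier_matD[OF Suc.prems(2)])
qed auto

lemma msum_mult_left:
  assumes "\<And>i. i < k \<Longrightarrow> f i \<in> carrier_mat n n" "B \<in> carrier_mat n n"
  shows "B * msum n f k = msum n (\<lambda>i. B * f i) k"
  using assms
proof (induction k)
  case (Suc k)
  then have "msum n f k \<in> carrier_mat n n" "f k \<in> carrier_mat n n" by auto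
  note this[THEN carrier_matD(1)] this[THEN carrier_matD(2)]
  with Suc show ?case by (simp add: mat_distrib_dim(1) carrier_matD[OF Suc.prems(2)])
qed auto

lemma msum_adjoint:
  assumes "\<And>i. i < k \<Longrightarrow> f i \<in> carrier_mat n n"
  shows "(msum n f k)\<^sup>\<dagger> = msum n (\<lambda>i. (f i)\<^sup>\<dagger>) k"
  using assms
proof (induction k)
  case (Suc k)
  then have "msum n f k \<in> carrier_mat n n" "f k \<in> carrier_mat n n" by auto
  note this[THEN carrier_matD(1)] this[THEN carrier_matD(2)]
  with Suc show ?case by (simp add: mat_adjoint_add)
qed auto

lemma msum_mtrace:
  assumes "\<And>i. i < k \<Longrightarrow> f i \<in> carrier_mat n n"
  shows "mtrace (msum n f k) = (\<Sum>i<k. mtrace (f i))"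
  using assms by (induction k) (auto simp: mtrace_add[of _ n])

lemma msum_cong: "(\<And>i. i < k \<Longrightarrow> f i = g i) \<Longrightarrow> msum n f k = msum n g k"
  by (induction k) auto

lemma msum_zero: "msum n (\<lambda>_. 0\<^sub>m n n) k = 0\<^sub>m n n"
  by (induction k) auto

lemma msum_mult_vec_single:
  assumes c: "\<And>i. i < k \<Longrightarrow> f i \<in> carrier_mat n n" and w: "w \<in> carrier_vec n" and j: "j < k"
    and z: "\<And>i. i < k \<Longrightarrow> i \<noteq> j \<Longrightarrow> f i *\<^sub>v w = 0\<^sub>v n"
  shows "msum n f k *\<^sub>v w = f j *\<^sub>v w"
proof -
  have fw: "f j *\<^sub>v w \<in> carrier_vec n" using mult_mat_vec_carrier[OF c[OF j] w] .
  have "msum n f i *\<^sub>v w = (if j < i then f j *\<^sub>v w else 0\<^sub>v n)" if "i \<le> k" for i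
    using that
  proof (induction i)
    case (Suc i)
    have "msum n f i \<in> carrier_mat n n" "f i \<in> carrier_mat n n" using c Suc.prems by auto
    then have "msum n f (Suc i) *\<^sub>v w = msum n f i *\<^sub>v w + f i *\<^sub>v w"
      using w by (simp add: add_mult_distrib_mat_vec[of _ n n])
    then show ?case using Suc z[of i] fw by (cases "i = j") auto
  qed (use w in auto)
  then show ?thesis using j by simp
qed

lemma msum_single:
  assumes "j < k" "f j \<in> carrier_mat n n" "\<And>i. i < k \<Longrightarrow> i \<noteq> j \<Longrightarrow> f i = 0\<^sub>m n n"
  shows "msum n f k = f j"
proof -
  have "msum n f i = (if j < i then f j else 0\<^sub>m n n)" if "i \<le> k" for i
    using that assms by (induction i) (auto simp: less_Suc_eq)
  then show ?thesis using assms(1) by simp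
qed

section \<open>Structure of *-subalgebras of a full matrix algebra\<close>

context
  fixes n :: nat and S :: "complex mat set"
  assumes S: "star_subalgebra n S"
begin

lemma sub_carrier: "x \<in> S \<Longrightarrow> x \<in> carrier_mat n n"
  using S by (auto simp: star_subalgebra_def)

lemma sub_dim: "x \<in> S \<Longrightarrow> dim_row x = n" "x \<in> S \<Longrightarrow> dim_col x = n"
  using sub_carrier by auto

lemma sub_closed:
  "0\<^sub>m n n \<in> S" "x \<in> S \<Longrightarrow> y \<in> S \<Longrightarrow> x + y \<in> S" "x \<in> S \<Longrightarrow> y \<in> S \<Longrightarrow> x * y \<in> S"
  "x \<in> S \<Longrightarrow> c \<cdot>\<^sub>m x \<in> S" "x \<in> S \<Longrightarrow> x\<^sup>\<dagger> \<in> S"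
  using S by (auto simp: star_subalgebra_def)

lemma sub_minus:
  assumes "x \<in> S" "y \<in> S" shows "x - y \<in> S"
proof -
  have "x - y = x + (-1) \<cdot>\<^sub>m y" using sub_dim assms by (intro eq_matI) auto
  with assms show ?thesis by (simp add: sub_closed)
qed

lemma sub_msum: "(\<And>i. i < k \<Longrightarrow> f i \<in> S) \<Longrightarrow> msum n f k \<in> S"
  by (induction k) (auto intro: sub_closed)

end

fun poly0 :: "complex mat \<Rightarrow> complex list \<Rightarrow> complex mat" where
  "poly0 h [] = 0\<^sub>m (dim_row h) (dim_row h)"
| "poly0 h (a # as) = a \<cdot>\<^sub>m h + h * poly0 h as"

lemma poly0_carrier: "h \<in> carrier_mat n n \<Longrightarrow> poly0 h as \<in> carrier_mat n n"
  by (induction as) auto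

lemma poly0_index:
  assumes h: "h \<in> carrier_mat n n" and ij: "i < n" "j < n"
  shows "poly0 h as $$ (i, j) = (\<Sum>k<length as. as ! k * (h ^\<^sub>m Suc k) $$ (i, j))"
  using ij
proof (induction as arbitrary: i j)
  case (Cons a as)
  have c: "poly0 h as \<in> carrier_mat n n" by (rule poly0_carrier[OF h])
  have pw: "h ^\<^sub>m k \<in> carrier_mat n n" for k using h by (rule pow_carrier_mat)
  have comm: "h * h ^\<^sub>m Suc k = h ^\<^sub>m Suc (Suc k)" for k
  proof (induction k)
    case (Suc k)
    have "h * h ^\<^sub>m Suc (Suc k) = h * h ^\<^sub>m Suc k * h"
      using h pw[of k] by (simp add: mat_mult_assoc_dim)
    with Suc show ?case by simp
  qed (use h in simp)
  have "(h * poly0 h as) $$ (i, j) = (\<Sum>l<n. h $$ (i, l) * poly0 h as $$ (l, j))"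
    using h c Cons.prems by (simp add: scalar_prod_def lessThan_atLeast0)
  also have "\<dots> = (\<Sum>l<n. \<Sum>k<length as. h $$ (i, l) * (as ! k * (h ^\<^sub>m Suc k) $$ (l, j)))"
    using Cons by (simp add: sum_distrib_left)
  also have "\<dots> = (\<Sum>k<length as. \<Sum>l<n. h $$ (i, l) * (as ! k * (h ^\<^sub>m Suc k) $$ (l, j)))"
    by (rule sum.swap)
  also have "\<dots> = (\<Sum>k<length as. as ! k * (h * h ^\<^sub>m Suc k) $$ (i, j))"
    using h pw Cons.prems
    by (intro sum.cong refl) (simp add: scalar_prod_def lessThan_atLeast0 sum_distrib_left algebra_simps del: pow_mat.simps)
  finally have "(h * poly0 h as) $$ (i, j) = (\<Sum>k<length as. as ! k * (h ^\<^sub>m Suc (Suc k)) $$ (i, j))"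
    unfolding comm .
  moreover have "h ^\<^sub>m Suc 0 = h" using h by simp
  ultimately show ?case using h c Cons.prems
    by (simp add: sum.lessThan_Suc_shift del: sum.lessThan_Suc pow_mat.simps)
qed (use h in simp)

lemma poly0_annihilates:
  assumes h: "h \<in> carrier_mat n n"
  obtains as where "\<exists>a\<in>set as. a \<noteq> 0" "poly0 h as = 0\<^sub>m n n"
proof -
  define N where "N = Suc (n * n)"
  define M where "M = mat N N (\<lambda>(r, k). if r < n * n then (h ^\<^sub>m Suc k) $$ (r div n, r mod n) else 0)"
  have M: "M \<in> carrier_mat N N" by (simp add: M_def)
  have "M $$ (n * n, j) = 0" if "j < N" for j using that by (simp add: M_def N_def)
  then have "det M = 0"
    using laplace_expansion_row[OF M, of "n * n"] by (simp add: N_def)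
  then obtain v where v: "v \<in> carrier_vec N" "v \<noteq> 0\<^sub>v N" "M *\<^sub>v v = 0\<^sub>v N"
    using det_0_iff_vec_prod_zero[OF M] by auto
  have "\<exists>a\<in>set (list_of_vec v). a \<noteq> 0"
  proof (rule ccontr)
    assume "\<not> ?thesis"
    then have "v $ i = 0" if "i < N" for i
      using that v(1) by (metis carrier_vecD in_set_conv_nth length_list_of_vec list_of_vec_index)
    then have "v = 0\<^sub>v N" using v(1) by (intro eq_vecI) auto
    with v(2) show False by simp
  qed
  moreover have "poly0 h (list_of_vec v) = 0\<^sub>m n n"
  proof (rule eq_matI)
    fix i j assume "i < dim_row (0\<^sub>m n n :: complex mat)" "j < dim_col (0\<^sub>m n n :: complex mat)"
    then have ij: "i < n" "j < n" by auto
    have lt: "i * n + j < n * n"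
    proof -
      have "i * n + j < (i + 1) * n" using ij by simp
      also have "\<dots> \<le> n * n" using ij by (intro mult_right_mono) auto
      finally show ?thesis .
    qed
    have "0 = (M *\<^sub>v v) $ (i * n + j)" using lt v(3) by (simp add: N_def)
    also have "\<dots> = (\<Sum>k<N. (h ^\<^sub>m Suc k) $$ (i, j) * v $ k)"
      using lt ij v(1) by (simp add: M_def N_def scalar_prod_def lessThan_atLeast0 del: pow_mat.simps)
    also have "\<dots> = poly0 h (list_of_vec v) $$ (i, j)"
      using v(1) by (simp add: poly0_index[OF h ij] list_of_vec_index mult.commute del: pow_mat.simps)
    finally show "poly0 h (list_of_vec v) $$ (i, j) = 0\<^sub>m n n $$ (i, j)" using ij by simp
  qed (use poly0_carrier[OF h, of "list_of_vec v"] in auto)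
  ultimately show thesis by (rule that)
qed

lemma poly0_factor:
  assumes h: "h \<in> carrier_mat n n"
  shows "\<exists>g \<in> carrier_mat n n. poly0 h as = h * g \<and> poly0 h as = g * h"
proof (induction as)
  case Nil
  show ?case using h by (intro bexI[of _ "0\<^sub>m n n"]) auto
next
  case (Cons a as)
  then obtain g where g: "g \<in> carrier_mat n n" "poly0 h as = h * g" "poly0 h as = g * h" by blast
  have c: "dim_row h = n" "dim_col h = n" "dim_row g = n" "dim_col g = n" using h g by auto
  have "a \<cdot>\<^sub>m h + h * poly0 h as = h * (a \<cdot>\<^sub>m 1\<^sub>m n + h * g)"
    using c by (simp add: g(2) mat_distrib_dim mat_smult_dim mat_one_zero_dim)
  moreover have "a \<cdot>\<^sub>m h + h * poly0 h as = (a \<cdot>\<^sub>m 1\<^sub>m n + h * g) * h"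
    using c by (simp add: g(3) mat_distrib_dim mat_smult_dim mat_one_zero_dim mat_mult_assoc_dim)
  moreover have "a \<cdot>\<^sub>m 1\<^sub>m n + h * g \<in> carrier_mat n n" using h g by auto
  ultimately show ?case by auto
qed

lemma hermitian_cancel:
  assumes h: "h \<in> carrier_mat n n" "h\<^sup>\<dagger> = h" and x: "x \<in> carrier_mat n n" and z: "h * (h * x) = 0\<^sub>m n n"
  shows "h * x = 0\<^sub>m n n"
proof (rule adjoint_mult_zero)
  have "(h * x)\<^sup>\<dagger> * (h * x) = x\<^sup>\<dagger> * (h * (h * x))"
    using h x by (simp add: mat_adjoint_mult mat_mult_assoc_dim)
  then show "(h * x)\<^sup>\<dagger> * (h * x) = 0\<^sub>m n n" using z x by simp
qed (use h x in auto)

text \<open>A polynomial without constant term that annihilates a Hermitian \<open>h\<close> may be divided by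
  \<open>h\<close> until its linear coefficient is nonzero.\<close>

lemma hermitian_local_unit:
  assumes h: "h \<in> carrier_mat n n" "h\<^sup>\<dagger> = h"
    and as: "\<exists>a\<in>set as. a \<noteq> 0" "poly0 h as = 0\<^sub>m n n"
  shows "\<exists>bs. h * poly0 h bs = h"
  using as
proof (induction as)
  case (Cons a as)
  have pc: "poly0 h as \<in> carrier_mat n n" by (rule poly0_carrier[OF h(1)])
  show ?case
  proof (cases "a = 0")
    case True
    obtain g where g: "g \<in> carrier_mat n n" "poly0 h as = h * g" using poly0_factor[OF h(1)] by blast
    have "0 \<cdot>\<^sub>m h = 0\<^sub>m n n" using h(1) by (intro eq_matI) auto
    then have "h * (h * g) = 0\<^sub>m n n" using Cons.prems(2) True h(1) g(1) by (simp add: g(2))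
    from hermitian_cancel[OF h g(1) this] Cons True g(2) show ?thesis by simp
  next
    case False
    have sc: "poly0 h (map ((*) c) bs) = c \<cdot>\<^sub>m poly0 h bs" for c bs
    proof (induction bs)
      case (Cons b bs)
      have "poly0 h bs \<in> carrier_mat n n" by (rule poly0_carrier[OF h(1)])
      with Cons h(1) show ?case
        by (intro eq_matI) (auto simp: mat_smult_dim algebra_simps simp del: index_mult_mat(1))
    qed (use h(1) in auto)
    have "h * poly0 h (map ((*) (- inverse a)) as) = (- inverse a) \<cdot>\<^sub>m (h * poly0 h as)"
      using h(1) pc by (simp add: sc mat_smult_dim)
    also have "\<dots> = h"
    proof (rule eq_matI)
      fix i j assume ij: "i < dim_row h" "j < dim_col h"
      have "(a \<cdot>\<^sub>m h + h * poly0 h as) $$ (i, j) = 0" using Cons.prems(2) ij h(1) by simp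
      then have "a * h $$ (i, j) + (h * poly0 h as) $$ (i, j) = 0"
        using ij h(1) pc by (simp del: index_mult_mat(1))
      then have "(h * poly0 h as) $$ (i, j) = - a * h $$ (i, j)"
        by (metis add_eq_0_iff mult_minus_left)
      then show "((- inverse a) \<cdot>\<^sub>m (h * poly0 h as)) $$ (i, j) = h $$ (i, j)"
        using ij h(1) pc False by (simp del: index_mult_mat(1))
    qed (use h(1) pc in auto)
    finally show ?thesis by blast
  qed
qed simp

lemma support_projection:
  assumes S: "star_subalgebra n S" and h: "h \<in> S" "h\<^sup>\<dagger> = h"
  obtains s g where "s \<in> S" "is_proj n s" "s * h = h" "g \<in> carrier_mat n n" "s = h * g" "s = g * h"
proof -
  have hc: "h \<in> carrier_mat n n" using sub_carrier[OF S h(1)] .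
  obtain as where "\<exists>a\<in>set as. a \<noteq> 0" "poly0 h as = 0\<^sub>m n n" by (rule poly0_annihilates[OF hc])
  from hermitian_local_unit[OF hc h(2) this] obtain bs where bs: "h * poly0 h bs = h" by blast
  define s where "s = poly0 h bs"
  have sc: "s \<in> carrier_mat n n" unfolding s_def by (rule poly0_carrier[OF hc])
  have sS: "s \<in> S" unfolding s_def
    by (induction bs) (use h(1) hc sub_closed[OF S] in auto)
  obtain g where g: "g \<in> carrier_mat n n" "s = h * g" "s = g * h"
    using poly0_factor[OF hc] unfolding s_def by blast
  have c: "dim_row h = n" "dim_col h = n" "dim_row g = n" "dim_col g = n" "dim_row s = n" "dim_col s = n"
    using hc g(1) sc by auto
  have hs: "h * s = h" using bs by (simp add: s_def)
  from arg_cong[OF this, of mat_adjoint] have sh: "s\<^sup>\<dagger> * h = h" using c h(2) by (simp add: mat_adjoint_mult)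
  have "s\<^sup>\<dagger> * s = s" using c sh by (simp add: g(2) flip: mat_mult_assoc_dim)
  moreover from arg_cong[OF this, of mat_adjoint] have "s\<^sup>\<dagger> * s = s\<^sup>\<dagger>" using c by (simp add: mat_adjoint_mult)
  ultimately have ss: "s\<^sup>\<dagger> = s" "s * s = s" by simp_all
  with sc sh sS g show thesis by (intro that[of s g]) (auto simp: is_proj_def)
qed

definition minimal_proj :: "nat \<Rightarrow> complex mat set \<Rightarrow> complex mat \<Rightarrow> bool" where
  "minimal_proj n S p \<longleftrightarrow> p \<in> S \<and> is_proj n p \<and> p \<noteq> 0\<^sub>m n n \<and> (\<forall>x\<in>S. \<exists>c. p * x * p = c \<cdot>\<^sub>m p)"

lemma eigenvector_exists:
  assumes B: "(B :: complex mat) \<in> carrier_mat r r" and r: "r > 0"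
  obtains \<mu> c where "c \<in> carrier_vec r" "c \<noteq> 0\<^sub>v r" "B *\<^sub>v c = \<mu> \<cdot>\<^sub>v c"
proof -
  have "degree (char_poly B) = r" using degree_monic_char_poly[OF B] by simp
  then have "\<not> constant (poly (char_poly B))" using r by (simp add: constant_degree)
  then obtain \<mu> where "poly (char_poly B) \<mu> = 0" using fundamental_theorem_of_algebra by blast
  then have "eigenvalue B \<mu>" using eigenvalue_root_char_poly[OF B] by simp
  then obtain c where "eigenvector B c \<mu>" by (auto simp: eigenvalue_def)
  with B show thesis by (intro that) (auto simp: eigenvector_def)
qed

lemma minimal_proj_exists:
  assumes S: "star_subalgebra n S" and ne: "S \<noteq> {0\<^sub>m n n}"
  obtains p where "minimal_proj n S p"
proof -
  define pr where "pr t \<longleftrightarrow> (\<exists>p\<in>S. is_proj n p \<and> p \<noteq> 0\<^sub>m n n \<and> mtrace p = of_nat t)" for t :: nat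
  have support: "\<exists>s g. s \<in> S \<and> is_proj n s \<and> s \<noteq> 0\<^sub>m n n \<and> g \<in> carrier_mat n n \<and> s = x\<^sup>\<dagger> * x * g \<and> s = g * (x\<^sup>\<dagger> * x)"
    if x: "x \<in> S" "x \<noteq> 0\<^sub>m n n" for x
  proof -
    have xc: "x \<in> carrier_mat n n" using sub_carrier[OF S x(1)] .
    have "x\<^sup>\<dagger> * x \<in> S" "(x\<^sup>\<dagger> * x)\<^sup>\<dagger> = x\<^sup>\<dagger> * x" using x sub_closed[OF S] xc by (auto simp: mat_adjoint_mult)
    then obtain s g where s: "s \<in> S" "is_proj n s" "s * (x\<^sup>\<dagger> * x) = x\<^sup>\<dagger> * x" "g \<in> carrier_mat n n"
      "s = x\<^sup>\<dagger> * x * g" "s = g * (x\<^sup>\<dagger> * x)" by (rule support_projection[OF S])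
    have "s \<noteq> 0\<^sub>m n n"
    proof
      assume "s = 0\<^sub>m n n"
      then have "x\<^sup>\<dagger> * x = 0\<^sub>m n n" using s(3) xc by auto
      from adjoint_mult_zero[OF xc this] x(2) show False by simp
    qed
    with s show ?thesis by blast
  qed
  obtain x where "x \<in> S" "x \<noteq> 0\<^sub>m n n" using ne sub_closed(1)[OF S] by blast
  from support[OF this] have "\<exists>t. pr t" unfolding pr_def using is_proj_mtrace_nat by metis
  then obtain t where t: "pr t" and least: "\<And>t'. pr t' \<Longrightarrow> t \<le> t'"
    using LeastI[of pr] Least_le[of pr] by metis
  from t obtain p where p: "p \<in> S" "is_proj n p" "p \<noteq> 0\<^sub>m n n" "mtrace p = of_nat t"
    by (auto simp: pr_def)
  have pd: "dim_row p = n" "dim_col p = n" "p * p = p" "p\<^sup>\<dagger> = p" using p(2) by (auto simp: is_proj_def)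
  obtain r V where V: "V \<in> carrier_mat n r" "V\<^sup>\<dagger> * V = 1\<^sub>m r" "V * V\<^sup>\<dagger> = p" by (rule is_proj_isometry[OF p(2)])
  have Vd: "dim_row V = n" "dim_col V = r" using V by auto
  have r: "r > 0" using isometry_dim_pos[OF V(1)] V(3) p(3) by simp
  have "\<exists>c. p * x * p = c \<cdot>\<^sub>m p" if x: "x \<in> S" for x
  proof -
    have xd: "dim_row x = n" "dim_col x = n" using sub_dim[OF S x] .
    have "V\<^sup>\<dagger> * x * V \<in> carrier_mat r r" using Vd by (intro carrier_matI) simp_all
    from eigenvector_exists[OF this r] obtain \<mu> c
      where c: "c \<in> carrier_vec r" "c \<noteq> 0\<^sub>v r" "V\<^sup>\<dagger> * x * V *\<^sub>v c = \<mu> \<cdot>\<^sub>v c" .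
    define u where "u = V *\<^sub>v c"
    have ud: "dim_vec u = n" "u \<in> carrier_vec n" using Vd by (simp_all add: u_def carrier_vecI)
    have Vu: "V\<^sup>\<dagger> *\<^sub>v u = c" using V(2) Vd c(1) by (simp add: u_def flip: mat_mult_vec_assoc_dim)
    have une: "u \<noteq> 0\<^sub>v n" using Vu c(2) Vd by (auto simp: mult_mat_vec_def)
    have pu: "p *\<^sub>v u = u"
      using Vd ud by (simp add: mat_mult_vec_assoc_dim Vu flip: V(3)) (simp add: u_def)
    have "p * x * p *\<^sub>v u = V *\<^sub>v (V\<^sup>\<dagger> * x * V *\<^sub>v c)"
      using pd xd Vd ud pu c(1) by (simp add: mat_mult_vec_assoc_dim) (simp add: u_def mat_mult_vec_assoc_dim flip: V(3))
    also have "\<dots> = \<mu> \<cdot>\<^sub>v u" using c(1,3) Vd by (simp add: u_def mat_vec_distrib_dim)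
    finally have pxpu: "p * x * p *\<^sub>v u = \<mu> \<cdot>\<^sub>v u" .
    define y where "y = p * x * p - \<mu> \<cdot>\<^sub>m p"
    have y: "y \<in> S" unfolding y_def by (intro sub_minus[OF S] sub_closed[OF S] p(1) x)
    have yd: "dim_row y = n" "dim_col y = n" using sub_dim[OF S y] .
    have yu: "y *\<^sub>v u = 0\<^sub>v n"
      using pd xd ud pxpu pu by (simp add: y_def mat_vec_distrib_dim del: index_mult_mat_vec)
    have yp: "y * p = y" using pd xd by (simp add: y_def mat_distrib_dim mat_smult_dim mat_mult_assoc_dim)
    have "y = 0\<^sub>m n n"
    proof (rule ccontr)
      assume "y \<noteq> 0\<^sub>m n n"
      from support[OF y this] obtain s g where s: "s \<in> S" "is_proj n s" "s \<noteq> 0\<^sub>m n n"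
        "g \<in> carrier_mat n n" "s = y\<^sup>\<dagger> * y * g" "s = g * (y\<^sup>\<dagger> * y)" by blast
      have sd: "dim_row s = n" "dim_col s = n" "dim_row g = n" "dim_col g = n"
        using s(2,4) by (auto simp: is_proj_def)
      have py: "p * y\<^sup>\<dagger> = y\<^sup>\<dagger>" using arg_cong[OF yp, of mat_adjoint] pd yd by (simp add: mat_adjoint_mult)
      have ps: "p * s = s" using py pd yd sd by (simp add: s(5) flip: mat_mult_assoc_dim)
      have su: "s *\<^sub>v u = 0\<^sub>v n"
        using yd sd ud yu by (subst s(6)) (simp add: mat_mult_vec_assoc_dim mult_mat_zero_vec_dim)
      have proj: "is_proj n (p - s)" using p(2) s(2) ps by (rule is_proj_diff)
      have "(p - s) *\<^sub>v u = u" using pd sd ud su pu by (simp add: mat_vec_distrib_dim)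
      then have ne: "p - s \<noteq> 0\<^sub>m n n" using une ud zero_mat_mult_vec_dim[OF ud(1), of n] by metis
      obtain t1 where t1: "mtrace (p - s) = of_nat t1" using is_proj_mtrace_nat[OF proj] .
      have "pr t1" unfolding pr_def using proj ne t1 sub_minus[OF S p(1) s(1)] by blast
      then have "t \<le> t1" by (rule least)
      moreover have "mtrace (p - s) = mtrace p - mtrace s"
        using p(2) s(2) by (intro mtrace_minus) (auto simp: is_proj_def)
      then have "real t1 = t - Re (mtrace s)" using t1 p(4) by (metis Re_complex_of_real minus_complex.simps(1) of_real_of_nat_eq)
      moreover have "Re (mtrace s) > 0" using is_proj_mtrace_pos s by blast
      ultimately show False by linarith
    qed
    have "p * x * p = \<mu> \<cdot>\<^sub>m p"
    proof (rule eq_matI)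
      fix i j assume ij: "i < dim_row (\<mu> \<cdot>\<^sub>m p)" "j < dim_col (\<mu> \<cdot>\<^sub>m p)"
      then have "(p * x * p - \<mu> \<cdot>\<^sub>m p) $$ (i, j) = 0" using \<open>y = 0\<^sub>m n n\<close> pd by (simp add: y_def)
      then show "(p * x * p) $$ (i, j) = (\<mu> \<cdot>\<^sub>m p) $$ (i, j)" using ij pd by (simp del: index_mult_mat(1))
    qed (use pd in auto)
    then show ?thesis by blast
  qed
  with p show thesis by (intro that[of p]) (auto simp: minimal_proj_def)
qed

text \<open>The left ideal \<open>Sp\<close> of a minimal projection \<open>p\<close> is a Hilbert space, with
  \<open>x\<^sup>*y = \<langle>x, y\<rangle> p\<close>; a unit vector \<open>v\<close> in the range of \<open>p\<close> identifies it with the subspace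
  \<open>Sv\<close> of \<open>\<complex>\<^sup>n\<close>. The columns of \<open>W\<close> are an orthonormal basis of \<open>Sv\<close>, and
  \<open>x \<mapsto> W\<^sup>*xW\<close> is an irreducible representation of \<open>S\<close> with central support \<open>z\<close>.\<close>

lemma simple_summand:
  assumes S: "star_subalgebra n S" and ne: "S \<noteq> {0\<^sub>m n n}"
  obtains z d W where "z \<in> S" "is_proj n z" "z \<noteq> 0\<^sub>m n n" "\<And>x. x \<in> S \<Longrightarrow> x * z = z * x"
    "d > 0" "W \<in> carrier_mat n d" "W\<^sup>\<dagger> * W = 1\<^sub>m d" "z * W = W"
    "\<And>x. x \<in> S \<Longrightarrow> x * W = W * (W\<^sup>\<dagger> * x * W)"
    "\<And>x. x \<in> S \<Longrightarrow> W\<^sup>\<dagger> * x * W = 0\<^sub>m d d \<Longrightarrow> x * z = 0\<^sub>m n n"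
    "\<And>c. c \<in> carrier_mat d d \<Longrightarrow> \<exists>x\<in>S. x * z = x \<and> W\<^sup>\<dagger> * x * W = c"
proof -
  obtain p where "minimal_proj n S p" by (rule minimal_proj_exists[OF S ne])
  then have p: "p \<in> S" "is_proj n p" "p \<noteq> 0\<^sub>m n n" and min: "\<And>x. x \<in> S \<Longrightarrow> \<exists>c. p * x * p = c \<cdot>\<^sub>m p"
    by (auto simp: minimal_proj_def)
  have pd: "dim_row p = n" "dim_col p = n" "p * p = p" "p\<^sup>\<dagger> = p" using p(2) by (auto simp: is_proj_def)
  note Sd = sub_dim[OF S] note Sc = sub_closed[OF S]
  obtain v where v: "v \<in> carrier_vec n" "p *\<^sub>v v = v" "v \<bullet>c v = 1"
  proof -
    obtain r V where V: "V \<in> carrier_mat n r" "V\<^sup>\<dagger> * V = 1\<^sub>m r" "V * V\<^sup>\<dagger> = p" by (rule is_proj_isometry[OF p(2)])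
    have Vd: "dim_row V = n" "dim_col V = r" using V(1) by auto
    have r: "r > 0" using isometry_dim_pos[OF V(1)] V(3) p(3) by simp
    have "p * V = V * (V\<^sup>\<dagger> * V)" using Vd by (simp add: mat_mult_assoc_dim flip: V(3))
    then have "p * V = V" using Vd V(2) by (simp add: mat_one_zero_dim)
    moreover have "col (p * V) 0 = p *\<^sub>v col V 0" using pd Vd r by (simp add: col_mult2_dim)
    ultimately have "p *\<^sub>v col V 0 = col V 0" by simp
    moreover have "col V 0 \<bullet>c col V 0 = (V\<^sup>\<dagger> * V) $$ (0, 0)"
      using r Vd by (simp add: scalar_prod_def mult.commute)
    ultimately show thesis using Vd V(2) r by (intro that[of "col V 0"]) (simp_all add: carrier_vecI)
  qed
  have vd: "dim_vec v = n" using v(1) by simp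
  define L where "L = {x \<in> S. x * p = x}"
  have LS: "x \<in> L \<Longrightarrow> x \<in> S" and Lp: "x \<in> L \<Longrightarrow> x * p = x" for x by (auto simp: L_def)
  have mult_L: "x * y \<in> L" if "x \<in> S" "y \<in> L" for x y
    using that Sc pd by (auto simp: L_def mat_mult_assoc_dim Sd)
  have minus_L: "x - y \<in> L" if "x \<in> L" "y \<in> L" for x y
    using that sub_minus[OF S] pd by (auto simp: L_def mat_distrib_dim Sd)
  have xp_L: "x * p \<in> L" if "x \<in> S" for x
    using that Sc p(1) pd by (auto simp: L_def mat_mult_assoc_dim Sd)
  have adj_mult_L: "\<exists>c. x\<^sup>\<dagger> * y = c \<cdot>\<^sub>m p" if "x \<in> L" "y \<in> L" for x y
  proof -
    have d: "dim_row x = n" "dim_col x = n" "dim_row y = n" "dim_col y = n" using that LS Sd by auto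
    have "p * x\<^sup>\<dagger> = x\<^sup>\<dagger>" using arg_cong[OF Lp[OF that(1)], of mat_adjoint] pd d by (simp add: mat_adjoint_mult)
    moreover have "p * (x\<^sup>\<dagger> * y) * p = (p * x\<^sup>\<dagger>) * (y * p)" using pd d by (simp add: mat_mult_assoc_dim)
    ultimately have "p * (x\<^sup>\<dagger> * y) * p = x\<^sup>\<dagger> * y" using Lp that by simp
    with min[of "x\<^sup>\<dagger> * y"] that LS Sc show ?thesis by auto
  qed
  have smult_v: "c = c'" if "c \<cdot>\<^sub>v v = c' \<cdot>\<^sub>v v" for c c'
  proof -
    have "(c \<cdot>\<^sub>v v) \<bullet>c v = (c' \<cdot>\<^sub>v v) \<bullet>c v" using that by simp
    then show ?thesis using vd v(3) by simp
  qed
  have L_zero: "x = 0\<^sub>m n n" if x: "x \<in> L" "x *\<^sub>v v = 0\<^sub>v n" for x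
  proof -
    have d: "dim_row x = n" "dim_col x = n" using x LS Sd by auto
    obtain c where c: "x\<^sup>\<dagger> * x = c \<cdot>\<^sub>m p" using adj_mult_L x(1) by blast
    have "c \<cdot>\<^sub>v v = x\<^sup>\<dagger> * x *\<^sub>v v" using pd vd v(2) by (simp add: c mat_vec_distrib_dim)
    also have "\<dots> = 0 \<cdot>\<^sub>v v" using d v(1) x(2) by (auto simp: mat_mult_vec_assoc_dim mult_mat_zero_vec_dim)
    finally have "c = 0" by (rule smult_v)
    then have "x\<^sup>\<dagger> * x = 0\<^sub>m n n" using c pd by (auto intro!: eq_matI)
    then show ?thesis by (rule adjoint_mult_zero[rotated]) (use sub_carrier[OF S] LS x in blast)
  qed
  define T where "T = (\<lambda>x. x *\<^sub>v v) ` L"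
  have T: "vec_subspace n T"
    unfolding vec_subspace_def
  proof (intro conjI allI ballI)
    show "T \<subseteq> carrier_vec n" using LS Sd by (auto simp: T_def intro!: carrier_vecI)
    have "0\<^sub>m n n \<in> L" using Sc pd by (auto simp: L_def)
    then show "0\<^sub>v n \<in> T" using v(1) by (force simp: T_def)
  next
    fix x y assume "x \<in> T" "y \<in> T"
    then obtain a b where ab: "a \<in> L" "b \<in> L" "x = a *\<^sub>v v" "y = b *\<^sub>v v" by (auto simp: T_def)
    have "a + b \<in> L" using ab(1,2) Sc pd by (auto simp: L_def mat_distrib_dim Sd)
    moreover have "x + y = (a + b) *\<^sub>v v" using ab LS Sd vd by (simp add: mat_vec_distrib_dim)
    ultimately show "x + y \<in> T" by (auto simp: T_def)
  next
    fix c x assume "x \<in> T"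
    then obtain a where a: "a \<in> L" "x = a *\<^sub>v v" by (auto simp: T_def)
    have "c \<cdot>\<^sub>m a \<in> L" using a(1) Sc pd by (auto simp: L_def mat_smult_dim Sd)
    moreover have "c \<cdot>\<^sub>v x = (c \<cdot>\<^sub>m a) *\<^sub>v v" using a LS Sd vd by (simp add: mat_vec_distrib_dim)
    ultimately show "c \<cdot>\<^sub>v x \<in> T" by (auto simp: T_def)
  qed
  obtain d W where W: "W \<in> carrier_mat n d" "W\<^sup>\<dagger> * W = 1\<^sub>m d" "\<And>j. j < d \<Longrightarrow> col W j \<in> T"
    "\<And>x. x \<in> T \<Longrightarrow> W *\<^sub>v (W\<^sup>\<dagger> *\<^sub>v x) = x" by (rule orthonormal_basis[OF T]) blast
  have Wd: "dim_row W = n" "dim_col W = d" using W(1) by auto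
  have lift: "\<exists>u\<in>L. u *\<^sub>v v = W *\<^sub>v c" if "c \<in> carrier_vec d" for c
    using vec_subspace_mult_mat_vec[OF T W(1) W(3) that] by (auto simp: T_def)
  have "\<forall>j. \<exists>u. j < d \<longrightarrow> u \<in> L \<and> u *\<^sub>v v = col W j" using W(3) by (force simp: T_def)
  then obtain u where u: "\<And>j. j < d \<Longrightarrow> u j \<in> L" "\<And>j. j < d \<Longrightarrow> u j *\<^sub>v v = col W j" by metis
  have ud: "dim_row (u j) = n" "dim_col (u j) = n" if "j < d" for j using u(1)[OF that] LS Sd by auto
  have orth: "(u i)\<^sup>\<dagger> *\<^sub>v col W j = (if i = j then v else 0\<^sub>v n)" if ij: "i < d" "j < d" for i j
  proof -
    obtain c where c: "(u i)\<^sup>\<dagger> * u j = c \<cdot>\<^sub>m p" using adj_mult_L u(1) ij by blast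
    have l: "(u i)\<^sup>\<dagger> *\<^sub>v col W j = c \<cdot>\<^sub>v v"
      using arg_cong[OF c, of "\<lambda>M. M *\<^sub>v v"] ud[OF ij(1)] ud[OF ij(2)] vd pd v(2) ij
      by (simp add: mat_mult_vec_assoc_dim mat_vec_distrib_dim u(2))
    have "c * (v \<bullet>c v) = (c \<cdot>\<^sub>v v) \<bullet>c v" using vd by simp
    also have "\<dots> = ((u i)\<^sup>\<dagger> *\<^sub>v col W j) \<bullet>c v" using l by simp
    also have "\<dots> = col W j \<bullet>c (u i *\<^sub>v v)"
    proof -
      have "(u i)\<^sup>\<dagger> \<in> carrier_mat n n" "col W j \<in> carrier_vec n"
        using ud[OF ij(1)] Wd by (auto intro!: carrier_matI carrier_vecI)
      from cscalar_prod_adjoint[OF this v(1)] show ?thesis unfolding mat_adjoint_adjoint .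
    qed
    also have "\<dots> = (W\<^sup>\<dagger> * W) $$ (i, j)"
      using ij Wd by (simp add: u(2) scalar_prod_def mult.commute)
    also have "\<dots> = (if i = j then 1 else 0)" using W(2) ij by simp
    finally have "c = (if i = j then 1 else 0)" using v(3) by simp
    with l v(1) show ?thesis by auto
  qed
  define G where "G f = msum n (\<lambda>j. f j * (u j)\<^sup>\<dagger>) d" for f
  have G_S: "G f \<in> S" if "\<And>j. j < d \<Longrightarrow> f j \<in> S" for f
    unfolding G_def using that u(1) LS by (intro sub_msum[OF S] Sc) auto
  have G_col: "G f *\<^sub>v col W j = f j *\<^sub>v v" if f: "\<And>j. j < d \<Longrightarrow> f j \<in> S" and j: "j < d" for f j
  proof -
    have "G f *\<^sub>v col W j = f j * (u j)\<^sup>\<dagger> *\<^sub>v col W j"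
      unfolding G_def using f Wd
      by (intro msum_mult_vec_single j)
        (auto simp: ud Sd orth mat_mult_vec_assoc_dim mult_mat_zero_vec_dim j intro!: carrier_matI carrier_vecI)
    then show ?thesis using f[OF j] Wd j by (simp add: mat_mult_vec_assoc_dim ud Sd orth)
  qed
  have G_left: "x * G f = G (\<lambda>j. x * f j)" if "x \<in> S" "\<And>j. j < d \<Longrightarrow> f j \<in> S" for x f
  proof -
    have "x * G f = msum n (\<lambda>j. x * (f j * (u j)\<^sup>\<dagger>)) d"
      unfolding G_def using that by (intro msum_mult_left) (auto simp: ud Sd intro!: carrier_matI)
    also have "\<dots> = G (\<lambda>j. x * f j)"
      unfolding G_def using that by (intro msum_cong) (auto simp: ud Sd mat_mult_assoc_dim)
    finally show ?thesis .
  qed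
  have G_cong: "G f = G g" if "\<And>j. j < d \<Longrightarrow> f j = g j" for f g
    unfolding G_def using that by (intro msum_cong) auto
  define z where "z = G u"
  have uS: "u j \<in> S" if "j < d" for j using u(1) LS that by blast
  have z: "z \<in> S" unfolding z_def by (rule G_S[OF uS])
  have zd: "dim_row z = n" "dim_col z = n" using Sd z by auto
  have zW: "z * W = W"
  proof (rule mat_col_eqI)
    fix j assume "j < dim_col W"
    then show "col (z * W) j = col W j"
      using zd Wd G_col[OF uS] u(2) by (simp add: col_mult2_dim) (simp add: z_def)
  qed (use zd Wd in auto)
  have zL: "z * x = x" if x: "x \<in> L" for x
  proof -
    have d: "dim_row x = n" "dim_col x = n" using x LS Sd by auto
    have "x *\<^sub>v v \<in> T" using x by (simp add: T_def)
    then have "W *\<^sub>v (W\<^sup>\<dagger> *\<^sub>v (x *\<^sub>v v)) = x *\<^sub>v v" by (rule W(4))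
    moreover have "z *\<^sub>v (W *\<^sub>v (W\<^sup>\<dagger> *\<^sub>v (x *\<^sub>v v))) = W *\<^sub>v (W\<^sup>\<dagger> *\<^sub>v (x *\<^sub>v v))"
      using zd Wd d zW by (simp flip: mat_mult_vec_assoc_dim[of z])
    ultimately have "z *\<^sub>v (x *\<^sub>v v) = x *\<^sub>v v" by simp
    then have "(z * x - x) *\<^sub>v v = 0\<^sub>v n"
      using zd d vd by (auto simp: mat_vec_distrib_dim mat_mult_vec_assoc_dim)
    moreover have "z * x - x \<in> L" using mult_L minus_L z x by blast
    ultimately have "z * x - x = 0\<^sub>m n n" by (intro L_zero)
    then show ?thesis by (rule mat_diff_zeroD) (simp_all add: zd d)
  qed
  have zGz: "z * G f = G f" if "\<And>j. j < d \<Longrightarrow> f j \<in> L" for f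
    using that LS zL by (simp add: G_left z) (intro G_cong, auto)
  have adz: "z\<^sup>\<dagger> = z"
    unfolding z_def G_def by (subst msum_adjoint) (auto simp: ud mat_adjoint_mult intro!: msum_cong carrier_matI)
  have zz: "z * z = z" using zGz[of u] u(1) by (simp add: z_def)
  have zxz: "z * (x * z) = x * z" if x: "x \<in> S" for x
    using zGz[of "\<lambda>j. x * u j"] mult_L x u(1) by (simp add: z_def G_left uS)
  have central: "x * z = z * x" if x: "x \<in> S" for x
  proof -
    have "z * (x\<^sup>\<dagger> * z) = x\<^sup>\<dagger> * z" using zxz[of "x\<^sup>\<dagger>"] x Sc by simp
    from arg_cong[OF this, of mat_adjoint] have "z * (x * z) = z * x"
      using Sd[OF x] zd adz by (simp add: mat_adjoint_mult mat_mult_assoc_dim)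
    with zxz[OF x] show ?thesis by simp
  qed
  have d0: "d > 0"
  proof (rule ccontr)
    assume "\<not> d > 0"
    have "p \<in> L" using p(1) pd by (simp add: L_def)
    then have "v \<in> T" using v(2) unfolding T_def by (metis imageI)
    from W(4)[OF this] have "W *\<^sub>v (W\<^sup>\<dagger> *\<^sub>v v) = v" .
    moreover have "W *\<^sub>v (W\<^sup>\<dagger> *\<^sub>v v) = 0\<^sub>v n"
      using Wd \<open>\<not> d > 0\<close> by (intro eq_vecI) (auto simp: scalar_prod_def)
    ultimately have "v = 0\<^sub>v n" by simp
    with v(1,3) show False by simp
  qed
  have zne: "z \<noteq> 0\<^sub>m n n"
  proof
    assume "z = 0\<^sub>m n n"
    then have "W = 0\<^sub>m n d" using zW Wd by (simp add: mat_one_zero_dim)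
    then have "(W\<^sup>\<dagger> * W) $$ (0, 0) = 0" using d0 by (simp add: scalar_prod_def)
    with W(2) d0 show False by simp
  qed
  have inv: "x * W = W * (W\<^sup>\<dagger> * x * W)" if x: "x \<in> S" for x
  proof (rule mat_col_eqI)
    fix j assume "j < dim_col (W * (W\<^sup>\<dagger> * x * W))"
    then have j: "j < d" using Wd by simp
    have "(x * u j) *\<^sub>v v \<in> T" using mult_L x u(1) j by (auto simp: T_def)
    then have "x *\<^sub>v col W j \<in> T" using Sd[OF x] ud[OF j] vd u(2) j by (simp add: mat_mult_vec_assoc_dim)
    from W(4)[OF this] show "col (x * W) j = col (W * (W\<^sup>\<dagger> * x * W)) j"
      using Wd Sd[OF x] j by (simp add: col_mult2_dim mat_mult_assoc_dim)
  qed (use Wd Sd[OF x] in auto)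
  have ker: "x * z = 0\<^sub>m n n" if x: "x \<in> S" and 0: "W\<^sup>\<dagger> * x * W = 0\<^sub>m d d" for x
  proof -
    have xW: "x * W = 0\<^sub>m n d" using inv[OF x] 0 Wd by (simp add: mat_one_zero_dim)
    have "x * u j = 0\<^sub>m n n" if j: "j < d" for j
    proof (rule L_zero)
      show "x * u j \<in> L" using mult_L x u(1) j by blast
      have "x * u j *\<^sub>v v = col (x * W) j"
        using Sd[OF x] ud[OF j] vd u(2) j Wd by (simp add: mat_mult_vec_assoc_dim col_mult2_dim)
      then show "x * u j *\<^sub>v v = 0\<^sub>v n" using xW j by simp
    qed
    then have "G (\<lambda>j. x * u j) = msum n (\<lambda>_. 0\<^sub>m n n) d"
      unfolding G_def by (intro msum_cong) (simp add: ud mat_one_zero_dim)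
    then show ?thesis using x uS by (simp add: z_def G_left msum_zero)
  qed
  have surj: "\<exists>x\<in>S. x * z = x \<and> W\<^sup>\<dagger> * x * W = c" if c: "c \<in> carrier_mat d d" for c
  proof -
    have cd: "dim_row c = d" "dim_col c = d" using c by auto
    have "\<forall>j. \<exists>a. j < d \<longrightarrow> a \<in> L \<and> a *\<^sub>v v = W *\<^sub>v col c j"
      using lift[of "col c j" for j] cd by (metis carrier_vecI dim_col)
    then obtain f where f: "\<And>j. j < d \<Longrightarrow> f j \<in> L" "\<And>j. j < d \<Longrightarrow> f j *\<^sub>v v = W *\<^sub>v col c j" by metis
    have GS: "G f \<in> S" using f(1) LS by (intro G_S) auto
    have "z * G f = G f" using f(1) by (rule zGz)
    moreover have "G f * W = W * c"
    proof (rule mat_col_eqI)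
      fix j assume "j < dim_col (W * c)"
      then have j: "j < d" using cd by simp
      then show "col (G f * W) j = col (W * c) j"
        using G_col[of f j] f LS Sd[OF GS] Wd cd by (simp add: col_mult2_dim)
    qed (use Sd[OF GS] Wd cd in auto)
    then have "W\<^sup>\<dagger> * G f * W = W\<^sup>\<dagger> * W * c" using Wd Sd[OF GS] cd by (simp add: mat_mult_assoc_dim)
    then have "W\<^sup>\<dagger> * G f * W = c" using W(2) cd by (simp add: mat_one_zero_dim)
    ultimately show ?thesis using GS central by metis
  qed
  have proj: "is_proj n z" using sub_carrier[OF S z] zz adz by (simp add: is_proj_def)
  show thesis by (rule that[OF z proj zne central d0 W(1,2) zW inv ker surj])
qed

text \<open>The irreducible representations \<open>x \<mapsto> W\<^sup>*xW\<close> of \<open>S\<close>, one from each equivalence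
  class. The projection \<open>q\<close> is fixed to \<open>1\<close> in the end; it is a parameter so that the trace of
  \<open>q\<close> can decrease when a simple summand of \<open>S\<close> is split off.\<close>

definition block_system :: "nat \<Rightarrow> complex mat set \<Rightarrow> complex mat \<Rightarrow> complex mat list \<Rightarrow> bool" where
  "block_system n S q Ws \<longleftrightarrow>
     (\<forall>W\<in>set Ws. W \<in> carrier_mat n (dim_col W) \<and> 0 < dim_col W \<and> q * W = W \<and>
        (\<forall>x\<in>S. x * W = W * (W\<^sup>\<dagger> * x * W))) \<and>
     (\<forall>x\<in>S. (\<forall>W\<in>set Ws. W\<^sup>\<dagger> * x * W = 0\<^sub>m (dim_col W) (dim_col W)) \<longrightarrow> x = 0\<^sub>m n n) \<and>
     (\<forall>cs. list_all2 (\<lambda>c W. c \<in> carrier_mat (dim_col W) (dim_col W)) cs Ws \<longrightarrow>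
        (\<exists>x\<in>S. map (\<lambda>W. W\<^sup>\<dagger> * x * W) Ws = cs))"

lemma block_system_exists:
  assumes "star_subalgebra n S" "is_proj n q" "\<And>x. x \<in> S \<Longrightarrow> q * x = x" "mtrace q = of_nat t"
  shows "\<exists>Ws. block_system n S q Ws"
  using assms
proof (induction t arbitrary: S q rule: less_induct)
  case (less t)
  note S = less.prems(1) and q = less.prems(2) and qx = less.prems(3)
  note Sd = sub_dim[OF S] note Sc = sub_closed[OF S]
  have qd: "dim_row q = n" "dim_col q = n" "q * q = q" "q\<^sup>\<dagger> = q" using q by (auto simp: is_proj_def)
  have xq: "x * q = x" if x: "x \<in> S" for x
    using arg_cong[OF qx[of "x\<^sup>\<dagger>"], of mat_adjoint] x Sc Sd[OF x] qd by (simp add: mat_adjoint_mult)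
  show ?case
  proof (cases "S = {0\<^sub>m n n}")
    case True
    then have "block_system n S q []" by (auto simp: block_system_def)
    then show ?thesis by blast
  next
    case False
    obtain z d W where z: "z \<in> S" "is_proj n z" "z \<noteq> 0\<^sub>m n n" and comm: "\<And>x. x \<in> S \<Longrightarrow> x * z = z * x"
      and d: "d > 0" and W: "W \<in> carrier_mat n d" "W\<^sup>\<dagger> * W = 1\<^sub>m d" "z * W = W"
      and inv: "\<And>x. x \<in> S \<Longrightarrow> x * W = W * (W\<^sup>\<dagger> * x * W)"
      and ker: "\<And>x. x \<in> S \<Longrightarrow> W\<^sup>\<dagger> * x * W = 0\<^sub>m d d \<Longrightarrow> x * z = 0\<^sub>m n n"
      and surj: "\<And>c. c \<in> carrier_mat d d \<Longrightarrow> \<exists>x\<in>S. x * z = x \<and> W\<^sup>\<dagger> * x * W = c"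
      by (rule simple_summand[OF S False]) blast
    have Wd: "dim_row W = n" "dim_col W = d" using W(1) by auto
    have zd: "dim_row z = n" "dim_col z = n" "z * z = z" "z\<^sup>\<dagger> = z" using z(2) by (auto simp: is_proj_def)
    define S' where "S' = {x \<in> S. x * z = 0\<^sub>m n n}"
    define q' where "q' = q - z"
    have q'd: "dim_row q' = n" "dim_col q' = n" using qd zd by (auto simp: q'_def)
    have S'S: "x \<in> S" and S'z: "x * z = 0\<^sub>m n n" if "x \<in> S'" for x using that by (auto simp: S'_def)
    have S': "star_subalgebra n S'"
      unfolding star_subalgebra_def
    proof (intro conjI ballI allI)
      show "S' \<subseteq> carrier_mat n n" using sub_carrier[OF S] by (auto simp: S'_def)
      show "0\<^sub>m n n \<in> S'" using Sc zd by (simp add: S'_def mat_one_zero_dim)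
    next
      fix x y assume xy: "x \<in> S'" "y \<in> S'"
      note D = Sd[OF S'S[OF xy(1)]] Sd[OF S'S[OF xy(2)]]
      show "x + y \<in> S'" using xy Sc D zd by (simp add: S'_def mat_distrib_dim)
      show "x * y \<in> S'" using xy Sc D zd by (simp add: S'_def mat_mult_assoc_dim mat_one_zero_dim)
    next
      fix c :: complex and x assume x: "x \<in> S'"
      note D = Sd[OF S'S[OF x]]
      have "c \<cdot>\<^sub>m 0\<^sub>m n n = 0\<^sub>m n n" by (intro eq_matI) auto
      then show "c \<cdot>\<^sub>m x \<in> S'" using x Sc D zd by (simp add: S'_def mat_smult_dim)
    next
      fix x assume x: "x \<in> S'"
      note D = Sd[OF S'S[OF x]]
      have "z * x = 0\<^sub>m n n" using x comm by (auto simp: S'_def)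
      from arg_cong[OF this, of mat_adjoint] have "x\<^sup>\<dagger> * z = 0\<^sub>m n n" using D zd by (simp add: mat_adjoint_mult)
      then show "x\<^sup>\<dagger> \<in> S'" using x Sc by (simp add: S'_def)
    qed
    have q': "is_proj n q'" unfolding q'_def by (rule is_proj_diff[OF q z(2) qx[OF z(1)]])
    have q'x: "q' * x = x" if x: "x \<in> S'" for x
    proof -
      have "z * x = 0\<^sub>m n n" using comm[OF S'S[OF x]] S'z[OF x] by simp
      then show ?thesis using Sd[OF S'S[OF x]] qd zd qx[OF S'S[OF x]]
        by (simp add: q'_def mat_distrib_dim) (intro eq_matI, auto)
    qed
    obtain t' where t': "mtrace q' = of_nat t'" by (rule is_proj_mtrace_nat[OF q'])
    have "mtrace q' = mtrace q - mtrace z"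
      unfolding q'_def using q z(2) by (intro mtrace_minus) (auto simp: is_proj_def)
    then have "real t' = real t - Re (mtrace z)" using t' less.prems(4)
      by (metis Re_complex_of_real minus_complex.simps(1) of_real_of_nat_eq)
    then have "t' < t" using is_proj_mtrace_pos[OF z(2,3)] by linarith
    from less.IH[OF this S' q' q'x t'] obtain Ws where "block_system n S' q' Ws" by blast
    then have Ws: "\<And>U. U \<in> set Ws \<Longrightarrow> U \<in> carrier_mat n (dim_col U) \<and> 0 < dim_col U \<and> q' * U = U"
      and inv': "\<And>U x. U \<in> set Ws \<Longrightarrow> x \<in> S' \<Longrightarrow> x * U = U * (U\<^sup>\<dagger> * x * U)"
      and ker': "\<And>x. x \<in> S' \<Longrightarrow> \<forall>U\<in>set Ws. U\<^sup>\<dagger> * x * U = 0\<^sub>m (dim_col U) (dim_col U) \<Longrightarrow> x = 0\<^sub>m n n"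
      and surj': "\<And>cs. list_all2 (\<lambda>c U. c \<in> carrier_mat (dim_col U) (dim_col U)) cs Ws \<Longrightarrow>
        \<exists>x\<in>S'. map (\<lambda>U. U\<^sup>\<dagger> * x * U) Ws = cs"
      unfolding block_system_def by blast+
    have Ud: "dim_row U = n" if "U \<in> set Ws" for U using Ws[OF that] by auto
    have zq': "z * q' = 0\<^sub>m n n"
      using zd qd xq[OF z(1)] by (simp add: q'_def mat_distrib_dim) (intro eq_matI, auto)
    have qq': "q * q' = q'" using zd qd qx[OF z(1)] by (simp add: q'_def mat_distrib_dim)
    have zU: "z * U = 0\<^sub>m n (dim_col U)" if U: "U \<in> set Ws" for U
    proof -
      have "z * U = z * q' * U" using Ws[OF U] Ud[OF U] zd q'd by (simp add: mat_mult_assoc_dim)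
      then show ?thesis using zq' Ud[OF U] by (simp add: mat_one_zero_dim)
    qed
    have qU: "q * U = U" if U: "U \<in> set Ws" for U
    proof -
      have "q * (q' * U) = q' * U" using qq' Ud[OF U] qd q'd by (simp flip: mat_mult_assoc_dim)
      then show ?thesis using Ws[OF U] by simp
    qed
    have qW: "q * W = W"
    proof -
      have "q * (z * W) = z * W" using qx[OF z(1)] Wd qd zd by (simp flip: mat_mult_assoc_dim)
      then show ?thesis using W(3) by simp
    qed
    have rest: "x - x * z \<in> S'" if x: "x \<in> S" for x
      using x z(1) Sc sub_minus[OF S] Sd[OF x] zd
      by (auto simp: S'_def mat_distrib_dim mat_mult_assoc_dim intro!: eq_matI)
    have restU: "(x - x * z) * U = x * U" if x: "x \<in> S" and U: "U \<in> set Ws" for x U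
    proof -
      have "(x - x * z) * U = x * U - 0\<^sub>m n (dim_col U)"
        using Sd[OF x] zd Ud[OF U] zU[OF U] by (simp add: mat_distrib_dim mat_mult_assoc_dim mat_one_zero_dim)
      also have "\<dots> = x * U" using Sd[OF x] by (intro eq_matI) auto
      finally show ?thesis .
    qed
    have "block_system n S q (W # Ws)"
      unfolding block_system_def
    proof (intro conjI ballI allI impI)
      fix U assume U: "U \<in> set (W # Ws)"
      then show "U \<in> carrier_mat n (dim_col U)" "0 < dim_col U" "q * U = U"
        using W Wd d Ws qU qW by (auto simp del: carrier_matD)
      fix x assume x: "x \<in> S"
      show "x * U = U * (U\<^sup>\<dagger> * x * U)"
      proof (cases "U = W")
        case True
        then show ?thesis using inv[OF x] by simp
      next
        case False
        then have U: "U \<in> set Ws" using U by simp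
        from inv'[OF U rest[OF x]] show ?thesis
          using restU[OF x U] Sd[OF x] zd Ud[OF U] by (simp add: mat_mult_assoc_dim)
      qed
    next
      fix x assume x: "x \<in> S" and 0: "\<forall>U\<in>set (W # Ws). U\<^sup>\<dagger> * x * U = 0\<^sub>m (dim_col U) (dim_col U)"
      have xz: "x * z = 0\<^sub>m n n" using ker[OF x] 0 Wd by simp
      have "x \<in> S'" using x xz by (simp add: S'_def)
      then show "x = 0\<^sub>m n n" using ker' 0 by simp
    next
      fix cs :: "complex mat list" assume "list_all2 (\<lambda>c U. c \<in> carrier_mat (dim_col U) (dim_col U)) cs (W # Ws)"
      then obtain c cs' where cs: "cs = c # cs'" "c \<in> carrier_mat d d"
        "list_all2 (\<lambda>c U. c \<in> carrier_mat (dim_col U) (dim_col U)) cs' Ws"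
        using Wd by (auto simp: list_all2_Cons2)
      obtain x where x: "x \<in> S" "x * z = x" "W\<^sup>\<dagger> * x * W = c" using surj[OF cs(2)] by blast
      obtain y where y: "y \<in> S'" "map (\<lambda>U. U\<^sup>\<dagger> * y * U) Ws = cs'" using surj'[OF cs(3)] by blast
      note D = Sd[OF x(1)] Sd[OF S'S[OF y(1)]]
      have "y * z * W = 0\<^sub>m n d" using S'z[OF y(1)] Wd by (simp add: mat_one_zero_dim)
      then have yW: "y * W = 0\<^sub>m n d" using W(3) D zd Wd by (simp add: mat_mult_assoc_dim)
      have xU: "x * U = 0\<^sub>m n (dim_col U)" if U: "U \<in> set Ws" for U
      proof -
        have "x * z * U = 0\<^sub>m n (dim_col U)"
          using zU[OF U] D zd Ud[OF U] by (simp add: mat_mult_assoc_dim mat_one_zero_dim)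
        then show ?thesis using x(2) by simp
      qed
      have "W\<^sup>\<dagger> * (x + y) * W = W\<^sup>\<dagger> * (x * W + y * W)"
        using D Wd by (simp add: mat_mult_assoc_dim mat_distrib_dim)
      also have "x * W + y * W = x * W" unfolding yW using D Wd by (intro eq_matI) auto
      also have "W\<^sup>\<dagger> * (x * W) = c" using x(3) D Wd by (simp add: mat_mult_assoc_dim)
      finally have 1: "W\<^sup>\<dagger> * (x + y) * W = c" .
      have 2: "U\<^sup>\<dagger> * (x + y) * U = U\<^sup>\<dagger> * y * U" if U: "U \<in> set Ws" for U
      proof -
        have "U\<^sup>\<dagger> * (x + y) * U = U\<^sup>\<dagger> * (x * U + y * U)"
          using D Ud[OF U] by (simp add: mat_mult_assoc_dim mat_distrib_dim)
        also have "x * U + y * U = y * U" unfolding xU[OF U] using D Ud[OF U] by (intro eq_matI) auto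
        finally show ?thesis using D Ud[OF U] by (simp add: mat_mult_assoc_dim)
      qed
      have "x + y \<in> S" using Sc x(1) S'S[OF y(1)] by blast
      moreover have "map (\<lambda>U. U\<^sup>\<dagger> * (x + y) * U) (W # Ws) = cs"
        using 1 2 y(2) cs(1) by (auto cong: map_cong)
      ultimately show "\<exists>x\<in>S. map (\<lambda>U. U\<^sup>\<dagger> * x * U) (W # Ws) = cs" by blast
    qed
    then show ?thesis by blast
  qed
qed

lemma mat_direct_sum_sel [simp]:
  "carrier (mat_direct_sum ds) = {xs. list_all2 (\<lambda>x d. x \<in> carrier_mat d d) xs ds}"
  "mult (mat_direct_sum ds) = map2 (*)" "one (mat_direct_sum ds) = map 1\<^sub>m ds"
  "zero (mat_direct_sum ds) = map (\<lambda>d. 0\<^sub>m d d) ds" "add (mat_direct_sum ds) = map2 (+)"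
  "smult (mat_direct_sum ds) = (\<lambda>c. map (\<lambda>x. c \<cdot>\<^sub>m x))" "adj (mat_direct_sum ds) = map mat_adjoint"
  by (simp_all add: mat_direct_sum_def)

lemma star_subalgebra_iso_direct_sum:
  fixes A :: "'a star_algebra"
  assumes \<pi>: "\<pi> \<in> star_hom A (mat_algebra n)" "inj_on \<pi> (carrier A)"
    and S: "star_subalgebra n (\<pi> ` carrier A)"
  obtains ds where "\<forall>d\<in>set ds. 0 < d" "star_iso A (mat_direct_sum ds)"
proof -
  define S where "S = \<pi> ` carrier A"
  note SS = S[folded S_def]
  obtain Ws where "block_system n S (1\<^sub>m n) Ws"
    using block_system_exists[OF SS is_proj_one, of n] sub_dim[OF SS] by (auto simp: mat_one_zero_dim)
  then have Ws: "\<And>U. U \<in> set Ws \<Longrightarrow> U \<in> carrier_mat n (dim_col U) \<and> 0 < dim_col U"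
    and inv: "\<And>U x. U \<in> set Ws \<Longrightarrow> x \<in> S \<Longrightarrow> x * U = U * (U\<^sup>\<dagger> * x * U)"
    and ker: "\<And>x. x \<in> S \<Longrightarrow> \<forall>U\<in>set Ws. U\<^sup>\<dagger> * x * U = 0\<^sub>m (dim_col U) (dim_col U) \<Longrightarrow> x = 0\<^sub>m n n"
    and surj: "\<And>cs. list_all2 (\<lambda>c U. c \<in> carrier_mat (dim_col U) (dim_col U)) cs Ws \<Longrightarrow>
      \<exists>x\<in>S. map (\<lambda>U. U\<^sup>\<dagger> * x * U) Ws = cs"
    unfolding block_system_def by blast+
  have Ud: "dim_row U = n" if "U \<in> set Ws" for U using Ws[OF that] by auto
  define ds where "ds = map dim_col Ws"
  define g where "g x = map (\<lambda>U. U\<^sup>\<dagger> * x * U) Ws" for x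
  note Sd = sub_dim[OF SS] note Sc = sub_closed[OF SS]
  have g_add: "g (x + y) = map2 (+) (g x) (g y)" if "x \<in> S" "y \<in> S" for x y
    using that unfolding g_def
    by (auto simp: zip_map_map zip_same_conv_map Sd Ud mat_distrib_dim mat_mult_assoc_dim)
  have g_mult: "g (x * y) = map2 (*) (g x) (g y)" if xy: "x \<in> S" "y \<in> S" for x y
  proof -
    have "U\<^sup>\<dagger> * (x * y) * U = U\<^sup>\<dagger> * x * U * (U\<^sup>\<dagger> * y * U)" if U: "U \<in> set Ws" for U
    proof -
      have "U\<^sup>\<dagger> * (x * y) * U = U\<^sup>\<dagger> * (x * (y * U))"
        using xy Sd Ud[OF U] by (simp add: mat_mult_assoc_dim)
      also have "\<dots> = U\<^sup>\<dagger> * (x * (U * (U\<^sup>\<dagger> * y * U)))" using inv[OF U xy(2)] by simp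
      finally show ?thesis using xy Sd Ud[OF U] by (simp add: mat_mult_assoc_dim)
    qed
    then show ?thesis unfolding g_def by (auto simp: zip_map_map zip_same_conv_map)
  qed
  have g_smult: "g (c \<cdot>\<^sub>m x) = map (\<lambda>y. c \<cdot>\<^sub>m y) (g x)" if "x \<in> S" for c x
    using that unfolding g_def by (auto simp: Sd Ud mat_smult_dim)
  have g_adj: "g (x\<^sup>\<dagger>) = map mat_adjoint (g x)" if "x \<in> S" for x
    using that unfolding g_def by (auto simp: Sd Ud mat_adjoint_mult mat_mult_assoc_dim)
  have g_car: "g x \<in> carrier (mat_direct_sum ds)" if "x \<in> S" for x
    using that Ud Sd unfolding g_def ds_def
    by (auto simp: list_all2_map1 list_all2_map2 list_all2_same intro!: carrier_matI)
  have inj: "x = y" if xy: "x \<in> S" "y \<in> S" "g x = g y" for x y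
  proof -
    have "U\<^sup>\<dagger> * (x - y) * U = 0\<^sub>m (dim_col U) (dim_col U)" if U: "U \<in> set Ws" for U
    proof -
      have "U\<^sup>\<dagger> * (x - y) * U = U\<^sup>\<dagger> * x * U - U\<^sup>\<dagger> * y * U"
        using xy Sd Ud[OF U] by (simp add: mat_distrib_dim)
      also have "U\<^sup>\<dagger> * x * U = U\<^sup>\<dagger> * y * U" using xy(3) U by (simp add: g_def)
      finally show ?thesis by (auto intro!: eq_matI)
    qed
    then have "x - y = 0\<^sub>m n n" using ker sub_minus[OF SS] xy by blast
    then show ?thesis by (rule mat_diff_zeroD) (use Sd xy in auto)
  qed
  have pS: "\<pi> a \<in> S" if "a \<in> carrier A" for a using that by (simp add: S_def)
  have "g \<circ> \<pi> \<in> star_hom A (mat_direct_sum ds)"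
    using \<pi>(1) g_car pS by (auto simp: star_hom_def g_add g_mult g_smult g_adj simp del: mat_direct_sum_sel(1))
  moreover have "bij_betw (g \<circ> \<pi>) (carrier A) (carrier (mat_direct_sum ds))"
    unfolding bij_betw_def
  proof
    show "inj_on (g \<circ> \<pi>) (carrier A)" using inj pS \<pi>(2) by (intro inj_onI) (auto dest: inj_onD)
    show "(g \<circ> \<pi>) ` carrier A = carrier (mat_direct_sum ds)"
    proof
      show "(g \<circ> \<pi>) ` carrier A \<subseteq> carrier (mat_direct_sum ds)" using g_car pS by force
      show "carrier (mat_direct_sum ds) \<subseteq> (g \<circ> \<pi>) ` carrier A"
      proof
        fix cs assume "cs \<in> carrier (mat_direct_sum ds)"
        then have "list_all2 (\<lambda>c U. c \<in> carrier_mat (dim_col U) (dim_col U)) cs Ws"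
          by (simp add: ds_def list_all2_map2)
        from surj[OF this] show "cs \<in> (g \<circ> \<pi>) ` carrier A" by (auto simp: S_def g_def)
      qed
    qed
  qed
  ultimately have "star_iso A (mat_direct_sum ds)" by (auto simp: star_iso_def)
  moreover have "\<forall>d\<in>set ds. 0 < d" using Ws by (auto simp: ds_def)
  ultimately show thesis by (intro that[of ds])
qed

section \<open>Channels and correctability\<close>

lemma sum_rotate: "(\<Sum>x\<in>A. \<Sum>y\<in>B. \<Sum>z\<in>C. f x y z) = (\<Sum>z\<in>C. \<Sum>x\<in>A. \<Sum>y\<in>B. f x y z)"
  for f :: "'x \<Rightarrow> 'y \<Rightarrow> 'z \<Rightarrow> 'v :: comm_monoid_add"
proof -
  have "(\<Sum>x\<in>A. \<Sum>y\<in>B. \<Sum>z\<in>C. f x y z) = (\<Sum>x\<in>A. \<Sum>z\<in>C. \<Sum>y\<in>B. f x y z)"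
    by (intro sum.cong refl sum.swap)
  also have "\<dots> = (\<Sum>z\<in>C. \<Sum>x\<in>A. \<Sum>y\<in>B. f x y z)" by (rule sum.swap)
  finally show ?thesis .
qed

lemma sum_lessThan_mult: "(\<Sum>i<k * n. f i) = (\<Sum>a<k. \<Sum>b<n. f (a * n + b))"
  for f :: "nat \<Rightarrow> 'v :: comm_monoid_add"
proof (induction k)
  case (Suc k)
  have "(\<Sum>i<Suc k * n. f i) = (\<Sum>i<k * n. f i) + (\<Sum>i = k * n..<k * n + n. f i)"
    by (subst sum.atLeastLessThan_concat[of 0, symmetric, unfolded lessThan_atLeast0[symmetric], of _ "k * n"])
      (auto simp: lessThan_atLeast0 sum.atLeastLessThan_concat add.commute)
  also have "(\<Sum>i = k * n..<k * n + n. f i) = (\<Sum>b<n. f (k * n + b))"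
    using sum.shift_bounds_nat_ivl[of f 0 "k * n" n] by (simp add: lessThan_atLeast0 add.commute)
  finally show ?case using Suc by simp
qed simp

lemma mult_add_less: "i < k \<Longrightarrow> a < n \<Longrightarrow> i * n + a < k * n" for i k a n :: nat
proof -
  assume "i < k" "a < n"
  then have "i * n + a < Suc i * n" by simp
  also have "\<dots> \<le> k * n" using \<open>i < k\<close> by (intro mult_right_mono) auto
  finally show ?thesis .
qed

lemma psd_iff:
  "psd N A \<longleftrightarrow> A \<in> carrier_mat N N \<and> (\<forall>w. 0 \<le> (\<Sum>i<N. \<Sum>j<N. cnj (w i) * A $$ (i, j) * w j))"
proof -
  have form: "(A *\<^sub>v v) \<bullet>c v = (\<Sum>i<N. \<Sum>j<N. cnj (v $ i) * A $$ (i, j) * v $ j)"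
    if "A \<in> carrier_mat N N" "v \<in> carrier_vec N" for v
    using that by (simp add: scalar_prod_def lessThan_atLeast0 sum_distrib_left sum_distrib_right algebra_simps)
  show ?thesis
  proof
    assume psd: "psd N A"
    then have A: "A \<in> carrier_mat N N" by (simp add: psd_def)
    have "0 \<le> (\<Sum>i<N. \<Sum>j<N. cnj (w i) * A $$ (i, j) * w j)" for w
    proof -
      have "0 \<le> (A *\<^sub>v vec N w) \<bullet>c vec N w" using psd by (auto simp: psd_def simp del: index_mult_mat_vec)
      then show ?thesis by (simp add: form[OF A])
    qed
    with A show "A \<in> carrier_mat N N \<and> (\<forall>w. 0 \<le> (\<Sum>i<N. \<Sum>j<N. cnj (w i) * A $$ (i, j) * w j))" by blast
  next
    assume "A \<in> carrier_mat N N \<and> (\<forall>w. 0 \<le> (\<Sum>i<N. \<Sum>j<N. cnj (w i) * A $$ (i, j) * w j))"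
    then show "psd N A" using form by (auto simp: psd_def)
  qed
qed

lemma completely_positive_kraus:
  fixes L :: nat
  assumes car: "\<And>Y. Y \<in> carrier_mat n n \<Longrightarrow> \<Phi> Y \<in> carrier_mat m m"
    and kraus: "\<And>Y \<alpha> \<beta>. Y \<in> carrier_mat n n \<Longrightarrow> \<alpha> < m \<Longrightarrow> \<beta> < m \<Longrightarrow>
      \<Phi> Y $$ (\<alpha>, \<beta>) = (\<Sum>l<L. \<Sum>a<n. \<Sum>b<n. K l \<alpha> a * Y $$ (a, b) * cnj (K l \<beta> b))"
  shows "completely_positive n m \<Phi>"
  unfolding completely_positive_def
proof (intro allI impI)
  fix k X assume X: "psd (k * n) X"
  define w' where "w' w l r = (\<Sum>\<alpha><m. cnj (K l \<alpha> (r mod n)) * w (r div n * m + \<alpha>))" for w l r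
  have eq: "(\<Sum>r<k * m. \<Sum>s<k * m. cnj (w r) * ampliation k n m \<Phi> X $$ (r, s) * w s)
      = (\<Sum>l<L. \<Sum>r<k * n. \<Sum>s<k * n. cnj (w' w l r) * X $$ (r, s) * w' w l s)" (is "?l = ?r") for w
  proof -
    have 1: "(\<Sum>\<alpha><m. \<Sum>\<beta><m. cnj (w (i * m + \<alpha>)) * ampliation k n m \<Phi> X $$ (i * m + \<alpha>, j * m + \<beta>) * w (j * m + \<beta>))
        = (\<Sum>l<L. \<Sum>a<n. \<Sum>b<n. cnj (w' w l (i * n + a)) * X $$ (i * n + a, j * n + b) * w' w l (j * n + b))"
      (is "?A = ?B") if ij: "i < k" "j < k" for i j
    proof -
      define T where "T \<alpha> \<beta> l a b = cnj (w (i * m + \<alpha>)) *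
        (K l \<alpha> a * X $$ (i * n + a, j * n + b) * cnj (K l \<beta> b)) * w (j * m + \<beta>)" for \<alpha> \<beta> l a b
      have blk: "mat_block n X i j \<in> carrier_mat n n" by (simp add: mat_block_def)
      have "?A = (\<Sum>\<alpha><m. \<Sum>\<beta><m. \<Sum>l<L. \<Sum>a<n. \<Sum>b<n. T \<alpha> \<beta> l a b)"
        using ij by (intro sum.cong refl)
          (simp add: ampliation_def mult_add_less kraus[OF blk] T_def sum_distrib_left sum_distrib_right, simp add: mat_block_def)
      also have "\<dots> = (\<Sum>l<L. \<Sum>\<alpha><m. \<Sum>\<beta><m. \<Sum>a<n. \<Sum>b<n. T \<alpha> \<beta> l a b)" by (rule sum_rotate)
      also have "\<dots> = (\<Sum>l<L. \<Sum>a<n. \<Sum>\<alpha><m. \<Sum>\<beta><m. \<Sum>b<n. T \<alpha> \<beta> l a b)" by (intro sum.cong refl sum_rotate)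
      also have "\<dots> = (\<Sum>l<L. \<Sum>a<n. \<Sum>b<n. \<Sum>\<alpha><m. \<Sum>\<beta><m. T \<alpha> \<beta> l a b)" by (intro sum.cong refl sum_rotate)
      also have "\<dots> = ?B"
      proof (intro sum.cong refl)
        fix l a b assume "a \<in> {..<n}" "b \<in> {..<n}"
        then have "cnj (w' w l (i * n + a)) = (\<Sum>\<alpha><m. K l \<alpha> a * cnj (w (i * m + \<alpha>)))"
          "w' w l (j * n + b) = (\<Sum>\<beta><m. cnj (K l \<beta> b) * w (j * m + \<beta>))"
          by (auto simp: w'_def)
        then have "cnj (w' w l (i * n + a)) * X $$ (i * n + a, j * n + b) * w' w l (j * n + b) =
          (\<Sum>\<alpha><m. \<Sum>\<beta><m. K l \<alpha> a * cnj (w (i * m + \<alpha>)) * X $$ (i * n + a, j * n + b) * (cnj (K l \<beta> b) * w (j * m + \<beta>)))"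
          by (simp only: sum_distrib_right sum_distrib_left) (rule sum.swap)
        also have "\<dots> = (\<Sum>\<alpha><m. \<Sum>\<beta><m. T \<alpha> \<beta> l a b)"
          by (intro sum.cong refl) (simp add: T_def algebra_simps)
        finally show "(\<Sum>\<alpha><m. \<Sum>\<beta><m. T \<alpha> \<beta> l a b) =
          cnj (w' w l (i * n + a)) * X $$ (i * n + a, j * n + b) * w' w l (j * n + b)" ..
      qed
      finally show ?thesis .
    qed
    have "?l = (\<Sum>i<k. \<Sum>\<alpha><m. \<Sum>j<k. \<Sum>\<beta><m.
        cnj (w (i * m + \<alpha>)) * ampliation k n m \<Phi> X $$ (i * m + \<alpha>, j * m + \<beta>) * w (j * m + \<beta>))"
      by (simp add: sum_lessThan_mult)
    also have "\<dots> = (\<Sum>i<k. \<Sum>j<k. \<Sum>\<alpha><m. \<Sum>\<beta><m.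
        cnj (w (i * m + \<alpha>)) * ampliation k n m \<Phi> X $$ (i * m + \<alpha>, j * m + \<beta>) * w (j * m + \<beta>))"
      by (intro sum.cong refl sum.swap)
    also have "\<dots> = (\<Sum>i<k. \<Sum>j<k. \<Sum>l<L. \<Sum>a<n. \<Sum>b<n.
        cnj (w' w l (i * n + a)) * X $$ (i * n + a, j * n + b) * w' w l (j * n + b))"
      by (intro sum.cong refl 1) auto
    also have "\<dots> = (\<Sum>l<L. \<Sum>i<k. \<Sum>j<k. \<Sum>a<n. \<Sum>b<n.
        cnj (w' w l (i * n + a)) * X $$ (i * n + a, j * n + b) * w' w l (j * n + b))"
      by (rule sum_rotate)
    also have "\<dots> = (\<Sum>l<L. \<Sum>i<k. \<Sum>a<n. \<Sum>j<k. \<Sum>b<n.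
        cnj (w' w l (i * n + a)) * X $$ (i * n + a, j * n + b) * w' w l (j * n + b))"
      by (intro sum.cong refl sum.swap)
    also have "\<dots> = ?r" by (simp add: sum_lessThan_mult)
    finally show ?thesis .
  qed
  have "0 \<le> (\<Sum>l<L. \<Sum>r<k * n. \<Sum>s<k * n. cnj (w' w l r) * X $$ (r, s) * w' w l s)" for w
    using X by (intro sum_nonneg[of "{..<L}"]) (auto simp: psd_iff)
  then have "0 \<le> (\<Sum>r<k * m. \<Sum>s<k * m. cnj (w r) * ampliation k n m \<Phi> X $$ (r, s) * w s)" for w
    unfolding eq .
  moreover have "ampliation k n m \<Phi> X \<in> carrier_mat (k * m) (k * m)" by (simp add: ampliation_def)
  ultimately show "psd (k * m) (ampliation k n m \<Phi> X)" by (simp add: psd_iff)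
qed

lemma completely_positive_comp:
  assumes \<Phi>: "completely_positive n m \<Phi>" "\<And>Y. Y \<in> carrier_mat n n \<Longrightarrow> \<Phi> Y \<in> carrier_mat m m"
    and \<Psi>: "completely_positive m r \<Psi>"
  shows "completely_positive n r (\<Psi> \<circ> \<Phi>)"
  unfolding completely_positive_def
proof (intro allI impI)
  fix k X assume X: "psd (k * n) X"
  have "ampliation k n r (\<Psi> \<circ> \<Phi>) X = ampliation k m r \<Psi> (ampliation k n m \<Phi> X)"
  proof -
    have "mat_block m (ampliation k n m \<Phi> X) i j = \<Phi> (mat_block n X i j)" if "i < k" "j < k" for i j
    proof -
      have "\<Phi> (mat_block n X i j) \<in> carrier_mat m m" by (intro \<Phi>(2)) (simp add: mat_block_def)
      then show ?thesis using that by (intro eq_matI) (auto simp: mat_block_def ampliation_def mult_add_less)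
    qed
    then show ?thesis by (intro eq_matI) (auto simp: ampliation_def less_mult_imp_div_less)
  qed
  then show "psd (k * r) (ampliation k n r (\<Psi> \<circ> \<Phi>) X)"
    using X \<Phi>(1) \<Psi> by (simp add: completely_positive_def)
qed

definition unit_mat :: "nat \<Rightarrow> nat \<Rightarrow> nat \<Rightarrow> complex mat" where
  "unit_mat n i j = mat n n (\<lambda>(a, b). if a = i \<and> b = j then 1 else 0)"

lemma unit_mat_carrier [simp]: "unit_mat n i j \<in> carrier_mat n n"
  by (simp add: unit_mat_def)

lemma unit_mat_dim [simp]: "dim_row (unit_mat n i j) = n" "dim_col (unit_mat n i j) = n"
  by (simp_all add: unit_mat_def)

lemma unit_mat_mult:
  assumes "j < n"
  shows "unit_mat n i j * unit_mat n k l = (if j = k then unit_mat n i l else 0\<^sub>m n n)"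
proof (rule eq_matI)
  fix a b assume ab: "a < dim_row (if j = k then unit_mat n i l else 0\<^sub>m n n)" "b < dim_col (if j = k then unit_mat n i l else 0\<^sub>m n n)"
  then have "a < n" "b < n" by (auto split: if_splits)
  then have "(unit_mat n i j * unit_mat n k l) $$ (a, b)
      = (\<Sum>c<n. unit_mat n i j $$ (a, c) * unit_mat n k l $$ (c, b))"
    by (simp add: scalar_prod_def lessThan_atLeast0)
  also have "\<dots> = (\<Sum>c<n. if c = j then (if a = i \<and> c = k \<and> b = l then 1 else 0) else 0)"
    using \<open>a < n\<close> \<open>b < n\<close> by (intro sum.cong refl) (auto simp: unit_mat_def)
  also have "\<dots> = (if a = i \<and> j = k \<and> b = l then 1 else 0)" using assms by simp
  finally show "(unit_mat n i j * unit_mat n k l) $$ (a, b) = (if j = k then unit_mat n i l else 0\<^sub>m n n) $$ (a, b)"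
    using \<open>a < n\<close> \<open>b < n\<close> by (simp add: unit_mat_def)
qed (auto simp: unit_mat_def)

lemma unit_mat_adjoint: "(unit_mat n i j)\<^sup>\<dagger> = unit_mat n j i"
  by (rule eq_matI) (auto simp: unit_mat_def)

lemma mtrace_mult_unit_mat:
  assumes "Z \<in> carrier_mat n n" "i < n" "j < n"
  shows "mtrace (Z * unit_mat n i j) = Z $$ (j, i)"
proof -
  have "mtrace (Z * unit_mat n i j) = (\<Sum>a<n. \<Sum>b<n. Z $$ (a, b) * unit_mat n i j $$ (b, a))"
    using assms by (simp add: mtrace_def scalar_prod_def lessThan_atLeast0)
  also have "\<dots> = (\<Sum>a<n. \<Sum>b<n. if b = i then (if a = j then Z $$ (a, b) else 0) else 0)"
    by (intro sum.cong refl) (auto simp: unit_mat_def)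
  also have "\<dots> = Z $$ (j, i)" using assms by simp
  finally show ?thesis .
qed

lemma msum_index:
  assumes "\<And>i. i < k \<Longrightarrow> f i \<in> carrier_mat n n" "a < n" "b < n"
  shows "msum n f k $$ (a, b) = (\<Sum>i<k. f i $$ (a, b))"
  using assms
proof (induction k)
  case (Suc k)
  then have "msum n f k \<in> carrier_mat n n" "f k \<in> carrier_mat n n" by auto
  then have "msum n f (Suc k) $$ (a, b) = msum n f k $$ (a, b) + f k $$ (a, b)"
    using Suc.prems(2,3) by (auto simp del: msum_carrier)
  with Suc show ?case by simp
qed simp

lemma mat_unit_expansion:
  assumes X: "X \<in> carrier_mat n n"
  shows "X = msum n (\<lambda>l. X $$ (l div n, l mod n) \<cdot>\<^sub>m unit_mat n (l div n) (l mod n)) (n * n)"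
proof (rule eq_matI)
  let ?M = "msum n (\<lambda>l. X $$ (l div n, l mod n) \<cdot>\<^sub>m unit_mat n (l div n) (l mod n)) (n * n)"
  have M: "?M \<in> carrier_mat n n" by simp
  fix a b assume "a < dim_row ?M" "b < dim_col ?M"
  then have ab: "a < n" "b < n" using M by auto
  have "?M $$ (a, b) = (\<Sum>l<n * n. (X $$ (l div n, l mod n) \<cdot>\<^sub>m unit_mat n (l div n) (l mod n)) $$ (a, b))"
    using ab by (intro msum_index) auto
  also have "\<dots> = (\<Sum>i<n. \<Sum>j<n. if j = b then (if i = a then X $$ (i, j) else 0) else 0)"
    unfolding sum_lessThan_mult using ab by (intro sum.cong refl) (auto simp: unit_mat_def)
  also have "\<dots> = X $$ (a, b)" using ab by simp
  finally show "X $$ (a, b) = ?M $$ (a, b)" ..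
qed (use X in \<open>auto simp: carrier_matD[OF msum_carrier]\<close>)

lemma map_adjoint_fixed_iff:
  assumes X: "X \<in> carrier_mat r r"
    and car: "\<And>\<rho>. \<rho> \<in> carrier_mat r r \<Longrightarrow> \<Psi> \<rho> \<in> carrier_mat r r"
    and add: "\<And>\<rho> \<sigma>. \<rho> \<in> carrier_mat r r \<Longrightarrow> \<sigma> \<in> carrier_mat r r \<Longrightarrow> \<Psi> (\<rho> + \<sigma>) = \<Psi> \<rho> + \<Psi> \<sigma>"
    and smult: "\<And>c \<rho>. \<rho> \<in> carrier_mat r r \<Longrightarrow> \<Psi> (c \<cdot>\<^sub>m \<rho>) = c \<cdot>\<^sub>m \<Psi> \<rho>"
  shows "map_adjoint r \<Psi> X = X \<longleftrightarrow> (\<forall>\<rho>\<in>carrier_mat r r. mtrace (X * \<Psi> \<rho>) = mtrace (X * \<rho>))"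
proof -
  let ?P = "\<lambda>Z. Z \<in> carrier_mat r r \<and> (\<forall>\<rho>\<in>carrier_mat r r. mtrace (X * \<Psi> \<rho>) = mtrace (Z * \<rho>))"
  have unique: "Z = Z'" if "?P Z" "?P Z'" for Z Z'
  proof (rule eq_matI)
    fix i j assume "i < dim_row Z'" "j < dim_col Z'"
    then have ij: "i < r" "j < r" using that(2) by auto
    have "mtrace (Z * unit_mat r j i) = mtrace (Z' * unit_mat r j i)"
      using that by (metis unit_mat_carrier)
    then show "Z $$ (i, j) = Z' $$ (i, j)" using that ij by (simp add: mtrace_mult_unit_mat)
  qed (use that in auto)
  define Z where "Z = mat r r (\<lambda>(i, j). mtrace (X * \<Psi> (unit_mat r j i)))"
  have Zc: "Z \<in> carrier_mat r r" by (simp add: Z_def)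
  have lin: "mtrace (X * \<Psi> (msum r f k)) - mtrace (Z * msum r f k) = (\<Sum>l<k. mtrace (X * \<Psi> (f l)) - mtrace (Z * f l))"
    if f: "\<And>l. f l \<in> carrier_mat r r" for f k
  proof (induction k)
    case 0
    have "\<Psi> (0\<^sub>m r r) = 0 \<cdot>\<^sub>m \<Psi> (0\<^sub>m r r)" using smult[of "0\<^sub>m r r" 0] by (simp add: smult_zero_mat)
    also have "\<dots> = 0\<^sub>m r r" using car[of "0\<^sub>m r r"] by (intro eq_matI) auto
    finally show ?case using X Zc by simp
  next
    case (Suc k)
    have m: "msum r f k \<in> carrier_mat r r" using f by simp
    have "X * (\<Psi> (msum r f k) + \<Psi> (f k)) = X * \<Psi> (msum r f k) + X * \<Psi> (f k)"
      "Z * (msum r f k + f k) = Z * msum r f k + Z * f k"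
      using mult_add_distrib_mat[OF X car[OF m] car[OF f]] mult_add_distrib_mat[OF Zc m f] .
    then show ?case using Suc m f X Zc car[OF m] car[OF f] by (simp add: add mtrace_add[of _ r])
  qed
  have PZ: "?P Z"
  proof (intro conjI ballI Zc)
    fix \<rho> :: "complex mat" assume \<rho>: "\<rho> \<in> carrier_mat r r"
    let ?f = "\<lambda>l. \<rho> $$ (l div r, l mod r) \<cdot>\<^sub>m unit_mat r (l div r) (l mod r)"
    have "mtrace (X * \<Psi> (?f l)) - mtrace (Z * ?f l) = 0" if l: "l < r * r" for l
    proof -
      have lr: "l div r < r" "l mod r < r"
        using l by (auto simp: less_mult_imp_div_less) (metis less_nat_zero_code mod_less_divisor mult_0 neq0_conv)
      define c where "c = \<rho> $$ (l div r, l mod r)"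
      define u where "u = unit_mat r (l div r) (l mod r)"
      have u: "u \<in> carrier_mat r r" by (simp add: u_def)
      have "mtrace (X * \<Psi> (c \<cdot>\<^sub>m u)) = c * mtrace (X * \<Psi> u)"
        using X car[OF u] by (simp add: smult[OF u] mult_smult_distrib[of _ r r _ r] mtrace_smult[of _ r])
      moreover have "mtrace (Z * (c \<cdot>\<^sub>m u)) = c * mtrace (Z * u)"
        using Zc u by (simp add: mult_smult_distrib[of _ r r _ r] mtrace_smult[of _ r])
      moreover have "mtrace (Z * u) = mtrace (X * \<Psi> u)"
        unfolding u_def mtrace_mult_unit_mat[OF Zc lr] using lr by (simp add: Z_def)
      ultimately show ?thesis by (simp add: c_def u_def)
    qed
    then have "mtrace (X * \<Psi> (msum r ?f (r * r))) - mtrace (Z * msum r ?f (r * r)) = 0"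
      by (subst lin) auto
    then show "mtrace (X * \<Psi> \<rho>) = mtrace (Z * \<rho>)"
      unfolding mat_unit_expansion[OF \<rho>, symmetric] by simp
  qed
  have "map_adjoint r \<Psi> X = Z"
    unfolding map_adjoint_def using PZ unique by (intro the_equality) blast+
  with PZ unique X show ?thesis by metis
qed

lemma map_adjoint_recovery_iff:
  assumes \<Phi>: "quantum_channel n m \<Phi>" and D: "quantum_channel m r D"
    and V: "V \<in> carrier_mat n r" and X: "X \<in> carrier_mat r r"
  shows "map_adjoint r (D \<circ> (\<lambda>Y. \<Phi> (V * Y * V\<^sup>\<dagger>))) X = X \<longleftrightarrow>
    (\<forall>\<rho>\<in>carrier_mat r r. mtrace (X * D (\<Phi> (V * \<rho> * V\<^sup>\<dagger>))) = mtrace (X * \<rho>))"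
proof -
  have Vd: "dim_row V = n" "dim_col V = r" using V by auto
  have Vc: "V * Y * V\<^sup>\<dagger> \<in> carrier_mat n n" for Y :: "complex mat" using Vd by (intro carrier_matI) auto
  have \<Phi>c: "\<Phi> Y \<in> carrier_mat m m" if "Y \<in> carrier_mat n n" for Y using \<Phi> that by (auto simp: quantum_channel_def)
  have Dc: "D Y \<in> carrier_mat r r" if "Y \<in> carrier_mat m m" for Y using D that by (auto simp: quantum_channel_def)
  have "map_adjoint r (D \<circ> (\<lambda>Y. \<Phi> (V * Y * V\<^sup>\<dagger>))) X = X \<longleftrightarrow>
    (\<forall>\<rho>\<in>carrier_mat r r. mtrace (X * (D \<circ> (\<lambda>Y. \<Phi> (V * Y * V\<^sup>\<dagger>))) \<rho>) = mtrace (X * \<rho>))"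
  proof (rule map_adjoint_fixed_iff[OF X])
    fix \<rho> :: "complex mat" assume \<rho>: "\<rho> \<in> carrier_mat r r"
    show "(D \<circ> (\<lambda>Y. \<Phi> (V * Y * V\<^sup>\<dagger>))) \<rho> \<in> carrier_mat r r" using Dc \<Phi>c Vc by simp
    have "V * (c \<cdot>\<^sub>m \<rho>) * V\<^sup>\<dagger> = c \<cdot>\<^sub>m (V * \<rho> * V\<^sup>\<dagger>)" for c using Vd \<rho> by (simp add: mat_smult_dim)
    then show "(D \<circ> (\<lambda>Y. \<Phi> (V * Y * V\<^sup>\<dagger>))) (c \<cdot>\<^sub>m \<rho>) = c \<cdot>\<^sub>m (D \<circ> (\<lambda>Y. \<Phi> (V * Y * V\<^sup>\<dagger>))) \<rho>" for c
      using \<Phi> D Vc \<Phi>c by (simp add: quantum_channel_def)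
    fix \<sigma> :: "complex mat" assume \<sigma>: "\<sigma> \<in> carrier_mat r r"
    have "V * (\<rho> + \<sigma>) * V\<^sup>\<dagger> = V * \<rho> * V\<^sup>\<dagger> + V * \<sigma> * V\<^sup>\<dagger>" using Vd \<rho> \<sigma> by (simp add: mat_distrib_dim)
    then show "(D \<circ> (\<lambda>Y. \<Phi> (V * Y * V\<^sup>\<dagger>))) (\<rho> + \<sigma>) =
        (D \<circ> (\<lambda>Y. \<Phi> (V * Y * V\<^sup>\<dagger>))) \<rho> + (D \<circ> (\<lambda>Y. \<Phi> (V * Y * V\<^sup>\<dagger>))) \<sigma>"
      using \<Phi> D Vc \<Phi>c by (simp add: quantum_channel_def)
  qed
  then show ?thesis by simp
qed

text \<open>The second summand makes the compression trace preserving: whatever lies outside the range of the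
  isometry \<open>T\<close> is replaced by a fixed pure state.\<close>

definition compress :: "nat \<Rightarrow> nat \<Rightarrow> complex mat \<Rightarrow> complex mat \<Rightarrow> complex mat" where
  "compress r s T Y = T\<^sup>\<dagger> * Y * T + mtrace ((1\<^sub>m r - T * T\<^sup>\<dagger>) * Y) \<cdot>\<^sub>m unit_mat s 0 0"

lemma quantum_channel_compress:
  assumes T: "T \<in> carrier_mat r s" "T\<^sup>\<dagger> * T = 1\<^sub>m s" and s: "s > 0"
  shows "quantum_channel r s (compress r s T)"
proof -
  have Td: "dim_row T = r" "dim_col T = s" using T by auto
  define E where "E = 1\<^sub>m r - T * T\<^sup>\<dagger>"
  have E: "is_proj r E" unfolding E_def
    using isometry_range_proj(1)[OF T] by (intro is_proj_diff is_proj_one) (auto simp: is_proj_def)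
  have Ec: "E \<in> carrier_mat r r" and Ed: "dim_row E = r" "dim_col E = r" "E * E = E" "E\<^sup>\<dagger> = E"
    using E by (auto simp: is_proj_def)
  have compress: "compress r s T Y = T\<^sup>\<dagger> * Y * T + mtrace (E * Y) \<cdot>\<^sub>m unit_mat s 0 0" for Y
    by (simp add: compress_def E_def)
  have car: "compress r s T Y \<in> carrier_mat s s" if "Y \<in> carrier_mat r r" for Y
    using that Td by (intro carrier_matI) (simp_all add: compress)
  have tr_unit: "mtrace (unit_mat s 0 0) = 1"
  proof -
    have "mtrace (1\<^sub>m s * unit_mat s 0 0) = 1" using s by (subst mtrace_mult_unit_mat) auto
    then show ?thesis by (simp add: mat_one_zero_dim)
  qed
  have cp: "completely_positive r s (compress r s T)"
  proof (rule completely_positive_kraus[where L = "Suc r" and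
        K = "\<lambda>l \<alpha> a. case l of 0 \<Rightarrow> cnj (T $$ (a, \<alpha>)) | Suc l \<Rightarrow> (if \<alpha> = 0 then E $$ (l, a) else 0)"])
    fix Y :: "complex mat" and \<alpha> \<beta> assume Y: "Y \<in> carrier_mat r r" and \<alpha>\<beta>: "\<alpha> < s" "\<beta> < s"
    have Yd: "dim_row Y = r" "dim_col Y = r" using Y by auto
    have 1: "(T\<^sup>\<dagger> * Y * T) $$ (\<alpha>, \<beta>) = (\<Sum>a<r. \<Sum>b<r. cnj (T $$ (a, \<alpha>)) * Y $$ (a, b) * T $$ (b, \<beta>))"
    proof -
      have "(T\<^sup>\<dagger> * Y * T) $$ (\<alpha>, \<beta>) = (\<Sum>b<r. \<Sum>a<r. cnj (T $$ (a, \<alpha>)) * Y $$ (a, b) * T $$ (b, \<beta>))"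
        using Td Yd \<alpha>\<beta> by (simp add: scalar_prod_def lessThan_atLeast0 sum_distrib_right)
      also have "\<dots> = (\<Sum>a<r. \<Sum>b<r. cnj (T $$ (a, \<alpha>)) * Y $$ (a, b) * T $$ (b, \<beta>))" by (rule sum.swap)
      finally show ?thesis .
    qed
    have "mtrace (E * Y) = mtrace (E * (E * Y))" using Ed Yd by (simp flip: mat_mult_assoc_dim)
    also have "\<dots> = mtrace (E * Y * E\<^sup>\<dagger>)"
      using mtrace_comm[OF Ec mult_carrier_mat[OF Ec Y]] Ed(4) by simp
    also have "\<dots> = (\<Sum>l<r. \<Sum>b<r. \<Sum>a<r. E $$ (l, a) * Y $$ (a, b) * cnj (E $$ (l, b)))"
      using Ed(1,2) Yd by (simp add: mtrace_def scalar_prod_def lessThan_atLeast0 sum_distrib_right)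
    also have "\<dots> = (\<Sum>l<r. \<Sum>a<r. \<Sum>b<r. E $$ (l, a) * Y $$ (a, b) * cnj (E $$ (l, b)))"
      by (intro sum.cong refl sum.swap)
    finally have 2: "mtrace (E * Y) = (\<Sum>l<r. \<Sum>a<r. \<Sum>b<r. E $$ (l, a) * Y $$ (a, b) * cnj (E $$ (l, b)))" .
    have "compress r s T Y $$ (\<alpha>, \<beta>) = (T\<^sup>\<dagger> * Y * T) $$ (\<alpha>, \<beta>) + mtrace (E * Y) * unit_mat s 0 0 $$ (\<alpha>, \<beta>)"
      unfolding compress using \<alpha>\<beta> Td by (simp del: index_mult_mat(1))
    also have "mtrace (E * Y) * unit_mat s 0 0 $$ (\<alpha>, \<beta>) = (\<Sum>l<r. \<Sum>a<r. \<Sum>b<r.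
      (if \<alpha> = 0 then E $$ (l, a) else 0) * Y $$ (a, b) * cnj (if \<beta> = 0 then E $$ (l, b) else 0))"
      unfolding 2 using \<alpha>\<beta> by (auto simp: unit_mat_def)
    finally show "compress r s T Y $$ (\<alpha>, \<beta>) = (\<Sum>l<Suc r. \<Sum>a<r. \<Sum>b<r.
        (case l of 0 \<Rightarrow> cnj (T $$ (a, \<alpha>)) | Suc l \<Rightarrow> (if \<alpha> = 0 then E $$ (l, a) else 0)) * Y $$ (a, b) *
        cnj (case l of 0 \<Rightarrow> cnj (T $$ (b, \<beta>)) | Suc l \<Rightarrow> (if \<beta> = 0 then E $$ (l, b) else 0)))"
      unfolding 1 by (simp add: sum.lessThan_Suc_shift del: sum.lessThan_Suc)
  qed (rule car)
  have add: "compress r s T (X + Y) = compress r s T X + compress r s T Y"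
    if XY: "X \<in> carrier_mat r r" "Y \<in> carrier_mat r r" for X Y
  proof -
    have d: "dim_row X = r" "dim_col X = r" "dim_row Y = r" "dim_col Y = r" using XY by auto
    have "T\<^sup>\<dagger> * (X + Y) * T = T\<^sup>\<dagger> * X * T + T\<^sup>\<dagger> * Y * T" using d Td by (simp add: mat_distrib_dim)
    moreover have "mtrace (E * (X + Y)) = mtrace (E * X) + mtrace (E * Y)"
      using d Ed mtrace_add[OF mult_carrier_mat[OF Ec XY(1)] mult_carrier_mat[OF Ec XY(2)]] by (simp add: mat_distrib_dim)
    ultimately show ?thesis unfolding compress using d Td
      by (intro eq_matI) (auto simp: algebra_simps simp del: index_mult_mat(1))
  qed
  have smult: "compress r s T (c \<cdot>\<^sub>m X) = c \<cdot>\<^sub>m compress r s T X" if X: "X \<in> carrier_mat r r" for c X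
  proof -
    have d: "dim_row X = r" "dim_col X = r" using X by auto
    have "T\<^sup>\<dagger> * (c \<cdot>\<^sub>m X) * T = c \<cdot>\<^sub>m (T\<^sup>\<dagger> * X * T)" using d Td by (simp add: mat_smult_dim)
    moreover have "mtrace (E * (c \<cdot>\<^sub>m X)) = c * mtrace (E * X)"
      using d Ed mtrace_smult[OF mult_carrier_mat[OF Ec X], of c] by (simp add: mat_smult_dim)
    ultimately show ?thesis unfolding compress using d Td
      by (intro eq_matI) (auto simp: algebra_simps simp del: index_mult_mat(1))
  qed
  have tr: "mtrace (compress r s T X) = mtrace X" if X: "X \<in> carrier_mat r r" for X
  proof -
    have d: "dim_row X = r" "dim_col X = r" using X by auto
    have c1: "T\<^sup>\<dagger> * X * T \<in> carrier_mat s s" "T * T\<^sup>\<dagger> * X \<in> carrier_mat r r" using Td d by (auto intro!: carrier_matI)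
    have "mtrace (compress r s T X) = mtrace (T\<^sup>\<dagger> * (X * T)) + mtrace (E * X)"
      unfolding compress using c1 d Td tr_unit
      by (subst mtrace_add[of _ s]) (simp_all add: mtrace_smult[of _ s] mat_mult_assoc_dim)
    also have "mtrace (T\<^sup>\<dagger> * (X * T)) = mtrace (X * T * T\<^sup>\<dagger>)"
      using mtrace_comm[of "T\<^sup>\<dagger>" s r "X * T"] T X by simp
    also have "\<dots> = mtrace (X * (T * T\<^sup>\<dagger>))" using d Td by (simp add: mat_mult_assoc_dim)
    also have "\<dots> = mtrace (T * T\<^sup>\<dagger> * X)" using mtrace_comm[of X r r "T * T\<^sup>\<dagger>"] T X by simp
    also have "mtrace (E * X) = mtrace X - mtrace (T * T\<^sup>\<dagger> * X)"
      using mtrace_minus[OF X c1(2)] d Td by (simp add: E_def mat_distrib_dim mat_one_zero_dim)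
    finally show ?thesis by simp
  qed
  show ?thesis unfolding quantum_channel_def using car add smult cp tr by blast
qed

lemma quantum_channel_comp:
  assumes "quantum_channel n m \<Phi>" "quantum_channel m r \<Psi>"
  shows "quantum_channel n r (\<Psi> \<circ> \<Phi>)"
proof -
  have c: "\<Phi> Y \<in> carrier_mat m m" if "Y \<in> carrier_mat n n" for Y
    using assms(1) that by (auto simp: quantum_channel_def)
  have "completely_positive n r (\<Psi> \<circ> \<Phi>)"
    using assms c by (intro completely_positive_comp[of n m]) (auto simp: quantum_channel_def)
  with assms c show ?thesis by (auto simp: quantum_channel_def)
qed

lemma correctable_subalgebra:
  assumes \<Phi>: "quantum_channel n m \<Phi>" and cor: "correctable n m \<Phi> S"
    and S': "star_subalgebra n S'" "S' \<subseteq> S"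
    and Q: "Q \<in> S'" "\<And>X. X \<in> S' \<Longrightarrow> Q * X = X" "\<And>X. X \<in> S' \<Longrightarrow> X * Q = X" "Q \<noteq> 0\<^sub>m n n"
  shows "correctable n m \<Phi> S'"
proof -
  obtain P r V D where S: "star_subalgebra n S" and P: "P \<in> S" "\<forall>X\<in>S. P * X = X \<and> X * P = X"
    and V: "V \<in> carrier_mat n r" "V\<^sup>\<dagger> * V = 1\<^sub>m r" "V * V\<^sup>\<dagger> = P" and D: "quantum_channel m r D"
    and rec: "\<forall>X \<in> (\<lambda>Y. V\<^sup>\<dagger> * Y * V) ` S. map_adjoint r (D \<circ> (\<lambda>Y. \<Phi> (V * Y * V\<^sup>\<dagger>))) X = X"
    using cor unfolding correctable_def by blast
  have Vd: "dim_row V = n" "dim_col V = r" using V by auto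
  have Pd: "dim_row P = n" "dim_col P = n" using sub_dim[OF S P(1)] by auto
  have recover: "mtrace (V\<^sup>\<dagger> * Y * V * D (\<Phi> (V * \<rho> * V\<^sup>\<dagger>))) = mtrace (V\<^sup>\<dagger> * Y * V * \<rho>)"
    if "Y \<in> S" "\<rho> \<in> carrier_mat r r" for Y \<rho>
  proof -
    have "V\<^sup>\<dagger> * Y * V \<in> carrier_mat r r" using Vd by (intro carrier_matI) auto
    from map_adjoint_recovery_iff[OF \<Phi> D V(1) this] show ?thesis using rec that by blast
  qed
  have Qd: "dim_row Q = n" "dim_col Q = n" using sub_dim[OF S'(1) Q(1)] by auto
  have "Q\<^sup>\<dagger> \<in> S'" using sub_closed[OF S'(1)] Q(1) by blast
  from Q(2)[OF this] have QQ: "Q * Q\<^sup>\<dagger> = Q\<^sup>\<dagger>" .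
  from arg_cong[OF this, of mat_adjoint] have "Q * Q\<^sup>\<dagger> = Q" using Qd by (simp add: mat_adjoint_mult)
  with QQ Q(2)[OF Q(1)] have Qp: "is_proj n Q" "Q\<^sup>\<dagger> = Q" "Q * Q = Q"
    using sub_carrier[OF S'(1) Q(1)] by (auto simp: is_proj_def)
  have QS: "Q \<in> S" using Q(1) S'(2) by blast
  obtain s W where W: "W \<in> carrier_mat n s" "W\<^sup>\<dagger> * W = 1\<^sub>m s" "W * W\<^sup>\<dagger> = Q" by (rule is_proj_isometry[OF Qp(1)])
  have Wd: "dim_row W = n" "dim_col W = s" using W by auto
  have s: "s > 0" using isometry_dim_pos[OF W(1)] W(3) Q(4) by simp
  have QW: "Q * W = W"
  proof -
    have "W * (W\<^sup>\<dagger> * W) = W" using Wd W(2) by (simp add: mat_one_zero_dim)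
    then show ?thesis using Wd by (simp add: mat_mult_assoc_dim flip: W(3))
  qed
  have PW: "P * W = W"
  proof -
    have "P * (Q * W) = Q * W" using P(2) QS Pd Qd Wd by (simp flip: mat_mult_assoc_dim)
    then show ?thesis by (simp add: QW)
  qed
  define T where "T = V\<^sup>\<dagger> * W"
  have Td: "dim_row T = r" "dim_col T = s" using Vd Wd by (auto simp: T_def)
  have Tc: "T \<in> carrier_mat r s" using Td by auto
  have VT: "V * T = W" using Vd Wd PW by (simp add: T_def V(3) flip: mat_mult_assoc_dim)
  have Tad: "T\<^sup>\<dagger> = W\<^sup>\<dagger> * V" using Vd Wd by (simp add: T_def mat_adjoint_mult)
  have TV: "T\<^sup>\<dagger> * V\<^sup>\<dagger> = W\<^sup>\<dagger>" using arg_cong[OF VT, of mat_adjoint] Vd Td by (simp add: mat_adjoint_mult)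
  have TT: "T\<^sup>\<dagger> * T = 1\<^sub>m s" using Vd Wd Td by (simp add: Tad mat_mult_assoc_dim VT W(2))
  define E where "E = 1\<^sub>m r - T * T\<^sup>\<dagger>"
  have E_eq: "E = V\<^sup>\<dagger> * (P - Q) * V"
  proof -
    have "T * T\<^sup>\<dagger> = V\<^sup>\<dagger> * Q * V" using Vd Wd by (simp add: T_def Tad mat_mult_assoc_dim mat_adjoint_mult flip: W(3))
    moreover have "V\<^sup>\<dagger> * P * V = V\<^sup>\<dagger> * V * (V\<^sup>\<dagger> * V)" using Vd by (simp add: mat_mult_assoc_dim flip: V(3))
    then have "V\<^sup>\<dagger> * P * V = 1\<^sub>m r" by (simp add: V(2))
    ultimately show ?thesis using Vd Pd Qd by (simp add: E_def mat_distrib_dim)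
  qed
  have Ed: "dim_row E = r" "dim_col E = r" using Td by (auto simp: E_def)
  have ET: "E * T = 0\<^sub>m r s"
  proof -
    have "E * T = T - T" using Td TT by (simp add: E_def mat_distrib_dim mat_one_zero_dim mat_mult_assoc_dim)
    also have "\<dots> = 0\<^sub>m r s" using Td by (intro eq_matI) auto
    finally show ?thesis .
  qed
  have PQ: "P - Q \<in> S" using sub_minus[OF S P(1) QS] .
  define D' where "D' = compress r s T \<circ> D"
  have D': "quantum_channel m s D'"
    unfolding D'_def by (rule quantum_channel_comp[OF D quantum_channel_compress[OF Tc TT s]])
  have "map_adjoint s (D' \<circ> (\<lambda>Y. \<Phi> (W * Y * W\<^sup>\<dagger>))) (W\<^sup>\<dagger> * Y * W) = W\<^sup>\<dagger> * Y * W" if Y: "Y \<in> S'" for Y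
  proof -
    have Yd: "dim_row Y = n" "dim_col Y = n" using sub_dim[OF S'(1) Y] by auto
    have Xc: "W\<^sup>\<dagger> * Y * W \<in> carrier_mat s s" using Wd by (intro carrier_matI) auto
    have lift: "T * (W\<^sup>\<dagger> * Y * W) * T\<^sup>\<dagger> = V\<^sup>\<dagger> * Y * V"
    proof -
      have "T * (W\<^sup>\<dagger> * Y * W) * T\<^sup>\<dagger> = V\<^sup>\<dagger> * (W * W\<^sup>\<dagger>) * Y * (W * W\<^sup>\<dagger>) * V"
        using Vd Wd Yd by (simp add: T_def Tad mat_mult_assoc_dim mat_adjoint_mult)
      also have "\<dots> = V\<^sup>\<dagger> * (Q * Y * Q) * V" using Vd Yd Qd by (simp add: W(3) mat_mult_assoc_dim)
      finally show ?thesis using Q(2,3)[OF Y] by simp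
    qed
    have "mtrace (W\<^sup>\<dagger> * Y * W * D' (\<Phi> (W * \<rho> * W\<^sup>\<dagger>))) = mtrace (W\<^sup>\<dagger> * Y * W * \<rho>)"
      if \<rho>: "\<rho> \<in> carrier_mat s s" for \<rho>
    proof -
      define X where "X = W\<^sup>\<dagger> * Y * W"
      define \<sigma> where "\<sigma> = T * \<rho> * T\<^sup>\<dagger>"
      have \<rho>d: "dim_row \<rho> = s" "dim_col \<rho> = s" using \<rho> by auto
      have Xd: "dim_row X = s" "dim_col X = s" using Xc by (auto simp: X_def)
      have \<sigma>c: "\<sigma> \<in> carrier_mat r r" and \<sigma>d: "dim_row \<sigma> = r" "dim_col \<sigma> = r" using Td by (auto simp: \<sigma>_def)
      have W\<rho>: "W * \<rho> * W\<^sup>\<dagger> = V * \<sigma> * V\<^sup>\<dagger>"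
        using Vd Td Wd \<rho>d by (simp add: \<sigma>_def mat_mult_assoc_dim TV) (simp add: VT flip: mat_mult_assoc_dim)
      define B where "B = D (\<Phi> (V * \<sigma> * V\<^sup>\<dagger>))"
      have "V * \<sigma> * V\<^sup>\<dagger> \<in> carrier_mat n n" using Vd by (intro carrier_matI) auto
      then have Bc: "B \<in> carrier_mat r r" using \<Phi> D unfolding B_def quantum_channel_def by blast
      then have Bd: "dim_row B = r" "dim_col B = r" by auto
      have EB: "mtrace (E * B) = mtrace (E * \<sigma>)" unfolding B_def E_eq by (rule recover[OF PQ \<sigma>c])
      have "E * \<sigma> = E * T * (\<rho> * T\<^sup>\<dagger>)" using Ed Td \<rho>d by (simp add: \<sigma>_def mat_mult_assoc_dim)
      also have "\<dots> = 0\<^sub>m r r" unfolding ET using Td \<rho>d by (simp add: mat_one_zero_dim)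
      finally have EB0: "mtrace (E * B) = 0" using EB by simp
      have "D' (\<Phi> (W * \<rho> * W\<^sup>\<dagger>)) = T\<^sup>\<dagger> * B * T"
        using Td Bd by (simp add: D'_def compress_def W\<rho> EB0 flip: B_def E_def) (intro eq_matI, auto)
      then have "mtrace (X * D' (\<Phi> (W * \<rho> * W\<^sup>\<dagger>))) = mtrace (X * T\<^sup>\<dagger> * B * T)"
        using Td Bd Xd by (simp add: mat_mult_assoc_dim)
      also have "\<dots> = mtrace (T * (X * T\<^sup>\<dagger> * B))"
        by (rule mtrace_comm[of _ s r]) (use Td Bd Xd in \<open>auto intro!: carrier_matI\<close>)
      also have "\<dots> = mtrace (T * X * T\<^sup>\<dagger> * B)" using Td Bd Xd by (simp add: mat_mult_assoc_dim)
      also have "\<dots> = mtrace (V\<^sup>\<dagger> * Y * V * B)" by (simp add: X_def lift)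
      also have "\<dots> = mtrace (V\<^sup>\<dagger> * Y * V * \<sigma>)"
        unfolding B_def using Y S'(2) by (intro recover[OF _ \<sigma>c]) auto
      also have "\<dots> = mtrace (T * X * T\<^sup>\<dagger> * \<sigma>)" by (simp add: X_def lift)
      also have "\<dots> = mtrace (T * (X * (T\<^sup>\<dagger> * T) * (\<rho> * T\<^sup>\<dagger>)))"
        using Td Xd \<rho>d by (simp add: \<sigma>_def mat_mult_assoc_dim)
      also have "\<dots> = mtrace (T * (X * \<rho> * T\<^sup>\<dagger>))" using Td Xd \<rho>d by (simp add: TT mat_one_zero_dim mat_mult_assoc_dim)
      also have "\<dots> = mtrace (X * \<rho> * T\<^sup>\<dagger> * T)"
        by (rule mtrace_comm[of _ r s]) (use Td Xd \<rho>d in \<open>auto intro!: carrier_matI\<close>)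
      also have "\<dots> = mtrace (X * \<rho>)" using Td Xd \<rho>d by (simp add: TT mat_one_zero_dim mat_mult_assoc_dim)
      finally show ?thesis unfolding X_def .
    qed
    then show ?thesis using map_adjoint_recovery_iff[OF \<Phi> D' W(1) Xc] by blast
  qed
  then show ?thesis
    unfolding correctable_def using S'(1) Q W D' by blast
qed

section \<open>Transmittability is inherited by subalgebras\<close>

lemma fin_dim_inj_linear:
  assumes lin: "linear_map K V W f" and inj: "inj_on f (carrier V)" and fd: "vectorspace.fin_dim K W"
  shows "vectorspace.fin_dim K V"
proof -
  interpret linear_map K V W f by (rule lin)
  have bound: "finite C \<and> card C \<le> W.dim" if C: "C \<subseteq> carrier V \<and> V.module.lin_indpt C" for C
  proof -
    have injC: "inj_on f C" using inj C by (auto intro: inj_on_subset)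
    have fC: "f ` C \<subseteq> carrier W" using C by auto
    have "W.module.lin_indpt (f ` C)"
    proof
      assume "W.module.lin_dep (f ` C)"
      then obtain A a v where A: "finite A" "A \<subseteq> f ` C" "a \<in> A \<rightarrow> carrier K"
        "W.module.lincomb a A = \<zero>\<^bsub>W\<^esub>" "v \<in> A" "a v \<noteq> \<zero>\<^bsub>K\<^esub>"
        unfolding W.module.lin_dep_def by blast
      then obtain B where B: "B \<subseteq> C" "A = f ` B" by (auto simp: subset_image_iff)
      have finB: "finite B" using A(1) B injC by (auto dest: finite_imageD inj_on_subset)
      have BV: "B \<subseteq> carrier V" using B(1) C by blast
      have "W.module.lincomb a (f ` B) = f (V.module.lincomb (a \<circ> f) B)"
        using A(3) B(2) by (intro lincomb_linear_image[OF inj BV _ finB]) simp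
      then have "f (V.module.lincomb (a \<circ> f) B) = f \<zero>\<^bsub>V\<^esub>" using A(4) B(2) by simp
      moreover have "a \<circ> f \<in> B \<rightarrow> carrier K" using A(3) B(2) by auto
      then have "V.module.lincomb (a \<circ> f) B \<in> carrier V" using BV by (intro V.module.lincomb_closed)
      ultimately have "V.module.lincomb (a \<circ> f) B = \<zero>\<^bsub>V\<^esub>" by (rule inj_onD[OF inj]) simp
      moreover obtain w where "w \<in> B" "v = f w" using A(5) B(2) by blast
      ultimately have "V.module.lin_dep C"
        unfolding V.module.lin_dep_def using A(6) finB B(1) \<open>a \<circ> f \<in> B \<rightarrow> carrier K\<close> by (metis comp_apply)
      with C show False by simp
    qed
    from W.li_le_dim[OF fd fC this] show ?thesis
      using injC by (auto simp: card_image dest: finite_imageD)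
  qed
  have "{} \<subseteq> carrier V \<and> V.module.lin_indpt {}" by (auto simp: V.module.lin_dep_def)
  from maximal_exists[of "\<lambda>C. C \<subseteq> carrier V \<and> V.module.lin_indpt C", OF bound this] obtain C
    where C: "finite C" "maximal C (\<lambda>C. C \<subseteq> carrier V \<and> V.module.lin_indpt C)" by blast
  then show ?thesis
    using V.max_li_is_gen[OF C(2)] unfolding V.fin_dim_def by (auto simp: maximal_def)
qed

text \<open>What must be checked by hand for a *-algebra that embeds in a finite-dimensional C*-algebra; all
  other axioms, the norm included, are pulled back along the embedding.\<close>

definition pre_star_algebra :: "'a star_algebra \<Rightarrow> bool" where
  "pre_star_algebra B \<longleftrightarrow> \<zero>\<^bsub>B\<^esub> \<in> carrier B \<and> \<one>\<^bsub>B\<^esub> \<in> carrier B \<and> \<one>\<^bsub>B\<^esub> \<noteq> \<zero>\<^bsub>B\<^esub> \<and>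
     \<zero>\<^bsub>B\<^esub> \<oplus>\<^bsub>B\<^esub> \<zero>\<^bsub>B\<^esub> = \<zero>\<^bsub>B\<^esub> \<and>
     (\<forall>x\<in>carrier B. \<forall>y\<in>carrier B. x \<oplus>\<^bsub>B\<^esub> y \<in> carrier B \<and> x \<otimes>\<^bsub>B\<^esub> y \<in> carrier B) \<and>
     (\<forall>x\<in>carrier B. \<one>\<^bsub>B\<^esub> \<otimes>\<^bsub>B\<^esub> x = x \<and> x \<otimes>\<^bsub>B\<^esub> \<one>\<^bsub>B\<^esub> = x \<and> adj B x \<in> carrier B) \<and>
     (\<forall>c. \<forall>x\<in>carrier B. c \<odot>\<^bsub>B\<^esub> x \<in> carrier B)"

lemma fd_cstar_pre: "fd_cstar_algebra A \<Longrightarrow> pre_star_algebra A"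
proof -
  assume A: "fd_cstar_algebra A"
  interpret A: ring A using A by (simp add: fd_cstar_algebra_def)
  interpret V: vectorspace class_ring A using A by (simp add: fd_cstar_algebra_def)
  have "c \<odot>\<^bsub>A\<^esub> x \<in> carrier A" if "x \<in> carrier A" for c x
    using V.smult_closed[of c x] that by simp
  with A show ?thesis by (auto simp: pre_star_algebra_def fd_cstar_algebra_def)
qed

lemma fd_cstar_embed:
  assumes A: "fd_cstar_algebra A" and f: "f \<in> star_hom B A" and inj: "inj_on f (carrier B)"
    and B: "pre_star_algebra B"
  shows "fd_cstar_algebra B"
proof -
  interpret A: ring A using A by (simp add: fd_cstar_algebra_def)
  interpret V: vectorspace class_ring A using A by (simp add: fd_cstar_algebra_def)
  have fd: "V.fin_dim" using A by (simp add: fd_cstar_algebra_def)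
  have nz: "\<one>\<^bsub>A\<^esub> \<noteq> \<zero>\<^bsub>A\<^esub>" using A by (simp add: fd_cstar_algebra_def)
  have smA: "c \<odot>\<^bsub>A\<^esub> x \<in> carrier A" if "x \<in> carrier A" for c x
    using V.smult_closed[of c x] that by simp
  have adA: "adj A x \<in> carrier A" "adj A (adj A x) = x" if "x \<in> carrier A" for x
    using A that by (auto simp: fd_cstar_algebra_def)
  have sml: "(c \<odot>\<^bsub>A\<^esub> x) \<otimes>\<^bsub>A\<^esub> y = c \<odot>\<^bsub>A\<^esub> (x \<otimes>\<^bsub>A\<^esub> y)"
    and smr: "x \<otimes>\<^bsub>A\<^esub> (c \<odot>\<^bsub>A\<^esub> y) = c \<odot>\<^bsub>A\<^esub> (x \<otimes>\<^bsub>A\<^esub> y)"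
    and ada: "adj A (x \<oplus>\<^bsub>A\<^esub> y) = adj A x \<oplus>\<^bsub>A\<^esub> adj A y"
    and adm: "adj A (x \<otimes>\<^bsub>A\<^esub> y) = adj A y \<otimes>\<^bsub>A\<^esub> adj A x"
    if "x \<in> carrier A" "y \<in> carrier A" for c x y
    using A that unfolding fd_cstar_algebra_def by blast+
  have ads: "adj A (c \<odot>\<^bsub>A\<^esub> x) = cnj c \<odot>\<^bsub>A\<^esub> adj A x" if "x \<in> carrier A" for c x
    using A that unfolding fd_cstar_algebra_def by blast
  have fc: "f x \<in> carrier A" if "x \<in> carrier B" for x using f that by (auto simp: star_hom_def)
  have fr: "f (x \<oplus>\<^bsub>B\<^esub> y) = f x \<oplus>\<^bsub>A\<^esub> f y" "f (x \<otimes>\<^bsub>B\<^esub> y) = f x \<otimes>\<^bsub>A\<^esub> f y"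
    if "x \<in> carrier B" "y \<in> carrier B" for x y
    using f that by (auto simp: star_hom_def)
  have fs: "f (c \<odot>\<^bsub>B\<^esub> x) = c \<odot>\<^bsub>A\<^esub> f x" "f (adj B x) = adj A (f x)"
    if "x \<in> carrier B" for c x
    using f that by (auto simp: star_hom_def)
  have Bc: "\<zero>\<^bsub>B\<^esub> \<in> carrier B" "\<one>\<^bsub>B\<^esub> \<in> carrier B" "\<one>\<^bsub>B\<^esub> \<noteq> \<zero>\<^bsub>B\<^esub>" "\<zero>\<^bsub>B\<^esub> \<oplus>\<^bsub>B\<^esub> \<zero>\<^bsub>B\<^esub> = \<zero>\<^bsub>B\<^esub>"
    "\<And>x y. x \<in> carrier B \<Longrightarrow> y \<in> carrier B \<Longrightarrow> x \<oplus>\<^bsub>B\<^esub> y \<in> carrier B"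
    "\<And>x y. x \<in> carrier B \<Longrightarrow> y \<in> carrier B \<Longrightarrow> x \<otimes>\<^bsub>B\<^esub> y \<in> carrier B"
    "\<And>x. x \<in> carrier B \<Longrightarrow> \<one>\<^bsub>B\<^esub> \<otimes>\<^bsub>B\<^esub> x = x" "\<And>x. x \<in> carrier B \<Longrightarrow> x \<otimes>\<^bsub>B\<^esub> \<one>\<^bsub>B\<^esub> = x"
    "\<And>x. x \<in> carrier B \<Longrightarrow> adj B x \<in> carrier B"
    "\<And>c x. x \<in> carrier B \<Longrightarrow> c \<odot>\<^bsub>B\<^esub> x \<in> carrier B"
    using B by (auto simp: pre_star_algebra_def)
  have f0: "f \<zero>\<^bsub>B\<^esub> = \<zero>\<^bsub>A\<^esub>"
  proof -
    have "f \<zero>\<^bsub>B\<^esub> \<oplus>\<^bsub>A\<^esub> f \<zero>\<^bsub>B\<^esub> = f \<zero>\<^bsub>B\<^esub>" using fr(1)[OF Bc(1,1)] Bc(4) by simp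
    then show ?thesis using fc[OF Bc(1)] by (simp add: A.add.l_cancel_one)
  qed
  have eqI: "x = y" if "f x = f y" "x \<in> carrier B" "y \<in> carrier B" for x y
    using inj that by (auto dest: inj_onD)
  note R = fr fs f0 fc Bc(1,2,5-)
  have neg1: "(-1) \<odot>\<^bsub>A\<^esub> x \<oplus>\<^bsub>A\<^esub> x = \<zero>\<^bsub>A\<^esub>" if "x \<in> carrier A" for x
    using V.smult_l_distr[of "-1" 1 x] that V.smult_one[OF that] V.lmult_0[OF that] by simp
  have ag: "abelian_group B"
  proof (rule abelian_groupI)
    fix x assume x: "x \<in> carrier B"
    show "\<exists>y\<in>carrier B. y \<oplus>\<^bsub>B\<^esub> x = \<zero>\<^bsub>B\<^esub>"
      by (intro bexI[of _ "(-1) \<odot>\<^bsub>B\<^esub> x"] eqI) (simp_all add: R x neg1)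
  qed (auto intro!: eqI simp: R A.a_ac)
  have mon: "monoid B"
    by (rule monoidI) (auto intro!: eqI simp: R A.m_assoc)
  have ring: "ring B"
    by (rule ringI[OF ag mon]) (auto intro!: eqI simp: R A.l_distr A.r_distr)
  have mod: "module class_ring B"
  proof (rule moduleI[OF _ ag])
    show "cring (class_ring :: complex ring)" by (rule domain.axioms(1)[OF field.axioms(1)[OF class_field]])
  qed (use V.smult_l_distr V.smult_r_distr V.smult_assoc1 V.smult_one in \<open>auto intro!: eqI simp: R\<close>)
  have vs: "vectorspace class_ring B"
    by (rule vectorspace.intro[OF mod class_field])
  have "linear_map class_ring B A f"
    by (intro linear_map.intro mod_hom.intro mod_hom_axioms.intro V.vectorspace_axioms vs
          vectorspace.axioms(1)[OF V.vectorspace_axioms] mod) (auto simp: LinearCombinations.module_hom_def R)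
  then have fdB: "vectorspace.fin_dim class_ring B" by (rule fin_dim_inj_linear[OF _ inj fd])
  let ?norm = "\<lambda>\<nu> :: 'a \<Rightarrow> real.
        (\<forall>x\<in>carrier A. 0 \<le> \<nu> x \<and> (\<nu> x = 0 \<longleftrightarrow> x = \<zero>\<^bsub>A\<^esub>)) \<and>
        (\<forall>c. \<forall>x\<in>carrier A. \<nu> (c \<odot>\<^bsub>A\<^esub> x) = cmod c * \<nu> x) \<and>
        (\<forall>x\<in>carrier A. \<forall>y\<in>carrier A.
           \<nu> (x \<oplus>\<^bsub>A\<^esub> y) \<le> \<nu> x + \<nu> y \<and> \<nu> (x \<otimes>\<^bsub>A\<^esub> y) \<le> \<nu> x * \<nu> y) \<and>
        (\<forall>x\<in>carrier A. \<nu> (adj A x \<otimes>\<^bsub>A\<^esub> x) = (\<nu> x)\<^sup>2)"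
  have "\<exists>\<nu>. ?norm \<nu>" using A unfolding fd_cstar_algebra_def by (elim conjE)
  then obtain \<nu> where "?norm \<nu>" ..
  then have nu: "x \<in> carrier A \<Longrightarrow> 0 \<le> \<nu> x" "x \<in> carrier A \<Longrightarrow> \<nu> x = 0 \<longleftrightarrow> x = \<zero>\<^bsub>A\<^esub>"
    "x \<in> carrier A \<Longrightarrow> \<nu> (c \<odot>\<^bsub>A\<^esub> x) = cmod c * \<nu> x"
    "\<lbrakk>x \<in> carrier A; y \<in> carrier A\<rbrakk> \<Longrightarrow> \<nu> (x \<oplus>\<^bsub>A\<^esub> y) \<le> \<nu> x + \<nu> y"
    "\<lbrakk>x \<in> carrier A; y \<in> carrier A\<rbrakk> \<Longrightarrow> \<nu> (x \<otimes>\<^bsub>A\<^esub> y) \<le> \<nu> x * \<nu> y"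
    "x \<in> carrier A \<Longrightarrow> \<nu> (adj A x \<otimes>\<^bsub>A\<^esub> x) = (\<nu> x)\<^sup>2" for c x y
    by simp_all
  have fz: "f x = \<zero>\<^bsub>A\<^esub> \<longleftrightarrow> x = \<zero>\<^bsub>B\<^esub>" if "x \<in> carrier B" for x
    using eqI[OF _ that Bc(1)] f0 by auto
  show ?thesis
    unfolding fd_cstar_algebra_def
  proof (intro conjI ring vs fdB Bc(3) exI[of _ "\<lambda>x. \<nu> (f x)"])
  qed (auto intro!: eqI simp: R fz nu sml smr ada adm ads smA adA)
qed

lemma transmittable_embeds:
  fixes A :: "'a star_algebra" and B :: "'b star_algebra"
  assumes \<Phi>: "quantum_channel n m \<Phi>" and A: "transmittable n m \<Phi> A"
    and emb: "star_embeds B A" and B: "pre_star_algebra B"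
  shows "transmittable n m \<Phi> B"
proof -
  obtain \<pi> where fdA: "fd_cstar_algebra A" and \<pi>: "\<pi> \<in> star_hom A (mat_algebra n)" "inj_on \<pi> (carrier A)"
    and cor: "correctable n m \<Phi> (\<pi> ` carrier A)"
    using A by (auto simp: transmittable_def)
  obtain f where f: "f \<in> star_hom B A" "inj_on f (carrier B)" using emb by (auto simp: star_embeds_def)
  define g where "g = \<pi> \<circ> f"
  have fd: "fd_cstar_algebra B" by (rule fd_cstar_embed[OF fdA f B])
  have g: "g \<in> star_hom B (mat_algebra n)" unfolding g_def by (rule star_hom_comp[OF f(1) \<pi>(1)])
  have inj: "inj_on g (carrier B)"
    unfolding g_def by (rule comp_inj_on[OF f(2) inj_on_subset[OF \<pi>(2) star_hom_image[OF f(1)]]])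
  have Bc: "\<zero>\<^bsub>B\<^esub> \<in> carrier B" "\<one>\<^bsub>B\<^esub> \<in> carrier B" "\<one>\<^bsub>B\<^esub> \<noteq> \<zero>\<^bsub>B\<^esub>" "\<zero>\<^bsub>B\<^esub> \<oplus>\<^bsub>B\<^esub> \<zero>\<^bsub>B\<^esub> = \<zero>\<^bsub>B\<^esub>"
    "\<And>x y. x \<in> carrier B \<Longrightarrow> y \<in> carrier B \<Longrightarrow> x \<oplus>\<^bsub>B\<^esub> y \<in> carrier B"
    "\<And>x y. x \<in> carrier B \<Longrightarrow> y \<in> carrier B \<Longrightarrow> x \<otimes>\<^bsub>B\<^esub> y \<in> carrier B"
    "\<And>x. x \<in> carrier B \<Longrightarrow> \<one>\<^bsub>B\<^esub> \<otimes>\<^bsub>B\<^esub> x = x" "\<And>x. x \<in> carrier B \<Longrightarrow> x \<otimes>\<^bsub>B\<^esub> \<one>\<^bsub>B\<^esub> = x"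
    "\<And>x. x \<in> carrier B \<Longrightarrow> adj B x \<in> carrier B"
    "\<And>c x. x \<in> carrier B \<Longrightarrow> c \<odot>\<^bsub>B\<^esub> x \<in> carrier B"
    using B by (auto simp: pre_star_algebra_def)
  have gc: "g x \<in> carrier_mat n n" if "x \<in> carrier B" for x using g that by (auto simp: star_hom_def)
  have gr: "x \<in> carrier B \<Longrightarrow> y \<in> carrier B \<Longrightarrow> g x + g y = g (x \<oplus>\<^bsub>B\<^esub> y)"
    "x \<in> carrier B \<Longrightarrow> y \<in> carrier B \<Longrightarrow> g x * g y = g (x \<otimes>\<^bsub>B\<^esub> y)"
    "x \<in> carrier B \<Longrightarrow> c \<cdot>\<^sub>m g x = g (c \<odot>\<^bsub>B\<^esub> x)"
    "x \<in> carrier B \<Longrightarrow> mat_adjoint (g x) = g (adj B x)" for c x y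
    using g by (auto simp: star_hom_def)
  have g0: "g \<zero>\<^bsub>B\<^esub> = 0\<^sub>m n n"
    using gr(1)[OF Bc(1,1)] Bc(4) by (intro mat_add_self_zeroD gc[OF Bc(1)]) simp
  have "correctable n m \<Phi> (g ` carrier B)"
  proof (rule correctable_subalgebra[OF \<Phi> cor])
    show "star_subalgebra n (g ` carrier B)"
      unfolding star_subalgebra_def
      using gc Bc by (auto simp: gr simp flip: g0)
    show "g ` carrier B \<subseteq> \<pi> ` carrier A" using star_hom_image[OF f(1)] by (auto simp: g_def)
    show "g \<one>\<^bsub>B\<^esub> \<in> g ` carrier B" using Bc by auto
    show "g \<one>\<^bsub>B\<^esub> * X = X" "X * g \<one>\<^bsub>B\<^esub> = X" if "X \<in> g ` carrier B" for X
      using that Bc by (auto simp: gr)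
    show "g \<one>\<^bsub>B\<^esub> \<noteq> 0\<^sub>m n n" using inj Bc(1-3) by (auto simp flip: g0 dest: inj_onD)
  qed
  with fd g inj show ?thesis by (auto simp: transmittable_def)
qed

lemma transmittable_iso_direct_sum:
  fixes A :: "'a star_algebra"
  assumes "transmittable n m \<Phi> A"
  obtains ds where "\<forall>d\<in>set ds. 0 < d" "star_iso A (mat_direct_sum ds)"
  using assms star_subalgebra_iso_direct_sum unfolding transmittable_def correctable_def by metis

lemma star_iso_sym:
  assumes iso: "star_iso A B" and A: "pre_star_algebra A"
  shows "star_iso B A"
proof -
  obtain f where f: "f \<in> star_hom A B" "bij_betw f (carrier A) (carrier B)" using iso by (auto simp: star_iso_def)
  have im: "f ` carrier A = carrier B" and inj: "inj_on f (carrier A)" using f(2) by (auto simp: bij_betw_def)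
  let ?g = "the_inv_into (carrier A) f"
  have g: "?g (f x) = x" if "x \<in> carrier A" for x using inj that by (rule the_inv_into_f_f)
  have r: "x \<in> carrier A \<Longrightarrow> y \<in> carrier A \<Longrightarrow> f x \<oplus>\<^bsub>B\<^esub> f y = f (x \<oplus>\<^bsub>A\<^esub> y)"
    "x \<in> carrier A \<Longrightarrow> y \<in> carrier A \<Longrightarrow> f x \<otimes>\<^bsub>B\<^esub> f y = f (x \<otimes>\<^bsub>A\<^esub> y)"
    "x \<in> carrier A \<Longrightarrow> c \<odot>\<^bsub>B\<^esub> f x = f (c \<odot>\<^bsub>A\<^esub> x)"
    "x \<in> carrier A \<Longrightarrow> adj B (f x) = f (adj A x)" for c x y
    using f(1) by (auto simp: star_hom_def)
  have "?g \<in> star_hom B A"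
    using A unfolding star_hom_def im[symmetric] by (auto simp: r g pre_star_algebra_def)
  moreover have "bij_betw ?g (carrier B) (carrier A)" using f(2) by (rule bij_betw_the_inv_into)
  ultimately show ?thesis by (auto simp: star_iso_def)
qed

section \<open>Embeddings between direct sums of matrix algebras\<close>

lemma mat_direct_sum_carrier_iff:
  "xs \<in> carrier (mat_direct_sum ds) \<longleftrightarrow>
    length xs = length ds \<and> (\<forall>i<length ds. dim_row (xs ! i) = ds ! i \<and> dim_col (xs ! i) = ds ! i)"
  by (auto simp: list_all2_conv_all_nth)

declare mat_direct_sum_sel(1) [simp del]

lemma pre_star_algebra_mat_direct_sum:
  assumes "ds \<noteq> []" "\<forall>d\<in>set ds. 0 < d"
  shows "pre_star_algebra (mat_direct_sum ds)"
proof -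
  have "map 1\<^sub>m ds \<noteq> (map (\<lambda>d. 0\<^sub>m d d) ds :: complex mat list)"
  proof
    assume "map 1\<^sub>m ds = (map (\<lambda>d. 0\<^sub>m d d) ds :: complex mat list)"
    then have "1\<^sub>m (hd ds) = (0\<^sub>m (hd ds) (hd ds) :: complex mat)" using assms(1) by (cases ds) auto
    then have "1\<^sub>m (hd ds) $$ (0, 0) = (0\<^sub>m (hd ds) (hd ds) $$ (0, 0) :: complex)" by simp
    then show False using assms by simp
  qed
  then show ?thesis
    unfolding pre_star_algebra_def
    by (auto simp: mat_direct_sum_carrier_iff mat_one_zero_dim intro!: nth_equalityI)
qed

lemma pre_star_algebra_mat_algebra: "0 < d \<Longrightarrow> pre_star_algebra (mat_algebra d)"
proof -
  assume d: "0 < d"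
  have "1\<^sub>m d \<noteq> (0\<^sub>m d d :: complex mat)"
  proof
    assume "1\<^sub>m d = (0\<^sub>m d d :: complex mat)"
    then have "1\<^sub>m d $$ (0, 0) = (0\<^sub>m d d $$ (0, 0) :: complex)" by simp
    then show False using d by simp
  qed
  then show ?thesis by (auto simp: pre_star_algebra_def)
qed

lemma star_iso_mat_algebra: "star_iso (mat_algebra d) (mat_direct_sum [d])"
  unfolding star_iso_def
proof (intro bexI)
  show "bij_betw (\<lambda>x. [x]) (carrier (mat_algebra d)) (carrier (mat_direct_sum [d]))"
    by (rule bij_betw_byWitness[where f' = hd]) (auto simp: mat_direct_sum_sel(1) list_all2_Cons2)
qed (auto simp: star_hom_def mat_direct_sum_sel(1))

lemma star_iso_mat_direct_sum_perm:
  assumes "mset ds = mset ds'"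
  shows "star_iso (mat_direct_sum ds) (mat_direct_sum ds')"
proof -
  obtain p where p: "p permutes {..<length ds}" "permute_list p ds = ds'"
    using mset_eq_permutation[OF assms[symmetric]] by metis
  have len: "length ds' = length ds" using p(2) by auto
  have p_lt: "p i < length ds" if "i < length ds" for i using permutes_in_image[OF p(1)] that by auto
  have ds': "ds' ! i = ds ! p i" if "i < length ds" for i using permute_list_nth[OF p(1) that] p(2) by simp
  have inv: "inv_into UNIV p permutes {..<length ds}" using p(1) by (rule permutes_inv)
  have inv_lt: "inv_into UNIV p i < length ds" if "i < length ds" for i using permutes_in_image[OF inv] that by auto
  have inv_p: "inv_into UNIV p (p i) = i" "p (inv_into UNIV p i) = i" for i using permutes_inverses[OF p(1)] by auto
  have nth: "permute_list q xs ! i = xs ! q i" if "q permutes {..<length ds}" "length xs = length ds" "i < length ds"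
    for q and i and xs :: "complex mat list"
    using permute_list_nth[of q xs i] that by simp
  have "permute_list p \<in> star_hom (mat_direct_sum ds) (mat_direct_sum ds')"
    unfolding star_hom_def
    by (auto simp: mat_direct_sum_carrier_iff len ds' nth p(1) p_lt intro!: nth_equalityI)
  moreover have "bij_betw (permute_list p) (carrier (mat_direct_sum ds)) (carrier (mat_direct_sum ds'))"
  proof (rule bij_betw_byWitness[where f' = "permute_list (inv_into UNIV p)"])
    show "\<forall>xs\<in>carrier (mat_direct_sum ds). permute_list (inv_into UNIV p) (permute_list p xs) = xs"
      "\<forall>xs\<in>carrier (mat_direct_sum ds'). permute_list p (permute_list (inv_into UNIV p) xs) = xs"
      by (auto simp: mat_direct_sum_carrier_iff len nth p(1) inv p_lt inv_lt inv_p intro!: nth_equalityI)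
    show "permute_list p ` carrier (mat_direct_sum ds) \<subseteq> carrier (mat_direct_sum ds')"
      by (auto simp: mat_direct_sum_carrier_iff len ds' nth p(1) p_lt)
    show "permute_list (inv_into UNIV p) ` carrier (mat_direct_sum ds') \<subseteq> carrier (mat_direct_sum ds)"
      using ds'[OF inv_lt] by (auto simp: mat_direct_sum_carrier_iff len nth inv inv_lt inv_p)
  qed
  ultimately show ?thesis by (auto simp: star_iso_def)
qed

lemma star_embeds_mat_direct_sum_append:
  assumes "star_embeds (mat_direct_sum as) (mat_direct_sum as')"
    and "star_embeds (mat_direct_sum bs) (mat_direct_sum bs')"
  shows "star_embeds (mat_direct_sum (as @ bs)) (mat_direct_sum (as' @ bs'))"
proof -
  obtain f g where f: "f \<in> star_hom (mat_direct_sum as) (mat_direct_sum as')" "inj_on f (carrier (mat_direct_sum as))"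
    and g: "g \<in> star_hom (mat_direct_sum bs) (mat_direct_sum bs')" "inj_on g (carrier (mat_direct_sum bs))"
    using assms by (auto simp: star_embeds_def)
  let ?A = "carrier (mat_direct_sum as)" and ?B = "carrier (mat_direct_sum bs)"
  define h where "h xs = f (take (length as) xs) @ g (drop (length as) xs)" for xs
  have len: "length x = length ds" if "x \<in> carrier (mat_direct_sum ds)" for x ds
    using that by (simp add: mat_direct_sum_carrier_iff)
  have fl: "length (f x) = length as'" if "x \<in> ?A" for x using f(1) that len[of "f x" as'] by (auto simp: star_hom_def)
  have gl: "length (g x) = length bs'" if "x \<in> ?B" for x using g(1) that len[of "g x" bs'] by (auto simp: star_hom_def)
  have h: "h (x @ y) = f x @ g y" if "x \<in> ?A" for x y using len[OF that] by (simp add: h_def)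
  have split: "\<exists>x y. z = x @ y \<and> x \<in> ?A \<and> y \<in> ?B" if "z \<in> carrier (mat_direct_sum (as @ bs))" for z
    using that by (auto simp: mat_direct_sum_sel(1) list_all2_append2)
  have join: "x @ y \<in> carrier (mat_direct_sum (cs @ ds))"
    if "x \<in> carrier (mat_direct_sum cs)" "y \<in> carrier (mat_direct_sum ds)" for x y cs ds
    using that by (auto simp: mat_direct_sum_sel(1) intro: list_all2_appendI)
  have closed: "map2 (+) x y \<in> carrier (mat_direct_sum ds)" "map2 (*) x y \<in> carrier (mat_direct_sum ds)"
    "map (\<lambda>x. c \<cdot>\<^sub>m x) x \<in> carrier (mat_direct_sum ds)" "map mat_adjoint x \<in> carrier (mat_direct_sum ds)"
    if "x \<in> carrier (mat_direct_sum ds)" "y \<in> carrier (mat_direct_sum ds)" for x y ds c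
    using that by (auto simp: mat_direct_sum_carrier_iff)
  have "h \<in> star_hom (mat_direct_sum (as @ bs)) (mat_direct_sum (as' @ bs'))"
    unfolding star_hom_def
  proof (intro CollectI conjI ballI allI Pi_I)
    fix z assume "z \<in> carrier (mat_direct_sum (as @ bs))"
    then obtain x y where z: "z = x @ y" "x \<in> ?A" "y \<in> ?B" using split by blast
    show "h z \<in> carrier (mat_direct_sum (as' @ bs'))"
      using z f(1) g(1) by (auto simp: h star_hom_def intro!: join)
    show "h (adj (mat_direct_sum (as @ bs)) z) = adj (mat_direct_sum (as' @ bs')) (h z)"
      using z f(1) g(1) closed by (simp add: h star_hom_def)
    show "h (c \<odot>\<^bsub>mat_direct_sum (as @ bs)\<^esub> z) = c \<odot>\<^bsub>mat_direct_sum (as' @ bs')\<^esub> h z" for c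
      using z f(1) g(1) closed by (simp add: h star_hom_def)
    fix z' assume "z' \<in> carrier (mat_direct_sum (as @ bs))"
    then obtain x' y' where z': "z' = x' @ y'" "x' \<in> ?A" "y' \<in> ?B" using split by blast
    show "h (z \<oplus>\<^bsub>mat_direct_sum (as @ bs)\<^esub> z') = h z \<oplus>\<^bsub>mat_direct_sum (as' @ bs')\<^esub> h z'"
      "h (z \<otimes>\<^bsub>mat_direct_sum (as @ bs)\<^esub> z') = h z \<otimes>\<^bsub>mat_direct_sum (as' @ bs')\<^esub> h z'"
      using z z' f(1) g(1) closed len by (simp_all add: h star_hom_def fl gl)
  qed
  moreover have "inj_on h (carrier (mat_direct_sum (as @ bs)))"
  proof (rule inj_onI)
    fix z z' assume zz': "z \<in> carrier (mat_direct_sum (as @ bs))" "z' \<in> carrier (mat_direct_sum (as @ bs))" "h z = h z'"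
    obtain x y where z: "z = x @ y" "x \<in> ?A" "y \<in> ?B" using split zz'(1) by blast
    obtain x' y' where z': "z' = x' @ y'" "x' \<in> ?A" "y' \<in> ?B" using split zz'(2) by blast
    from zz'(3) have "f x = f x' \<and> g y = g y'" using z z' by (simp add: h fl)
    then show "z = z'" using z z' f(2) g(2) by (auto dest: inj_onD)
  qed
  ultimately show ?thesis by (auto simp: star_embeds_def)
qed

lemma star_embeds_block_diagonal:
  assumes d: "0 < d" and kd: "k * d \<le> b"
  shows "star_embeds (mat_direct_sum (replicate k d)) (mat_direct_sum [b])"
proof -
  define F :: "complex mat list \<Rightarrow> complex mat"
    where "F xs = mat b b (\<lambda>(i, j). if i div d = j div d \<and> i div d < k then xs ! (i div d) $$ (i mod d, j mod d) else 0)" for xs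
  have C: "length xs = k" "i < k \<Longrightarrow> xs ! i \<in> carrier_mat d d" "i < k \<Longrightarrow> dim_row (xs ! i) = d" "i < k \<Longrightarrow> dim_col (xs ! i) = d"
    if "xs \<in> carrier (mat_direct_sum (replicate k d))" for xs i
    using that by (auto simp: mat_direct_sum_carrier_iff intro!: carrier_matI)
  have F_mult: "F (map2 (*) xs ys) = F xs * F ys"
    if xs: "xs \<in> carrier (mat_direct_sum (replicate k d))" and ys: "ys \<in> carrier (mat_direct_sum (replicate k d))" for xs ys
  proof (rule eq_matI)
    fix i j assume "i < dim_row (F xs * F ys)" "j < dim_col (F xs * F ys)"
    then have ij: "i < b" "j < b" by (auto simp: F_def)
    define T where "T l = (if i div d = l div d \<and> i div d < k then xs ! (i div d) $$ (i mod d, l mod d) else 0) *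
      (if l div d = j div d \<and> l div d < k then ys ! (l div d) $$ (l mod d, j mod d) else 0)" for l
    have "(F xs * F ys) $$ (i, j) = (\<Sum>l<b. T l)"
      using ij by (simp add: F_def scalar_prod_def lessThan_atLeast0 T_def)
    also have "\<dots> = (\<Sum>l<k * d. T l)"
      using kd d by (intro sum.mono_neutral_right) (auto simp: T_def less_mult_imp_div_less not_less div_less_iff_less_mult)
    also have "\<dots> = (\<Sum>a<k. \<Sum>t<d. T (a * d + t))" by (rule sum_lessThan_mult)
    also have "\<dots> = (\<Sum>a<k. if a = i div d then (if i div d = j div d then
        \<Sum>t<d. xs ! (i div d) $$ (i mod d, t) * ys ! (i div d) $$ (t, j mod d) else 0) else 0)"
      by (intro sum.cong refl) (auto simp: T_def)
    also have "\<dots> = F (map2 (*) xs ys) $$ (i, j)"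
      using ij d by (auto simp: F_def C[OF xs] C[OF ys] scalar_prod_def lessThan_atLeast0 mod_less_divisor)
    finally show "F (map2 (*) xs ys) $$ (i, j) = (F xs * F ys) $$ (i, j)" ..
  qed (auto simp: F_def)
  have "(\<lambda>xs. [F xs]) \<in> star_hom (mat_direct_sum (replicate k d)) (mat_direct_sum [b])"
    unfolding star_hom_def
  proof (intro CollectI conjI ballI allI Pi_I)
    fix xs assume xs: "xs \<in> carrier (mat_direct_sum (replicate k d))"
    show "[F xs] \<in> carrier (mat_direct_sum [b])" by (simp add: mat_direct_sum_sel(1) F_def)
    show "[F (adj (mat_direct_sum (replicate k d)) xs)] = adj (mat_direct_sum [b]) [F xs]"
      using d by (auto simp: F_def C[OF xs] intro!: eq_matI)
    show "[F (c \<odot>\<^bsub>mat_direct_sum (replicate k d)\<^esub> xs)] = c \<odot>\<^bsub>mat_direct_sum [b]\<^esub> [F xs]" for c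
      using d by (auto simp: F_def C[OF xs] intro!: eq_matI)
    fix ys assume ys: "ys \<in> carrier (mat_direct_sum (replicate k d))"
    show "[F (xs \<oplus>\<^bsub>mat_direct_sum (replicate k d)\<^esub> ys)] = [F xs] \<oplus>\<^bsub>mat_direct_sum [b]\<^esub> [F ys]"
      using d by (auto simp: F_def C[OF xs] C[OF ys] intro!: eq_matI)
    show "[F (xs \<otimes>\<^bsub>mat_direct_sum (replicate k d)\<^esub> ys)] = [F xs] \<otimes>\<^bsub>mat_direct_sum [b]\<^esub> [F ys]"
      using F_mult[OF xs ys] by simp
  qed
  moreover have "inj_on (\<lambda>xs. [F xs]) (carrier (mat_direct_sum (replicate k d)))"
  proof (rule inj_onI)
    fix xs ys assume xs: "xs \<in> carrier (mat_direct_sum (replicate k d))"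
      and ys: "ys \<in> carrier (mat_direct_sum (replicate k d))" and eq: "[F xs] = [F ys]"
    show "xs = ys"
    proof (rule nth_equalityI)
      fix q assume "q < length xs"
      then have q: "q < k" using C(1)[OF xs] by simp
      show "xs ! q = ys ! q"
      proof (rule eq_matI)
        fix i j assume "i < dim_row (ys ! q)" "j < dim_col (ys ! q)"
        then have ij: "i < d" "j < d" using C[OF ys] q by auto
        have lt: "q * d + i < b" "q * d + j < b"
          using mult_add_less[OF q ij(1)] mult_add_less[OF q ij(2)] kd by linarith+
        have "F xs $$ (q * d + i, q * d + j) = F ys $$ (q * d + i, q * d + j)" using eq by simp
        then show "xs ! q $$ (i, j) = ys ! q $$ (i, j)" using lt ij q by (simp add: F_def)
      qed (use C[OF xs] C[OF ys] q in auto)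
    qed (use C(1)[OF xs] C(1)[OF ys] in simp)
  qed
  ultimately show ?thesis by (auto simp: star_embeds_def)
qed

lemma star_embeds_replicate:
  assumes d: "0 < d" and c: "c \<le> (\<Sum>b\<leftarrow>bs. b div d)"
  shows "star_embeds (mat_direct_sum (replicate c d)) (mat_direct_sum bs)"
  using c
proof (induction bs arbitrary: c)
  case Nil
  have "id \<in> star_hom (mat_direct_sum []) (mat_direct_sum [])" by (auto simp: star_hom_def)
  with Nil show ?case by (auto simp: star_embeds_def intro!: bexI[of _ id])
next
  case (Cons b bs)
  define k where "k = min c (b div d)"
  have "k * d \<le> b div d * d" by (intro mult_right_mono) (auto simp: k_def)
  also have "\<dots> \<le> b" by simp
  finally have kd: "k * d \<le> b" .
  have "c - k \<le> (\<Sum>b\<leftarrow>bs. b div d)" using Cons.prems by (auto simp: k_def)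
  from star_embeds_mat_direct_sum_append[OF star_embeds_block_diagonal[OF d kd] Cons.IH[OF this]]
  show ?case by (simp add: k_def flip: replicate_add)
qed

lemma is_proj_msum:
  assumes p: "\<And>l. l < N \<Longrightarrow> is_proj b (p l)"
    and orth: "\<And>l l'. l < N \<Longrightarrow> l' < N \<Longrightarrow> l \<noteq> l' \<Longrightarrow> p l * p l' = 0\<^sub>m b b"
  shows "is_proj b (msum b p N)"
proof -
  have c: "p l \<in> carrier_mat b b" "p l * p l = p l" "(p l)\<^sup>\<dagger> = p l" if "l < N" for l
    using p[OF that] by (auto simp: is_proj_def)
  have "p l * msum b p N = p l" if l: "l < N" for l
  proof -
    have "p l * msum b p N = msum b (\<lambda>l'. p l * p l') N" using c l by (intro msum_mult_left) auto
    also have "\<dots> = p l * p l" using c l orth by (intro msum_single) auto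
    finally show ?thesis using c l by simp
  qed
  then have "msum b p N * msum b p N = msum b p N"
    using c by (subst msum_mult_right) (auto intro!: msum_cong)
  moreover have "(msum b p N)\<^sup>\<dagger> = msum b p N" using c by (subst msum_adjoint) (auto intro!: msum_cong)
  ultimately show ?thesis using c by (simp add: is_proj_def)
qed

text \<open>Here \<open>t J k\<close> is the multiplicity of the \<open>k\<close>-th copy of \<open>M\<^sub>d\<close> in the \<open>J\<close>-th block, that is,
  the rank of the image of its matrix unit \<open>e\<^sub>0\<^sub>0\<close>. The image of the unit of \<open>M\<^sub>d\<^sup>\<oplus>\<^sup>c\<close> in this
  block has rank \<open>d \<cdot> \<Sum>\<^sub>k t J k\<close>, and every \<open>k\<close> occurs in some block because the embedding is
  injective.\<close>

lemma star_embeds_replicate_le: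
  assumes emb: "star_embeds (mat_direct_sum (replicate c d)) (mat_direct_sum bs)" and d: "0 < d"
  shows "c \<le> (\<Sum>b\<leftarrow>bs. b div d)"
proof -
  let ?A = "mat_direct_sum (replicate c d)"
  obtain f where f: "f \<in> star_hom ?A (mat_direct_sum bs)" "inj_on f (carrier ?A)"
    using emb by (auto simp: star_embeds_def)
  define zero where "zero = replicate c (0\<^sub>m d d :: complex mat)"
  define e where "e k i j = zero[k := unit_mat d i j]" for k i j
  have e_car: "e k i j \<in> carrier ?A" for k i j
    by (cases "k < c") (auto simp: e_def zero_def mat_direct_sum_carrier_iff nth_list_update)
  have zero_car: "zero \<in> carrier ?A" by (simp add: zero_def mat_direct_sum_carrier_iff)
  have e_adj: "map mat_adjoint (e k i j) = e k j i" for k i j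
    by (simp add: e_def zero_def map_update unit_mat_adjoint)
  have e_mult: "map2 (*) (e k i j) (e k' i' j') = (if k = k' \<and> j = i' then e k i j' else zero)"
    if "k < c" "k' < c" "j < d" for k k' i j i' j'
    using that by (auto simp: e_def zero_def nth_list_update unit_mat_mult intro!: nth_equalityI)
  have f_car: "f x \<in> carrier (mat_direct_sum bs)" if "x \<in> carrier ?A" for x
    using f(1) that by (auto simp: star_hom_def)
  have f_nth: "f x ! J \<in> carrier_mat (bs ! J) (bs ! J)" if "x \<in> carrier ?A" "J < length bs" for x J
    using f_car[OF that(1)] that(2) by (auto simp: mat_direct_sum_carrier_iff intro!: carrier_matI)
  have f_len: "length (f x) = length bs" if "x \<in> carrier ?A" for x
    using f_car[OF that] by (simp add: mat_direct_sum_carrier_iff)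
  have f_mult: "f x ! J * f y ! J = f (map2 (*) x y) ! J"
    if "x \<in> carrier ?A" "y \<in> carrier ?A" "J < length bs" for x y J
    using f(1) that f_len by (simp add: star_hom_def)
  have f_adj: "(f x ! J)\<^sup>\<dagger> = f (map mat_adjoint x) ! J"
    if "x \<in> carrier ?A" "J < length bs" for x J
    using f(1) that f_len by (simp add: star_hom_def)
  have f_zero: "f zero ! J = 0\<^sub>m (bs ! J) (bs ! J)" if J: "J < length bs" for J
  proof -
    have "map2 (+) zero zero = zero" by (simp add: zero_def zip_replicate)
    then have "f zero = map2 (+) (f zero) (f zero)"
      using f(1) zero_car by (fastforce simp: star_hom_def)
    then have "f zero ! J + f zero ! J = f zero ! J"
      using J f_len[OF zero_car] by (metis (no_types, lifting) case_prod_conv length_map length_zip min.idem nth_map nth_zip)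
    then show ?thesis using f_nth[OF zero_car J] by (rule mat_add_self_zeroD)
  qed
  define p where "p J k i = f (e k i i) ! J" for J k i
  have p_proj: "is_proj (bs ! J) (p J k i)" if "J < length bs" "k < c" "i < d" for J k i
    using that f_nth[OF e_car] f_mult[OF e_car e_car] f_adj[OF e_car]
    by (simp add: is_proj_def p_def e_mult e_adj)
  have p_orth: "p J k i * p J k' i' = 0\<^sub>m (bs ! J) (bs ! J)"
    if "J < length bs" "k < c" "i < d" "k' < c" "i' < d" "(k, i) \<noteq> (k', i')" for J k i k' i'
    using that f_mult[OF e_car e_car] by (auto simp: p_def e_mult f_zero)
  have p_tr: "mtrace (p J k i) = mtrace (p J k 0)" if "J < length bs" "k < c" "i < d" for J k i
  proof -
    let ?v = "f (e k i 0) ! J" and ?v' = "f (e k 0 i) ! J"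
    have "mtrace (?v * ?v') = mtrace (?v' * ?v)" using that f_nth[OF e_car] by (intro mtrace_comm)
    then show ?thesis using that d f_mult[OF e_car e_car] by (simp add: p_def e_mult)
  qed
  have "\<forall>J k. \<exists>t. J < length bs \<longrightarrow> k < c \<longrightarrow> mtrace (p J k 0) = of_nat t"
    using is_proj_mtrace_nat[OF p_proj] d by metis
  then obtain t :: "nat \<Rightarrow> nat \<Rightarrow> nat"
    where t: "\<And>J k. J < length bs \<Longrightarrow> k < c \<Longrightarrow> mtrace (p J k 0) = of_nat (t J k)" by metis
  have row: "(\<Sum>k<c. t J k) \<le> bs ! J div d" if J: "J < length bs" for J
  proof -
    let ?P = "msum (bs ! J) (\<lambda>l. p J (l div d) (l mod d)) (c * d)"
    have lt: "l div d < c" "l mod d < d" if "l < c * d" for l using that d by (auto simp: less_mult_imp_div_less)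
    have "is_proj (bs ! J) ?P"
    proof (rule is_proj_msum)
      fix l l' assume l: "l < c * d" "l' < c * d" "l \<noteq> l'"
      then have "(l div d, l mod d) \<noteq> (l' div d, l' mod d)" by (metis Pair_inject div_mult_mod_eq)
      with l show "p J (l div d) (l mod d) * p J (l' div d) (l' mod d) = 0\<^sub>m (bs ! J) (bs ! J)"
        using lt J by (intro p_orth) auto
    qed (use p_proj lt J in auto)
    from is_proj_mtrace(3)[OF this] have "Re (mtrace ?P) \<le> bs ! J" .
    moreover have "mtrace ?P = (\<Sum>l<c * d. mtrace (p J (l div d) (l mod d)))"
      using f_nth[OF e_car J] by (intro msum_mtrace) (simp add: p_def)
    also have "\<dots> = (\<Sum>k<c. \<Sum>i<d. mtrace (p J k i))" by (simp add: sum_lessThan_mult)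
    also have "\<dots> = (\<Sum>k<c. \<Sum>i<d. of_nat (t J k))"
      by (intro sum.cong refl trans[OF p_tr t]) (use J in auto)
    also have "\<dots> = of_nat (d * (\<Sum>k<c. t J k))" by (simp add: sum_distrib_left)
    ultimately have "real (d * (\<Sum>k<c. t J k)) \<le> real (bs ! J)" by (metis Re_complex_of_real of_real_of_nat_eq)
    then have "(\<Sum>k<c. t J k) * d \<le> bs ! J" by (simp only: of_nat_le_iff mult.commute)
    then show ?thesis using d by (simp add: less_eq_div_iff_mult_less_eq)
  qed
  have col: "1 \<le> (\<Sum>J<length bs. t J k)" if k: "k < c" for k
  proof (rule ccontr)
    assume "\<not> ?thesis"
    then have "(\<Sum>J<length bs. t J k) = 0" by linarith
    then have "t J k = 0" if "J < length bs" for J using that by simp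
    then have "p J k 0 = 0\<^sub>m (bs ! J) (bs ! J)" if "J < length bs" for J
      using is_proj_mtrace_pos[OF p_proj[OF that k d]] t[OF that k] that by fastforce
    then have "f (e k 0 0) = f zero"
      using f_len[OF e_car] f_len[OF zero_car] by (intro nth_equalityI) (auto simp: p_def f_zero)
    then have "e k 0 0 = zero" using f(2) e_car zero_car by (auto dest: inj_onD)
    then have "e k 0 0 ! k $$ (0, 0) = zero ! k $$ (0, 0)" by simp
    then show False using k d by (simp add: e_def zero_def unit_mat_def)
  qed
  have "c = (\<Sum>k<c. 1)" by simp
  also have "\<dots> \<le> (\<Sum>k<c. \<Sum>J<length bs. t J k)" using col by (intro sum_mono) auto
  also have "\<dots> = (\<Sum>J<length bs. \<Sum>k<c. t J k)" by (rule sum.swap)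
  also have "\<dots> \<le> (\<Sum>J<length bs. bs ! J div d)" using row by (intro sum_mono) auto
  also have "\<dots> = (\<Sum>b\<leftarrow>bs. b div d)" by (simp add: sum_list_sum_nth lessThan_atLeast0)
  finally show ?thesis .
qed

section \<open>Hybrid capacities\<close>

lemma finite_transmittable_copies:
  assumes d: "0 < d"
  shows "finite {c. transmittable n m \<Phi> (mat_direct_sum (replicate c d))}"
proof (rule finite_subset)
  show "{c. transmittable n m \<Phi> (mat_direct_sum (replicate c d))} \<subseteq> {..n div d}"
  proof safe
    fix c assume "transmittable n m \<Phi> (mat_direct_sum (replicate c d))"
    then have "star_embeds (mat_direct_sum (replicate c d)) (mat_algebra n)"
      by (auto simp: transmittable_def star_embeds_def)
    then have "star_embeds (mat_direct_sum (replicate c d)) (mat_direct_sum [n])"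
      by (rule star_embeds_trans[OF _ star_iso_embeds[OF star_iso_mat_algebra]])
    from star_embeds_replicate_le[OF this d] show "c \<le> n div d" by simp
  qed
qed simp

lemma transmittable_mat_algebra_iff:
  assumes \<Phi>: "quantum_channel n m \<Phi>" and d: "0 < d"
  shows "transmittable n m \<Phi> (mat_algebra d) \<longleftrightarrow> transmittable n m \<Phi> (mat_direct_sum (replicate 1 d))"
proof -
  have pre: "pre_star_algebra (mat_algebra d)" "pre_star_algebra (mat_direct_sum [d])"
    using d by (auto intro: pre_star_algebra_mat_algebra pre_star_algebra_mat_direct_sum)
  have "star_embeds (mat_algebra d) (mat_direct_sum [d])" "star_embeds (mat_direct_sum [d]) (mat_algebra d)"
    using star_iso_mat_algebra star_iso_sym[OF star_iso_mat_algebra pre(1)] by (auto intro: star_iso_embeds)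
  with pre show ?thesis by (auto intro: transmittable_embeds[OF \<Phi>])
qed

lemma not_transmittable_mat_algebra_0: "\<not> transmittable n m \<Phi> (mat_algebra 0)"
proof -
  have "1\<^sub>m 0 = (0\<^sub>m 0 0 :: complex mat)" by (rule eq_matI) auto
  then show ?thesis by (simp add: transmittable_def fd_cstar_algebra_def)
qed

lemma finite_transmittable_dims:
  assumes \<Phi>: "quantum_channel n m \<Phi>"
  shows "finite {d. transmittable n m \<Phi> (mat_algebra d)}"
proof (rule finite_subset)
  show "{d. transmittable n m \<Phi> (mat_algebra d)} \<subseteq> {..n}"
  proof safe
    fix d assume t: "transmittable n m \<Phi> (mat_algebra d)"
    then have d: "0 < d" using not_transmittable_mat_algebra_0 by (cases d) auto
    from t have 1: "star_embeds (mat_algebra d) (mat_algebra n)"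
      by (auto simp: transmittable_def star_embeds_def)
    have 2: "star_embeds (mat_direct_sum [d]) (mat_algebra d)"
      using d by (intro star_iso_embeds star_iso_sym[OF star_iso_mat_algebra] pre_star_algebra_mat_algebra)
    have 3: "star_embeds (mat_algebra n) (mat_direct_sum [n])"
      by (intro star_iso_embeds star_iso_mat_algebra)
    have "star_embeds (mat_direct_sum (replicate 1 d)) (mat_direct_sum [n])"
      using star_embeds_trans[OF star_embeds_trans[OF 2 1] 3] by simp
    from star_embeds_replicate_le[OF this d] have "1 \<le> n div d" by simp
    then show "d \<le> n" using d by (metis div_less not_le not_one_le_zero)
  qed
qed simp

locale transmittable_direct_sum =
  fixes n m :: nat and \<Phi> :: "complex mat \<Rightarrow> complex mat" and A :: "'a star_algebra" and ds :: "nat list"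
  assumes \<Phi>: "quantum_channel n m \<Phi>" and A: "transmittable n m \<Phi> A"
    and iso: "star_iso A (mat_direct_sum ds)" and pos: "\<forall>d\<in>set ds. 0 < d"
begin

lemma pre_A: "pre_star_algebra A"
  using A fd_cstar_pre by (auto simp: transmittable_def)

lemma iso': "star_iso (mat_direct_sum ds) A"
  using iso pre_A by (rule star_iso_sym)

lemma transmittable_copies:
  assumes "0 < d" "0 < c" "c \<le> (\<Sum>b\<leftarrow>ds. b div d)"
  shows "transmittable n m \<Phi> (mat_direct_sum (replicate c d))"
proof (rule transmittable_embeds[OF \<Phi> A])
  show "star_embeds (mat_direct_sum (replicate c d)) A"
    by (rule star_embeds_trans[OF star_embeds_replicate[OF assms(1,3)] star_iso_embeds[OF iso']])
  show "pre_star_algebra (mat_direct_sum (replicate c d))"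
    using assms by (intro pre_star_algebra_mat_direct_sum) auto
qed

lemma sum_div_le_hybrid_cap:
  assumes d: "0 < d"
  shows "(\<Sum>b\<leftarrow>ds. b div d) \<le> hybrid_cap n m \<Phi> d"
proof (cases "(\<Sum>b\<leftarrow>ds. b div d) = 0")
  case False
  then have "transmittable n m \<Phi> (mat_direct_sum (replicate (\<Sum>b\<leftarrow>ds. b div d) d))"
    using transmittable_copies[OF d _ order_refl] by blast
  then show ?thesis unfolding hybrid_cap_def using finite_transmittable_copies[OF d] by (intro Max_ge) auto
next
  case True
  show ?thesis unfolding True by simp
qed

lemma transmittable_summand:
  assumes b: "b \<in> set ds"
  shows "transmittable n m \<Phi> (mat_algebra b)"
proof -
  have b0: "0 < b" using b pos by blast
  have "b div b \<in> set (map (\<lambda>b'. b' div b) ds)" unfolding set_map using b by (rule imageI)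
  then have "b div b \<le> (\<Sum>b'\<leftarrow>ds. b' div b)" by (rule member_le_sum_list) simp
  then have "transmittable n m \<Phi> (mat_direct_sum (replicate 1 b))" using b0 by (intro transmittable_copies) auto
  then show ?thesis using transmittable_mat_algebra_iff[OF \<Phi> b0] by simp
qed

lemma dims_le_d_max: "b \<in> set ds \<Longrightarrow> b \<le> d_max n m \<Phi>"
  unfolding d_max_def using transmittable_summand finite_transmittable_dims[OF \<Phi>] by (intro Max_ge) auto

lemma dims_range: "set ds \<subseteq> {1..d_max n m \<Phi>}"
  using pos dims_le_d_max by (auto simp: Suc_le_eq)

lemma ds_nonempty: "ds \<noteq> []"
proof
  assume "ds = []"
  then have "carrier (mat_direct_sum ds) = {[]}" by (auto simp: mat_direct_sum_sel(1))
  then have "card (carrier A) = 1" using iso bij_betw_same_card by (fastforce simp: star_iso_def)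
  then obtain a where "carrier A = {a}" by (auto simp: card_1_singleton_iff)
  then show False using pre_A by (auto simp: pre_star_algebra_def)
qed

lemma transmittable_d_max: "transmittable n m \<Phi> (mat_algebra (d_max n m \<Phi>))" "0 < d_max n m \<Phi>"
proof -
  have "transmittable n m \<Phi> (mat_algebra (hd ds))" using ds_nonempty by (intro transmittable_summand) simp
  then have "{d. transmittable n m \<Phi> (mat_algebra d)} \<noteq> {}" by blast
  from Max_in[OF finite_transmittable_dims[OF \<Phi>] this]
  show "transmittable n m \<Phi> (mat_algebra (d_max n m \<Phi>))" by (simp add: d_max_def)
  then show "0 < d_max n m \<Phi>" using not_transmittable_mat_algebra_0 by (cases "d_max n m \<Phi>") auto
qed

lemma transmittable_hybrid_cap:
  assumes d: "d \<in> {1..d_max n m \<Phi>}"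
  shows "transmittable n m \<Phi> (mat_direct_sum (replicate (hybrid_cap n m \<Phi> d) d))"
proof -
  let ?D = "d_max n m \<Phi>"
  have d0: "0 < d" using d by auto
  have "transmittable n m \<Phi> (mat_direct_sum (replicate 1 ?D))"
    using transmittable_d_max transmittable_mat_algebra_iff[OF \<Phi>] by simp
  moreover have "star_embeds (mat_direct_sum (replicate 1 d)) (mat_direct_sum (replicate 1 ?D))"
    using d d0 by (intro star_embeds_replicate) (auto simp: div_greater_zero_iff Suc_le_eq)
  moreover have "pre_star_algebra (mat_direct_sum (replicate 1 d))"
    using d0 by (intro pre_star_algebra_mat_direct_sum) auto
  ultimately have "transmittable n m \<Phi> (mat_direct_sum (replicate 1 d))"
    by (rule transmittable_embeds[OF \<Phi>])
  then have "{c. transmittable n m \<Phi> (mat_direct_sum (replicate c d))} \<noteq> {}" by blast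
  from Max_in[OF finite_transmittable_copies[OF d0] this] show ?thesis by (simp add: hybrid_cap_def)
qed

end

lemma sum_list_div_eq:
  assumes "set ds \<subseteq> {1..D}" "d \<in> {1..D}"
  shows "(\<Sum>b\<leftarrow>ds. b div d) = count_list ds d + (\<Sum>k\<in>{d<..D}. count_list ds k * (k div d))"
proof -
  have "(\<Sum>b\<leftarrow>ds. b div d) = (\<Sum>k\<in>{1..D}. count_list ds k * (k div d))"
    using assms(1) by (intro sum_list_map_eq_sum_count2) auto
  also have "\<dots> = (\<Sum>k\<in>{d..D}. count_list ds k * (k div d))"
    using assms(2) by (intro sum.mono_neutral_right) auto
  also have "{d..D} = insert d {d<..D}" using assms(2) by auto
  also have "(\<Sum>k\<in>insert d {d<..D}. count_list ds k * (k div d)) =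
      count_list ds d + (\<Sum>k\<in>{d<..D}. count_list ds k * (k div d))"
    using assms(2) by simp
  finally show ?thesis .
qed

lemma hybrid_cap_eq:
  "int (hybrid_cap n m \<Phi> d) =
    hybrid_mult n m \<Phi> d + (\<Sum>k\<in>{d<..d_max n m \<Phi>}. hybrid_mult n m \<Phi> k * int (k div d))"
  by (subst hybrid_mult.simps) (simp add: floor_divide_of_nat_eq)

lemma hybrid_mult_eq_count:
  assumes ds: "set ds \<subseteq> {1..d_max n m \<Phi>}"
    and cap: "\<And>d. d \<in> {1..d_max n m \<Phi>} \<Longrightarrow> hybrid_cap n m \<Phi> d = (\<Sum>b\<leftarrow>ds. b div d)"
    and d: "d \<in> {1..d_max n m \<Phi>}"
  shows "hybrid_mult n m \<Phi> d = int (count_list ds d)"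
  using d
proof (induction "d_max n m \<Phi> - d" arbitrary: d rule: less_induct)
  case less
  have "hybrid_mult n m \<Phi> k = int (count_list ds k)" if "k \<in> {d<..d_max n m \<Phi>}" for k
    using that less by auto
  then have "(\<Sum>k\<in>{d<..d_max n m \<Phi>}. hybrid_mult n m \<Phi> k * int (k div d)) =
      int (\<Sum>k\<in>{d<..d_max n m \<Phi>}. count_list ds k * (k div d))" by simp
  then show ?case
    using hybrid_cap_eq[of n m \<Phi> d] cap[OF less.prems] sum_list_div_eq[OF ds less.prems] by simp
qed

definition cap_dims :: "nat \<Rightarrow> nat \<Rightarrow> (complex mat \<Rightarrow> complex mat) \<Rightarrow> nat list" where
  "cap_dims n m \<Phi> = concat (map (\<lambda>d. replicate (nat (hybrid_mult n m \<Phi> d)) d) [1..<Suc (d_max n m \<Phi>)])"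

lemma capacity_algebra_eq: "capacity_algebra n m \<Phi> = mat_direct_sum (cap_dims n m \<Phi>)"
  by (simp add: capacity_algebra_def cap_dims_def)

lemma count_list_concat_replicate:
  "distinct xs \<Longrightarrow> count_list (concat (map (\<lambda>d. replicate (g d) d) xs)) a = (if a \<in> set xs then g a else 0)"
proof (induction xs)
  case (Cons x xs)
  have "count_list (replicate k x) a = (if a = x then k else 0)" for k by (induction k) auto
  with Cons show ?case by auto
qed simp

lemma set_cap_dims: "set (cap_dims n m \<Phi>) \<subseteq> {1..d_max n m \<Phi>}"
  by (auto simp: cap_dims_def)

lemma count_cap_dims:
  "count_list (cap_dims n m \<Phi>) d = (if d \<in> {1..d_max n m \<Phi>} then nat (hybrid_mult n m \<Phi> d) else 0)"
  unfolding cap_dims_def by (subst count_list_concat_replicate) auto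

lemma mset_cap_dims:
  assumes ds: "set ds \<subseteq> {1..d_max n m \<Phi>}"
    and cap: "\<And>d. d \<in> {1..d_max n m \<Phi>} \<Longrightarrow> hybrid_cap n m \<Phi> d = (\<Sum>b\<leftarrow>ds. b div d)"
  shows "mset ds = mset (cap_dims n m \<Phi>)"
proof (rule multiset_eqI)
  fix d
  show "count (mset ds) d = count (mset (cap_dims n m \<Phi>)) d"
  proof (cases "d \<in> {1..d_max n m \<Phi>}")
    case True
    then show ?thesis using hybrid_mult_eq_count[OF ds cap True]
      by (simp add: count_mset count_cap_dims)
  next
    case False
    then have "d \<notin> set ds" "d \<notin> set (cap_dims n m \<Phi>)" using ds set_cap_dims by blast+
    then show ?thesis by (metis count_mset_0_iff)
  qed
qed

lemma hybrid_cap_cap_dims: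
  assumes nonneg: "\<forall>d\<in>{1..d_max n m \<Phi>}. 0 \<le> hybrid_mult n m \<Phi> d" and d: "d \<in> {1..d_max n m \<Phi>}"
  shows "hybrid_cap n m \<Phi> d = (\<Sum>b\<leftarrow>cap_dims n m \<Phi>. b div d)"
proof -
  let ?D = "d_max n m \<Phi>"
  have "hybrid_mult n m \<Phi> k = int (count_list (cap_dims n m \<Phi>) k)" if "k \<in> {1..?D}" for k
    using nonneg that by (simp add: count_cap_dims)
  moreover have "{d<..?D} \<subseteq> {1..?D}" by auto
  ultimately have "int (hybrid_cap n m \<Phi> d) = int (count_list (cap_dims n m \<Phi>) d +
      (\<Sum>k\<in>{d<..?D}. count_list (cap_dims n m \<Phi>) k * (k div d)))"
    unfolding hybrid_cap_eq using d by (auto intro!: sum.cong)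
  then show ?thesis using sum_list_div_eq[OF set_cap_dims d] by (metis of_nat_eq_iff)
qed

theorem corollary4p7:
  fixes n m :: nat
    and \<Phi> :: "complex mat \<Rightarrow> complex mat"
  assumes "quantum_channel n m \<Phi>"
  shows "(\<forall>A :: 'a star_algebra. dominating_transmittable n m \<Phi> A \<longrightarrow>
            (\<forall>d\<in>{1..d_max n m \<Phi>}. 0 \<le> hybrid_mult n m \<Phi> d) \<and>
            star_iso A (capacity_algebra n m \<Phi>)) \<and>
         ((\<forall>d\<in>{1..d_max n m \<Phi>}. 0 \<le> hybrid_mult n m \<Phi> d) \<and>
            transmittable n m \<Phi> (capacity_algebra n m \<Phi>) \<longrightarrow>
            maximal_transmittable n m \<Phi> (capacity_algebra n m \<Phi>))"
proof (intro conjI allI impI)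
  fix A :: "'a star_algebra" assume dom: "dominating_transmittable n m \<Phi> A"
  then have A: "transmittable n m \<Phi> A" by (simp add: dominating_transmittable_def)
  obtain ds where ds: "\<forall>d\<in>set ds. 0 < d" "star_iso A (mat_direct_sum ds)"
    by (rule transmittable_iso_direct_sum[OF A])
  interpret transmittable_direct_sum n m \<Phi> A ds using assms A ds by unfold_locales
  have cap: "hybrid_cap n m \<Phi> d = (\<Sum>b\<leftarrow>ds. b div d)" if d: "d \<in> {1..d_max n m \<Phi>}" for d
  proof (rule antisym)
    have "star_embeds (mat_direct_sum (replicate (hybrid_cap n m \<Phi> d) d)) A"
      using dominating_any_type[OF dom transmittable_hybrid_cap[OF d]] .
    then have "star_embeds (mat_direct_sum (replicate (hybrid_cap n m \<Phi> d) d)) (mat_direct_sum ds)"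
      by (rule star_embeds_trans[OF _ star_iso_embeds[OF ds(2)]])
    then show "hybrid_cap n m \<Phi> d \<le> (\<Sum>b\<leftarrow>ds. b div d)" using d by (intro star_embeds_replicate_le) auto
    show "(\<Sum>b\<leftarrow>ds. b div d) \<le> hybrid_cap n m \<Phi> d" using d by (intro sum_div_le_hybrid_cap) auto
  qed
  show "\<forall>d\<in>{1..d_max n m \<Phi>}. 0 \<le> hybrid_mult n m \<Phi> d"
    using hybrid_mult_eq_count[OF dims_range cap] by simp
  show "star_iso A (capacity_algebra n m \<Phi>)"
    unfolding capacity_algebra_eq
    using ds(2) star_iso_mat_direct_sum_perm[OF mset_cap_dims[OF dims_range cap]] by (rule star_iso_trans)
next
  assume "(\<forall>d\<in>{1..d_max n m \<Phi>}. 0 \<le> hybrid_mult n m \<Phi> d) \<and> transmittable n m \<Phi> (capacity_algebra n m \<Phi>)"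
  then have nonneg: "\<forall>d\<in>{1..d_max n m \<Phi>}. 0 \<le> hybrid_mult n m \<Phi> d"
    and T: "transmittable n m \<Phi> (mat_direct_sum (cap_dims n m \<Phi>))"
    by (auto simp: capacity_algebra_eq)
  have "star_iso (mat_direct_sum (cap_dims n m \<Phi>)) B"
    if B: "transmittable n m \<Phi> B" and emb: "star_embeds (mat_direct_sum (cap_dims n m \<Phi>)) B"
    for B :: "complex mat star_algebra"
  proof -
    obtain bs where bs: "\<forall>d\<in>set bs. 0 < d" "star_iso B (mat_direct_sum bs)"
      by (rule transmittable_iso_direct_sum[OF B])
    interpret transmittable_direct_sum n m \<Phi> B bs using assms B bs by unfold_locales
    have cap: "hybrid_cap n m \<Phi> d = (\<Sum>b\<leftarrow>bs. b div d)" if d: "d \<in> {1..d_max n m \<Phi>}" for d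
    proof (rule antisym)
      have d0: "0 < d" using d by simp
      have "star_embeds (mat_direct_sum (replicate (hybrid_cap n m \<Phi> d) d)) (mat_direct_sum (cap_dims n m \<Phi>))"
        using star_embeds_replicate[OF d0] hybrid_cap_cap_dims[OF nonneg d] by simp
      then have "star_embeds (mat_direct_sum (replicate (hybrid_cap n m \<Phi> d) d)) (mat_direct_sum bs)"
        by (rule star_embeds_trans[OF star_embeds_trans[OF _ emb] star_iso_embeds[OF bs(2)]])
      then show "hybrid_cap n m \<Phi> d \<le> (\<Sum>b\<leftarrow>bs. b div d)" using d0 by (rule star_embeds_replicate_le)
      show "(\<Sum>b\<leftarrow>bs. b div d) \<le> hybrid_cap n m \<Phi> d" using d0 by (rule sum_div_le_hybrid_cap)
    qed
    show ?thesis
      using star_iso_mat_direct_sum_perm[OF mset_cap_dims[OF dims_range cap, symmetric]] iso'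
      by (rule star_iso_trans)
  qed
  then show "maximal_transmittable n m \<Phi> (capacity_algebra n m \<Phi>)"
    using T by (simp add: maximal_transmittable_def capacity_algebra_eq)
qed

end
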